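(* Let $\nu>0$, $\mu>0$, $\omega\in(-\infty,0)\cup(8,\infty)$, $\nu/\mu\notin[-\omega,8-\omega]$, and, if $\omega<0$, $\nu/\mu>-\omega$. Let $\phi_\omega=(\phi_{n,m})\in\ell^2(\mathbb Z^2)$ denote the (real-valued) localized ground state, at frequency $\omega$, of $$-\Delta\phi_{n,m}-\omega\phi_{n,m}=\frac{\nu\phi_{n,m}^3}{1+\mu\phi_{n,m}^2},\qquad (n,m)\in\mathbb Z^2.$$ Let $L_\pm$ be the bounded self-adjoint operators on $\ell^2(\mathbb Z^2)$ given by $$(L_-s)_{n,m}=-\Delta s_{n,m}-\omega s_{n,m}-\frac{\nu\phi_{n,m}^2}{1+\mu\phi_{n,m}^2}s_{n,m},$$ $$(L_+r)_{n,m}=-\Delta r_{n,m}-\omega r_{n,m}-\nu\frac{\phi_{n,m}^2(3+\mu\phi_{n,m}^2)}{(1+\mu\phi_{n,m}^2)^2}r_{n,m}.$$ Assume that (i) $\ker(L_-)=\mathrm{span}\{\phi_\omega\}$; (ii) $L_+$ possesses exactly one simple negative eigenvalue; (iii) $\ker(L_+)=\{0\}$; and assume in addition the slope condition $$\frac{d}{d\omega}M(\phi_\omega)<0,\qquad M(\psi)=\sum_{(n,m)\in\mathbb Z^2}|\psi_{n,m}|^2.$$ Then the standing wave $\psi_{n,m}(t)=e^{-i\omega t}\phi_{n,m}$ is orbitally stable in $\ell^2(\mathbb Z^2)$ for the equation $$i\dot\psi_{n,m}+\Delta\psi_{n,m}+\frac{\nu|\psi_{n,m}|^2}{1+\mu|\psi_{n,m}|^2}\psi_{n,m}=0,\qquad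 (n,m)\in\mathbb Z^2.$$
   Context: Discrete Laplacian: $(\Delta u)_{n,m}=u_{n+1,m}+u_{n-1,m}+u_{n,m+1}+u_{n,m-1}-4u_{n,m}$. Ground state at frequency $\omega$: with $F(s)=\int_0^s\frac{\nu\tau^3}{1+\mu\tau^2}d\tau$ and $J(u)=\frac12((-\Delta-\omega)u,u)-\sum_{(n,m)\in\mathbb Z^2}F(u_{n,m})$ on the real space $\ell^2(\mathbb Z^2)$, a ground state is a solution of the stationary equation which minimizes $J$ on $\mathcal N=\{u\in\ell^2(\mathbb Z^2)\setminus\{0\}:\langle J'(u),u\rangle=0\}$. Localized means exponentially decaying: $|\phi_{n,m}|\le Ce^{-\alpha|(n,m)|}$ for some $C,\alpha>0$. Orbital stability in $\ell^2(\mathbb Z^2)$ (complex-valued sequences for the dynamics): for every $\varepsilon>0$ there is $\delta>0$ such that every solution $\psi(t)$ of the evolution equation with $\inf_{\theta\in\mathbb R}\|\psi(0)-e^{i\theta}\phi_\omega\|_{\ell^2}<\delta$ satisfies $\inf_{\theta\in\mathbb R}\|\psi(t)-e^{i\theta}\phi_\omega\|_{\ell^2}<\varepsilon$ for all times $t$. The operators $L_\pm$ act on the real Hilbert space $\ell^2(\mathbb Z^2)$. *)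

theory Defs
  imports "HOL-Analysis.Analysis"
begin

section \<open>The Hilbert space of square-summable families\<close>

definition square_summable :: "('i \<Rightarrow> 'a::real_inner) \<Rightarrow> bool" where
  "square_summable f \<longleftrightarrow> (\<lambda>i. (norm (f i))\<^sup>2) summable_on UNIV"

lemma square_summable_zero: "square_summable (\<lambda>_. 0)"
  by (simp add: square_summable_def)

lemma square_summable_dominated:
  assumes "square_summable f" "\<And>i. norm (g i) \<le> B * norm (f i)"
  shows "square_summable g"
  unfolding square_summable_def
proof (rule summable_on_comparison_test)
  show "(\<lambda>i. B\<^sup>2 * (norm (f i))\<^sup>2) summable_on UNIV"
    using assms(1) unfolding square_summable_def by (rule summable_on_cmult_right)
  show "(norm (g i))\<^sup>2 \<le> B\<^sup>2 * (norm (f i))\<^sup>2" for i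
    using power_mono[OF assms(2)[of i], of 2] by (simp add: power_mult_distrib)
qed simp

lemma square_summable_add:
  assumes "square_summable f" "square_summable g"
  shows "square_summable (\<lambda>i. f i + g i)"
  unfolding square_summable_def
proof (rule summable_on_comparison_test)
  show "(\<lambda>i. 2 * (norm (f i))\<^sup>2 + 2 * (norm (g i))\<^sup>2) summable_on UNIV"
    using assms unfolding square_summable_def
    by (intro summable_on_add summable_on_cmult_right)
  show "(norm (f i + g i))\<^sup>2 \<le> 2 * (norm (f i))\<^sup>2 + 2 * (norm (g i))\<^sup>2" for i
  proof -
    have "(norm (f i + g i))\<^sup>2 \<le> (norm (f i) + norm (g i))\<^sup>2"
      by (intro power_mono norm_triangle_ineq) simp
    also have "\<dots> \<le> 2 * (norm (f i))\<^sup>2 + 2 * (norm (g i))\<^sup>2"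
      using sum_squares_bound[of "norm (f i)" "norm (g i)"] by (simp add: power2_sum)
    finally show ?thesis .
  qed
qed simp

lemma square_summable_scaleR:
  "square_summable f \<Longrightarrow> square_summable (\<lambda>i. c *\<^sub>R f i)"
  by (erule square_summable_dominated[where B = "\<bar>c\<bar>"]) simp

lemma square_summable_uminus: "square_summable f \<Longrightarrow> square_summable (\<lambda>i. - f i)"
  by (simp add: square_summable_def)

lemma square_summable_diff:
  "square_summable f \<Longrightarrow> square_summable g \<Longrightarrow> square_summable (\<lambda>i. f i - g i)"
  using square_summable_add[of f "\<lambda>i. - g i"] square_summable_uminus[of g] by simp

lemma square_summable_reindex:
  assumes "square_summable f" "bij h"
  shows "square_summable (\<lambda>i. f (h i))"
  using assms summable_on_reindex_bij_betw[of h UNIV UNIV "\<lambda>i. (norm (f i))\<^sup>2"]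
  by (simp add: square_summable_def)

lemma square_summable_inner:
  assumes "square_summable f" "square_summable g"
  shows "(\<lambda>i. inner (f i) (g i)) summable_on UNIV"
proof -
  have sq: "(\<lambda>i. (norm (f i))\<^sup>2 + (norm (g i))\<^sup>2) summable_on UNIV"
    using assms unfolding square_summable_def by (rule summable_on_add)
  have "norm (inner (f i) (g i)) \<le> (norm (f i))\<^sup>2 + (norm (g i))\<^sup>2" for i
  proof -
    have "norm (inner (f i) (g i)) \<le> norm (f i) * norm (g i)"
      by (simp add: Cauchy_Schwarz_ineq2)
    also have "\<dots> \<le> 2 * norm (f i) * norm (g i)"
      by simp
    also have "\<dots> \<le> (norm (f i))\<^sup>2 + (norm (g i))\<^sup>2"
      by (rule sum_squares_bound)
    finally show ?thesis .
  qed
  then have "(\<lambda>i. norm (inner (f i) (g i))) summable_on UNIV"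
    by (rule Infinite_Sum.abs_summable_on_comparison_test'[OF sq])
  then show ?thesis by (rule abs_summable_summable)
qed

text \<open>A multiplier of the form \<open>i \<mapsto> g (f i)\<close> with \<open>f\<close> square summable is bounded as soon as
  \<open>g\<close> is continuous at 0, because only finitely many values \<open>f i\<close> are away from 0.\<close>

lemma square_summable_multiplier:
  fixes f s :: "'i \<Rightarrow> real" and g :: "real \<Rightarrow> real"
  assumes f: "square_summable f" and s: "square_summable s" and g: "isCont g 0"
  shows "square_summable (\<lambda>i. g (f i) * s i)"
proof -
  obtain e where e: "e > 0" "\<And>x. \<bar>x\<bar> < e \<Longrightarrow> \<bar>g x - g 0\<bar> < 1"
    using g unfolding continuous_at_eps_delta
    by (metis diff_zero dist_real_def zero_less_one)
  define A where "A = {i. \<bar>f i\<bar> \<ge> e}"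
  let ?S = "\<Sum>\<^sub>\<infinity>i. (norm (f i))\<^sup>2"
  have "card G \<le> nat \<lfloor>?S / e\<^sup>2\<rfloor>" if G: "G \<subseteq> A" "finite G" for G
  proof -
    have "real (card G) * e\<^sup>2 = (\<Sum>i\<in>G. e\<^sup>2)" by simp
    also have "\<dots> \<le> (\<Sum>i\<in>G. (norm (f i))\<^sup>2)"
    proof (rule sum_mono)
      fix i assume "i \<in> G"
      then have "e \<le> \<bar>f i\<bar>" using G(1) by (auto simp: A_def)
      then show "e\<^sup>2 \<le> (norm (f i))\<^sup>2"
        using e(1) by (simp only: real_norm_def) (intro power_mono, simp_all)
    qed
    also have "\<dots> \<le> ?S"
      using f G unfolding square_summable_def by (intro finite_sum_le_infsum) auto
    finally have "real (card G) \<le> ?S / e\<^sup>2"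
      using e(1) by (simp add: pos_le_divide_eq)
    then show ?thesis
      by (simp add: le_nat_floor)
  qed
  then have fin: "finite A"
    using finite_if_finite_subsets_card_bdd[of A] by blast
  define B where "B = \<bar>g 0\<bar> + 1 + (\<Sum>i\<in>A. \<bar>g (f i)\<bar>)"
  have "\<bar>g (f i)\<bar> \<le> B" for i
  proof (cases "i \<in> A")
    case True
    then have "\<bar>g (f i)\<bar> \<le> (\<Sum>i\<in>A. \<bar>g (f i)\<bar>)"
      using fin by (intro member_le_sum) auto
    then show ?thesis by (simp add: B_def)
  next
    case False
    then have "\<bar>g (f i) - g 0\<bar> < 1" using e(2)[of "f i"] by (simp add: A_def)
    moreover have "0 \<le> (\<Sum>i\<in>A. \<bar>g (f i)\<bar>)" by (simp add: sum_nonneg)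
    ultimately show ?thesis unfolding B_def by linarith
  qed
  then show ?thesis
    by (intro square_summable_dominated[OF s, of _ B]) (simp add: abs_mult mult_right_mono)
qed

typedef (overloaded) ('i, 'a::real_inner) ell2 = "{f :: 'i \<Rightarrow> 'a. square_summable f}"
  morphisms apply_ell2 Abs_ell2
  using square_summable_zero by blast

setup_lifting type_definition_ell2

text \<open>For \<open>'a = complex\<close> the inner product below is the real one,
  \<open>Re (\<Sum>i. u i * cnj (v i))\<close>; it induces the usual norm.\<close>

instantiation ell2 :: (type, real_inner) real_inner
begin

lift_definition zero_ell2 :: "('a, 'b) ell2" is "\<lambda>_. 0"
  by (rule square_summable_zero)
lift_definition plus_ell2 :: "('a, 'b) ell2 \<Rightarrow> ('a, 'b) ell2 \<Rightarrow> ('a, 'b) ell2"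
  is "\<lambda>f g i. f i + g i" by (rule square_summable_add)
lift_definition minus_ell2 :: "('a, 'b) ell2 \<Rightarrow> ('a, 'b) ell2 \<Rightarrow> ('a, 'b) ell2"
  is "\<lambda>f g i. f i - g i" by (rule square_summable_diff)
lift_definition uminus_ell2 :: "('a, 'b) ell2 \<Rightarrow> ('a, 'b) ell2"
  is "\<lambda>f i. - f i" by (rule square_summable_uminus)
lift_definition scaleR_ell2 :: "real \<Rightarrow> ('a, 'b) ell2 \<Rightarrow> ('a, 'b) ell2"
  is "\<lambda>c f i. c *\<^sub>R f i" by (rule square_summable_scaleR)
lift_definition inner_ell2 :: "('a, 'b) ell2 \<Rightarrow> ('a, 'b) ell2 \<Rightarrow> real"
  is "\<lambda>f g. \<Sum>\<^sub>\<infinity>i. inner (f i) (g i)" .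
definition norm_ell2 :: "('a, 'b) ell2 \<Rightarrow> real"
  where "norm_ell2 u = sqrt (inner u u)"
definition sgn_ell2 :: "('a, 'b) ell2 \<Rightarrow> ('a, 'b) ell2"
  where "sgn_ell2 u = inverse (norm u) *\<^sub>R u"
definition dist_ell2 :: "('a, 'b) ell2 \<Rightarrow> ('a, 'b) ell2 \<Rightarrow> real"
  where "dist_ell2 u v = norm (u - v)"
definition uniformity_ell2 :: "(('a, 'b) ell2 \<times> ('a, 'b) ell2) filter"
  where "uniformity_ell2 = (INF e\<in>{0<..}. principal {(u, v). dist u v < e})"
definition open_ell2 :: "('a, 'b) ell2 set \<Rightarrow> bool"
  where "open_ell2 U \<longleftrightarrow> (\<forall>u\<in>U. \<forall>\<^sub>F (u', v) in uniformity. u' = u \<longrightarrow> v \<in> U)"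

instance
proof
  fix u v w :: "('a, 'b) ell2" and a b :: real
  show "u + v + w = u + (v + w)" by transfer (simp add: add.assoc)
  show "u + v = v + u" by transfer (simp add: add.commute)
  show "0 + u = u" by transfer simp
  show "- u + u = 0" by transfer simp
  show "u - v = u + - v" by transfer simp
  show "a *\<^sub>R (u + v) = a *\<^sub>R u + a *\<^sub>R v" by transfer (simp add: scaleR_add_right)
  show "(a + b) *\<^sub>R u = a *\<^sub>R u + b *\<^sub>R u" by transfer (simp add: scaleR_add_left)
  show "a *\<^sub>R b *\<^sub>R u = (a * b) *\<^sub>R u" by transfer simp
  show "1 *\<^sub>R u = u" by transfer simp
  show "dist u v = norm (u - v)" by (rule dist_ell2_def)
  show "sgn u = inverse (norm u) *\<^sub>R u" by (rule sgn_ell2_def)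
  show "norm u = sqrt (inner u u)" by (rule norm_ell2_def)
  show "inner u v = inner v u" by transfer (simp add: inner_commute)
  show "inner (u + v) w = inner u w + inner v w"
    by transfer (simp add: inner_add_left infsum_add square_summable_inner)
  show "inner (a *\<^sub>R u) v = a * inner u v"
    by transfer (simp add: infsum_cmult_right square_summable_inner)
  show "0 \<le> inner u u" by transfer (simp add: infsum_nonneg)
  show "(inner u u = 0) = (u = 0)"
  proof transfer
    fix f :: "'a \<Rightarrow> 'b" assume f: "square_summable f"
    have "f = (\<lambda>_. 0)" if "(\<Sum>\<^sub>\<infinity>i. inner (f i) (f i)) = 0"
    proof
      fix i
      have "inner (f i) (f i) = 0"
        by (rule nonneg_infsum_le_0D[where A = UNIV and f = "\<lambda>i. inner (f i) (f i)"])
          (simp_all only: that order_refl square_summable_inner[OF f f] inner_ge_zero UNIV_I)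
      then show "f i = 0" by simp
    qed
    then show "((\<Sum>\<^sub>\<infinity>i. inner (f i) (f i)) = 0) = (f = (\<lambda>_. 0))"
      by (intro iffI) (assumption | simp)+
  qed
qed (fact uniformity_ell2_def, fact open_ell2_def)

end

section \<open>The lattice equation\<close>

type_synonym site = "int \<times> int"

definition lap :: "(site \<Rightarrow> 'a::real_vector) \<Rightarrow> site \<Rightarrow> 'a" where
  "lap u = (\<lambda>(n, m). u (n + 1, m) + u (n - 1, m) + u (n, m + 1) + u (n, m - 1) - 4 *\<^sub>R u (n, m))"

lemma square_summable_lap:
  assumes "square_summable u" shows "square_summable (lap u)"
proof -
  have shift: "square_summable (\<lambda>p. u (fst p + a, snd p + b))" for a b
  proof (rule square_summable_reindex[OF assms])
    show "bij (\<lambda>p :: site. (fst p + a, snd p + b))"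
      by (rule bij_betw_byWitness[where f' = "\<lambda>p. (fst p - a, snd p - b)"]) auto
  qed
  have "lap u = (\<lambda>p. u (fst p + 1, snd p + 0) + u (fst p + - 1, snd p + 0)
      + u (fst p + 0, snd p + 1) + u (fst p + 0, snd p + - 1) - 4 *\<^sub>R u (fst p + 0, snd p + 0))"
    by (auto simp: lap_def fun_eq_iff)
  then show ?thesis
    by (simp only:) (intro square_summable_diff square_summable_add square_summable_scaleR shift)
qed

lift_definition Laplacian :: "(site, 'a::real_inner) ell2 \<Rightarrow> (site, 'a) ell2"
  is lap by (rule square_summable_lap)

definition mass :: "(site, 'a::real_inner) ell2 \<Rightarrow> real" where
  "mass u = (\<Sum>\<^sub>\<infinity>p. (norm (apply_ell2 u p))\<^sup>2)"

subsection \<open>Ground states\<close>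

text \<open>The interval integral is oriented, so this is also the intended value for negative \<open>s\<close>.\<close>

definition F_sat :: "real \<Rightarrow> real \<Rightarrow> real \<Rightarrow> real" where
  "F_sat \<nu> \<mu> s = (LBINT \<tau>=ereal 0..ereal s. \<nu> * \<tau> ^ 3 / (1 + \<mu> * \<tau>\<^sup>2))"

definition J :: "real \<Rightarrow> real \<Rightarrow> real \<Rightarrow> (site, real) ell2 \<Rightarrow> real" where
  "J \<nu> \<mu> \<omega> u = 1 / 2 * inner (- Laplacian u - \<omega> *\<^sub>R u) u
     - (\<Sum>\<^sub>\<infinity>p. F_sat \<nu> \<mu> (apply_ell2 u p))"

definition Nehari :: "real \<Rightarrow> real \<Rightarrow> real \<Rightarrow> (site, real) ell2 set" where
  "Nehari \<nu> \<mu> \<omega> = {u. u \<noteq> 0 \<and> (\<exists>J'. (J \<nu> \<mu> \<omega> has_derivative J') (at u) \<and> J' u = 0)}"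

definition stationary_solution :: "real \<Rightarrow> real \<Rightarrow> real \<Rightarrow> (site, real) ell2 \<Rightarrow> bool" where
  "stationary_solution \<nu> \<mu> \<omega> \<phi> \<longleftrightarrow>
     (\<forall>p. - lap (apply_ell2 \<phi>) p - \<omega> * apply_ell2 \<phi> p
          = \<nu> * (apply_ell2 \<phi> p) ^ 3 / (1 + \<mu> * (apply_ell2 \<phi> p)\<^sup>2))"

definition ground_state :: "real \<Rightarrow> real \<Rightarrow> real \<Rightarrow> (site, real) ell2 \<Rightarrow> bool" where
  "ground_state \<nu> \<mu> \<omega> \<phi> \<longleftrightarrow> stationary_solution \<nu> \<mu> \<omega> \<phi> \<and>
     \<phi> \<in> Nehari \<nu> \<mu> \<omega> \<and> (\<forall>u \<in> Nehari \<nu> \<mu> \<omega>. J \<nu> \<mu> \<omega> \<phi> \<le> J \<nu> \<mu> \<omega> u)"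

definition localized :: "(site, real) ell2 \<Rightarrow> bool" where
  "localized \<phi> \<longleftrightarrow> (\<exists>C>0. \<exists>\<alpha>>0. \<forall>n m.
     \<bar>apply_ell2 \<phi> (n, m)\<bar> \<le> C * exp (- \<alpha> * norm (real_of_int n, real_of_int m)))"

subsection \<open>The linearized operators\<close>

lift_definition L_minus ::
    "real \<Rightarrow> real \<Rightarrow> real \<Rightarrow> (site, real) ell2 \<Rightarrow> (site, real) ell2 \<Rightarrow> (site, real) ell2"
  is "\<lambda>\<nu> \<mu> \<omega> \<phi> s p. - lap s p - \<omega> * s p - \<nu> * (\<phi> p)\<^sup>2 / (1 + \<mu> * (\<phi> p)\<^sup>2) * s p"
proof -
  fix \<nu> \<mu> \<omega> and \<phi> s :: "site \<Rightarrow> real"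
  assume "square_summable \<phi>" and s: "square_summable s"
  then have "square_summable (\<lambda>p. \<nu> * (\<phi> p)\<^sup>2 / (1 + \<mu> * (\<phi> p)\<^sup>2) * s p)"
    by (rule square_summable_multiplier[where g = "\<lambda>x. \<nu> * x\<^sup>2 / (1 + \<mu> * x\<^sup>2)"])
      (intro continuous_intros, simp)
  then show "square_summable
      (\<lambda>p. - lap s p - \<omega> * s p - \<nu> * (\<phi> p)\<^sup>2 / (1 + \<mu> * (\<phi> p)\<^sup>2) * s p)"
    using square_summable_scaleR[OF s, of \<omega>]
    by (intro square_summable_diff square_summable_uminus square_summable_lap s) simp_all
qed

lift_definition L_plus ::
    "real \<Rightarrow> real \<Rightarrow> real \<Rightarrow> (site, real) ell2 \<Rightarrow> (site, real) ell2 \<Rightarrow> (site, real) ell2"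
  is "\<lambda>\<nu> \<mu> \<omega> \<phi> r p. - lap r p - \<omega> * r p
        - \<nu> * ((\<phi> p)\<^sup>2 * (3 + \<mu> * (\<phi> p)\<^sup>2) / (1 + \<mu> * (\<phi> p)\<^sup>2)\<^sup>2) * r p"
proof -
  fix \<nu> \<mu> \<omega> and \<phi> r :: "site \<Rightarrow> real"
  assume "square_summable \<phi>" and r: "square_summable r"
  then have "square_summable
      (\<lambda>p. \<nu> * ((\<phi> p)\<^sup>2 * (3 + \<mu> * (\<phi> p)\<^sup>2) / (1 + \<mu> * (\<phi> p)\<^sup>2)\<^sup>2) * r p)"
    by (rule square_summable_multiplier[where g = "\<lambda>x. \<nu> * (x\<^sup>2 * (3 + \<mu> * x\<^sup>2) / (1 + \<mu> * x\<^sup>2)\<^sup>2)"])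
      (intro continuous_intros, simp)
  then show "square_summable (\<lambda>p. - lap r p - \<omega> * r p
        - \<nu> * ((\<phi> p)\<^sup>2 * (3 + \<mu> * (\<phi> p)\<^sup>2) / (1 + \<mu> * (\<phi> p)\<^sup>2)\<^sup>2) * r p)"
    using square_summable_scaleR[OF r, of \<omega>]
    by (intro square_summable_diff square_summable_uminus square_summable_lap r) simp_all
qed

definition eigenspace :: "('v::real_vector \<Rightarrow> 'v) \<Rightarrow> real \<Rightarrow> 'v set" where
  "eigenspace A \<kappa> = {v. A v = \<kappa> *\<^sub>R v}"

definition eigenvalue :: "('v::real_vector \<Rightarrow> 'v) \<Rightarrow> real \<Rightarrow> bool" where
  "eigenvalue A \<kappa> \<longleftrightarrow> (\<exists>v. v \<noteq> 0 \<and> v \<in> eigenspace A \<kappa>)"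

text \<open>Used for self-adjoint operators only, so geometric and algebraic simplicity agree.
  In infinite dimension \<open>dim\<close> is 0 by convention, hence \<open>dim = 1\<close> does say one-dimensional.\<close>

definition simple_eigenvalue :: "('v::real_vector \<Rightarrow> 'v) \<Rightarrow> real \<Rightarrow> bool" where
  "simple_eigenvalue A \<kappa> \<longleftrightarrow> eigenvalue A \<kappa> \<and> dim (eigenspace A \<kappa>) = 1"

subsection \<open>Evolution and orbital stability\<close>

text \<open>Solutions are differentiable as \<open>ell2\<close>-valued curves (one-sidedly at an end point of the
  time interval); the equation then forces the derivative to be continuous.\<close>

definition solution_on ::
    "real \<Rightarrow> real \<Rightarrow> real set \<Rightarrow> (real \<Rightarrow> (site, complex) ell2) \<Rightarrow> bool" where
  "solution_on \<nu> \<mu> T \<psi> \<longleftrightarrow> (\<exists>\<psi>'. \<forall>t\<in>T.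
     (\<psi> has_vector_derivative \<psi>' t) (at t within T) \<and>
     (\<forall>p. \<i> * apply_ell2 (\<psi>' t) p + lap (apply_ell2 (\<psi> t)) p
        + of_real (\<nu> * (cmod (apply_ell2 (\<psi> t) p))\<^sup>2 / (1 + \<mu> * (cmod (apply_ell2 (\<psi> t) p))\<^sup>2))
            * apply_ell2 (\<psi> t) p = 0))"

lift_definition phase_rotation :: "real \<Rightarrow> (site, real) ell2 \<Rightarrow> (site, complex) ell2"
  is "\<lambda>\<theta> \<phi> p. exp (\<i> * of_real \<theta>) * of_real (\<phi> p)"
  by (simp add: square_summable_def norm_mult)

text \<open>The orbit of the standing wave \<open>exp (- \<i> \<omega> t) \<phi>\<close> is the set of all phase rotations of \<open>\<phi>\<close>,
  so \<open>\<omega>\<close> does not occur explicitly. No assumption is made that a solution is global: the estimate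
  holds on whatever time interval around the initial time 0 the solution lives.\<close>

definition orbitally_stable :: "real \<Rightarrow> real \<Rightarrow> (site, real) ell2 \<Rightarrow> bool" where
  "orbitally_stable \<nu> \<mu> \<phi> \<longleftrightarrow> (\<forall>\<epsilon>>0. \<exists>\<delta>>0. \<forall>T \<psi>.
     is_interval T \<and> 0 \<in> T \<and> solution_on \<nu> \<mu> T \<psi> \<and>
     (INF \<theta>. norm (\<psi> 0 - phase_rotation \<theta> \<phi>)) < \<delta> \<longrightarrow>
     (\<forall>t\<in>T. (INF \<theta>. norm (\<psi> t - phase_rotation \<theta> \<phi>)) < \<epsilon>))"

end

theory Submission
  imports Defs
begin

text \<open>
  Stability follows from coercivity of \<open>L_plus\<close> on the orthogonal complement of the profile \<open>\<phi>\<close>,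
  by the usual Lyapunov argument with the energy plus a multiple of the squared mass defect; there
  \<open>L_minus \<ge> L_plus\<close>, so that the imaginary direction needs no separate treatment.

  No continuity of the family of ground states in \<open>\<omega>\<close> is available. Instead, let \<open>d \<omega>\<close> be the least
  energy on the Nehari manifold. Using the ground state at one frequency as a test function at another
  one gives \<open>d w \<le> d w' - (w - w') / 2 * M w' + O((w - w')\<^sup>2)\<close> for the mass \<open>M\<close>, and summation over
  fine partitions turns the slope condition into the lower bound
  \<open>d (\<omega> + e) \<ge> d \<omega> - e / 2 * M \<omega> - D / 8 * e\<^sup>2\<close> for small \<open>e > 0\<close>. Testing with
  \<open>\<phi> + e h\<close>, where \<open>\<langle>L_plus \<phi>, h\<rangle> = M \<omega>\<close>, gives the upper bound
  \<open>d \<omega> - e / 2 * M \<omega> + e\<^sup>2 * (\<langle>L_plus h, h\<rangle> / 2 - \<langle>\<phi>, h\<rangle>) + O(e\<^sup>3)\<close>. Comparing the two and taking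
  \<open>h\<close> proportional to \<open>r \<bottom> \<phi>\<close> yields \<open>\<langle>L_plus r, r\<rangle> \<ge> c * \<langle>L_plus \<phi>, r\<rangle>\<^sup>2\<close>. This improves to
  coercivity by compactness and the triviality of the kernel of \<open>L_plus\<close>. For \<open>\<omega> > 8\<close> there is no
  nonzero stationary solution.
\<close>

section \<open>Square-summable families\<close>

lemmas apply_ell2_simps [simp] =
  zero_ell2.rep_eq plus_ell2.rep_eq minus_ell2.rep_eq uminus_ell2.rep_eq scaleR_ell2.rep_eq

lemma square_summable_apply_ell2: "square_summable (apply_ell2 u)"
  using apply_ell2[of u] by simp

lemma summable_on_norm_ell2_sq: "(\<lambda>p. (norm (apply_ell2 u p))\<^sup>2) summable_on UNIV"
  using square_summable_apply_ell2[of u] by (simp add: square_summable_def)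

lemma summable_on_inner_ell2: "(\<lambda>p. inner (apply_ell2 u p) (apply_ell2 v p)) summable_on UNIV"
  by (intro square_summable_inner square_summable_apply_ell2)

lemma ell2_eqI: "(\<And>p. apply_ell2 u p = apply_ell2 v p) \<Longrightarrow> u = v"
  using apply_ell2_inject by blast

lemma norm_ell2_sq: "(norm u)\<^sup>2 = (\<Sum>\<^sub>\<infinity>p. (norm (apply_ell2 u p))\<^sup>2)"
  by (simp add: power2_norm_eq_inner inner_ell2.rep_eq)

lemma mass_eq_norm_sq: "mass u = (norm u)\<^sup>2"
  by (simp add: mass_def norm_ell2_sq)

lemma norm_apply_ell2_le: "norm (apply_ell2 u p) \<le> norm u"
proof -
  have "(\<Sum>q\<in>{p}. (norm (apply_ell2 u q))\<^sup>2) \<le> (norm u)\<^sup>2"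
    unfolding norm_ell2_sq by (intro finite_sum_le_infsum summable_on_norm_ell2_sq) auto
  then show ?thesis by (simp add: power2_le_iff_abs_le)
qed

lemma norm_ell2_mono:
  assumes "\<And>p. norm (apply_ell2 u p) \<le> C * norm (apply_ell2 v p)" "0 \<le> C"
  shows "norm u \<le> C * norm v"
proof -
  have "(norm u)\<^sup>2 \<le> (\<Sum>\<^sub>\<infinity>p. C\<^sup>2 * (norm (apply_ell2 v p))\<^sup>2)"
    unfolding norm_ell2_sq
  proof (intro infsum_mono summable_on_norm_ell2_sq summable_on_cmult_right)
    show "(norm (apply_ell2 u p))\<^sup>2 \<le> C\<^sup>2 * (norm (apply_ell2 v p))\<^sup>2" for p
      using power_mono[OF assms(1)[of p], of 2] by (simp add: power_mult_distrib)
  qed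
  also have "\<dots> = (C * norm v)\<^sup>2"
    by (simp add: power_mult_distrib norm_ell2_sq infsum_cmult_right summable_on_norm_ell2_sq)
  finally show ?thesis
    using assms(2) by (simp add: power2_le_iff_abs_le)
qed

lemma finite_apply_ell2_ge:
  assumes "e > 0" shows "finite {p. e \<le> (norm (apply_ell2 u p))\<^sup>2}"
proof -
  have "card G \<le> nat \<lfloor>(norm u)\<^sup>2 / e\<rfloor>"
    if G: "G \<subseteq> {p. e \<le> (norm (apply_ell2 u p))\<^sup>2}" "finite G" for G
  proof -
    have "real (card G) * e = (\<Sum>p\<in>G. e)" by simp
    also have "\<dots> \<le> (\<Sum>p\<in>G. (norm (apply_ell2 u p))\<^sup>2)"
      using G(1) by (intro sum_mono) auto
    also have "\<dots> \<le> (norm u)\<^sup>2"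
      unfolding norm_ell2_sq using G by (intro finite_sum_le_infsum summable_on_norm_ell2_sq) auto
    finally show ?thesis
      using assms by (simp add: le_nat_floor pos_le_divide_eq)
  qed
  then show ?thesis by (rule finite_if_finite_subsets_card_bdd[THEN conjunct1, rotated]) 
qed

text \<open>Each coordinate converges by \<open>norm_apply_ell2_le\<close>. The Cauchy estimate
  restricted to a finite set of sites survives the limit, and the bound is uniform in that set, so
  it extends to the whole sum. Completeness later supplies the limit of a minimizing sequence for
  the second variation.\<close>

lemma Cauchy_ell2_convergent:
  fixes X :: "nat \<Rightarrow> ('i, 'a::{real_inner, complete_space}) ell2"
  assumes X: "Cauchy X" shows "convergent X"
proof -
  have "Cauchy (\<lambda>n. apply_ell2 (X n) p)" for p
  proof (rule metric_CauchyI)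
    fix e :: real assume "e > 0"
    then obtain N where N: "\<And>m n. m \<ge> N \<Longrightarrow> n \<ge> N \<Longrightarrow> dist (X m) (X n) < e"
      using X by (meson metric_CauchyD)
    have "dist (apply_ell2 (X m) p) (apply_ell2 (X n) p) < e" if "m \<ge> N" "n \<ge> N" for m n
      using norm_apply_ell2_le[of "X m - X n" p] N[OF that] by (simp add: dist_norm)
    then show "\<exists>M. \<forall>m\<ge>M. \<forall>n\<ge>M. dist (apply_ell2 (X m) p) (apply_ell2 (X n) p) < e" by blast
  qed
  then have "\<exists>l. (\<lambda>n. apply_ell2 (X n) p) \<longlonglongrightarrow> l" for p
    using Cauchy_convergent_iff convergent_def by metis
  then obtain f where f: "\<And>p. (\<lambda>n. apply_ell2 (X n) p) \<longlonglongrightarrow> f p" by metis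
  have bound: "(\<Sum>p\<in>G. (norm (apply_ell2 (X n) p - f p))\<^sup>2) \<le> e\<^sup>2"
    if N: "\<And>m n. m \<ge> N \<Longrightarrow> n \<ge> N \<Longrightarrow> dist (X m) (X n) < e" and "n \<ge> N" "finite G" for e N n G
  proof (rule LIMSEQ_le_const2)
    show "(\<lambda>m. \<Sum>p\<in>G. (norm (apply_ell2 (X n) p - apply_ell2 (X m) p))\<^sup>2)
        \<longlonglongrightarrow> (\<Sum>p\<in>G. (norm (apply_ell2 (X n) p - f p))\<^sup>2)"
      by (intro tendsto_intros f)
    have "(\<Sum>p\<in>G. (norm (apply_ell2 (X n) p - apply_ell2 (X m) p))\<^sup>2) \<le> e\<^sup>2" if "m \<ge> N" for m
    proof -
      have "(\<Sum>p\<in>G. (norm (apply_ell2 (X n - X m) p))\<^sup>2) \<le> (norm (X n - X m))\<^sup>2"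
        unfolding norm_ell2_sq
        by (intro finite_sum_le_infsum summable_on_norm_ell2_sq \<open>finite G\<close>) auto
      also have "\<dots> \<le> e\<^sup>2"
        using N[OF \<open>n \<ge> N\<close> that] by (intro power_mono) (auto simp: dist_norm)
      finally show ?thesis by simp
    qed
    then show "\<exists>M. \<forall>m\<ge>M. (\<Sum>p\<in>G. (norm (apply_ell2 (X n) p - apply_ell2 (X m) p))\<^sup>2) \<le> e\<^sup>2"
      by blast
  qed
  have summ: "(\<lambda>p. (norm (apply_ell2 (X n) p - f p))\<^sup>2) summable_on UNIV
      \<and> (\<Sum>\<^sub>\<infinity>p. (norm (apply_ell2 (X n) p - f p))\<^sup>2) \<le> e\<^sup>2"
    if "\<And>m n. m \<ge> N \<Longrightarrow> n \<ge> N \<Longrightarrow> dist (X m) (X n) < e" "n \<ge> N" for e N n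
  proof
    show s: "(\<lambda>p. (norm (apply_ell2 (X n) p - f p))\<^sup>2) summable_on UNIV"
      by (rule nonneg_bdd_above_summable_on) (auto intro!: bdd_aboveI2 bound[OF that])
    show "(\<Sum>\<^sub>\<infinity>p. (norm (apply_ell2 (X n) p - f p))\<^sup>2) \<le> e\<^sup>2"
      by (rule infsum_le_finite_sums[OF s]) (auto intro!: bound[OF that])
  qed
  obtain N1 where N1: "\<And>m n. m \<ge> N1 \<Longrightarrow> n \<ge> N1 \<Longrightarrow> dist (X m) (X n) < 1"
    using metric_CauchyD[OF X, of 1] by auto
  have "square_summable (\<lambda>p. apply_ell2 (X N1) p - f p)"
    unfolding square_summable_def using summ[OF N1] by blast
  from square_summable_diff[OF square_summable_apply_ell2[of "X N1"] this]
  have "square_summable f" by simp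
  then have app: "apply_ell2 (Abs_ell2 f) = f" by (simp add: Abs_ell2_inverse)
  have "X \<longlonglongrightarrow> Abs_ell2 f"
  proof (rule metric_LIMSEQ_I)
    fix e :: real assume e: "e > 0"
    obtain N where N: "\<And>m n. m \<ge> N \<Longrightarrow> n \<ge> N \<Longrightarrow> dist (X m) (X n) < e / 2"
      using metric_CauchyD[OF X, of "e / 2"] e by auto
    have "dist (X n) (Abs_ell2 f) < e" if "n \<ge> N" for n
    proof -
      have "(norm (X n - Abs_ell2 f))\<^sup>2 \<le> (e / 2)\<^sup>2"
        unfolding norm_ell2_sq using summ[OF N that] by (simp add: app)
      then have "norm (X n - Abs_ell2 f) \<le> e / 2"
        using e by (simp add: power2_le_iff_abs_le del: power_divide)
      then show ?thesis using e by (simp add: dist_norm)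
    qed
    then show "\<exists>N. \<forall>n\<ge>N. dist (X n) (Abs_ell2 f) < e" by blast
  qed
  then show ?thesis by (auto simp: convergent_def)
qed

instance ell2 :: (type, "{real_inner, complete_space}") complete_space
  by standard (rule Cauchy_ell2_convergent)

text \<open>Induction over the sites: a further subsequence settles one more coordinate and keeps
  the earlier limits. This is the compactness input of the coercivity argument, where only finitely
  many coordinates have to converge.\<close>

lemma bounded_sequences_convergent_subseq:
  fixes x :: "nat \<Rightarrow> 'i \<Rightarrow> real"
  assumes "finite A" "\<And>n p. \<bar>x n p\<bar> \<le> B"
  shows "\<exists>s::nat \<Rightarrow> nat. strict_mono s \<and> (\<forall>p\<in>A. convergent (\<lambda>n. x (s n) p))"
  using assms(1)
proof (induction rule: finite_induct)
  case empty
  show ?case using strict_mono_id by auto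
next
  case (insert q A)
  then obtain s :: "nat \<Rightarrow> nat"
    where s: "strict_mono s" "\<And>p. p \<in> A \<Longrightarrow> convergent (\<lambda>n. x (s n) p)" by blast
  have "bounded (range (\<lambda>n. x (s n) q))"
    using assms(2) by (auto intro!: boundedI)
  then obtain l r where r: "strict_mono (r :: nat \<Rightarrow> nat)" "((\<lambda>n. x (s n) q) \<circ> r) \<longlonglongrightarrow> l"
    using bounded_imp_convergent_subsequence by blast
  have "convergent (\<lambda>n. x ((s \<circ> r) n) p)" if "p \<in> insert q A" for p
  proof (cases "p = q")
    case True
    then show ?thesis using r(2) by (auto simp: convergent_def o_def)
  next
    case False
    then have "convergent ((\<lambda>n. x (s n) p) \<circ> r)"
      using that s(2) r(1) by (intro convergent_subseq_convergent) auto
    then show ?thesis by (simp add: o_def)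
  qed
  then show ?case using strict_mono_o[OF s(1) r(1)] by blast
qed

section \<open>The lattice Laplacian\<close>

lift_definition translate :: "site \<Rightarrow> (site, 'a::real_inner) ell2 \<Rightarrow> (site, 'a) ell2"
  is "\<lambda>a u p. u (p + a)"
  by (rule square_summable_reindex) (auto intro!: bij_betw_byWitness[where f' = "\<lambda>p. p - _"])

lemma translate_add: "translate a (u + v) = translate a u + translate a v"
  by transfer simp

lemma translate_scaleR: "translate a (c *\<^sub>R u) = c *\<^sub>R translate a u"
  by transfer simp

lemma infsum_translate: "(\<Sum>\<^sub>\<infinity>p. f (p + a)) = (\<Sum>\<^sub>\<infinity>p::site. f p)"
  by (rule infsum_reindex_bij_betw)
    (auto intro!: bij_betw_byWitness[where f' = "\<lambda>p. p - a"])

lemma inner_translate: "inner (translate a u) v = inner u (translate (- a) v)"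
  unfolding inner_ell2.rep_eq translate.rep_eq
  by (subst infsum_translate[of _ a, symmetric]) simp

lemma norm_translate: "norm (translate a u) = norm u"
proof -
  have "(norm (translate a u))\<^sup>2 = (norm u)\<^sup>2"
    unfolding norm_ell2_sq translate.rep_eq
    by (rule infsum_translate[of "\<lambda>p. (norm (apply_ell2 u p))\<^sup>2"])
  then show ?thesis by simp
qed

lemma Laplacian_eq_translates:
  "Laplacian u = translate (1, 0) u + translate (- 1, 0) u + translate (0, 1) u
    + translate (0, - 1) u - 4 *\<^sub>R u"
  by transfer (auto simp: lap_def fun_eq_iff)

lemma inner_Laplacian: "inner (Laplacian u) v = inner u (Laplacian v)"
  by (simp add: Laplacian_eq_translates inner_simps inner_translate zero_prod_def)

lemma bounded_linear_Laplacian: "bounded_linear Laplacian"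
proof (rule bounded_linear_intro)
  show "Laplacian (u + v) = Laplacian u + Laplacian v" for u v :: "(site, 'a) ell2"
    by (simp add: Laplacian_eq_translates translate_add algebra_simps)
  show "Laplacian (c *\<^sub>R u) = c *\<^sub>R Laplacian u" for c and u :: "(site, 'a) ell2"
    by (simp add: Laplacian_eq_translates translate_scaleR algebra_simps)
  \<comment> \<open>Four isometric translates and the diagonal term with factor 4.\<close>
  show "norm (Laplacian u) \<le> norm u * 8" for u :: "(site, 'a) ell2"
    unfolding Laplacian_eq_translates
    by (rule norm_triangle_le_diff, rule order_trans, rule add_right_mono, 
      (rule order_trans[OF norm_triangle_ineq] add_mono order_refl)+) (simp_all add: norm_translate)
qed

lemmas linear_Laplacian = bounded_linear.linear[OF bounded_linear_Laplacian]

lemma abs_inner_translate_le: "\<bar>inner (translate a u) u\<bar> \<le> (norm u)\<^sup>2"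
  using Cauchy_Schwarz_ineq2[of "translate a u" u] by (simp add: norm_translate power2_eq_square)

text \<open>The negative Laplacian is 4 minus four translations, and each translation contributes at
  most \<open>(norm u)\<^sup>2\<close> in absolute value. This is the spectral band [0, 8].\<close>

lemma inner_Laplacian_bounds:
  "0 \<le> inner (- Laplacian u) u" "inner (- Laplacian u) u \<le> 8 * (norm u)\<^sup>2"
  using abs_inner_translate_le[of "(1, 0)" u] abs_inner_translate_le[of "(- 1, 0)" u]
    abs_inner_translate_le[of "(0, 1)" u] abs_inner_translate_le[of "(0, - 1)" u]
  by (auto simp: Laplacian_eq_translates inner_simps power2_norm_eq_inner)

section \<open>The energy functional\<close>

lemma has_sum_diff_real:
  fixes f g :: "'i \<Rightarrow> real"
  assumes "(f has_sum a) A" "(g has_sum b) A"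
  shows "((\<lambda>x. f x - g x) has_sum (a - b)) A"
  using has_sum_add[OF assms(1) has_sum_uminusI[OF assms(2)]] by simp

lemma
  fixes f g :: "'i \<Rightarrow> real"
  assumes "f summable_on A" "g summable_on A"
  shows summable_on_diff_real: "(\<lambda>x. f x - g x) summable_on A"
    and infsum_diff_real: "(\<Sum>\<^sub>\<infinity>x\<in>A. f x - g x) = infsum f A - infsum g A"
  using has_sum_diff_real[OF has_sum_infsum[OF assms(1)] has_sum_infsum[OF assms(2)]]
  by (auto simp: summable_on_def infsumI)

section \<open>The saturable nonlinearity and the functional with its first two derivatives\<close>

definition sat_coeff :: "real \<Rightarrow> real \<Rightarrow> real \<Rightarrow> real" where
  "sat_coeff \<nu> \<mu> s = \<nu> * s / (1 + \<mu> * s)"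

text \<open>\<open>F_sat\<close> in the variable \<open>s = |u|\<^sup>2\<close>, in which it is convex.\<close>

definition sat_pot :: "real \<Rightarrow> real \<Rightarrow> real \<Rightarrow> real" where
  "sat_pot \<nu> \<mu> s = \<nu> / (2 * \<mu>) * (s - ln (1 + \<mu> * s) / \<mu>)"

text \<open>The value type is an arbitrary inner product space, so that the real stationary problem
  and the complex evolution share one calculus.\<close>

lift_definition saturation ::
    "real \<Rightarrow> real \<Rightarrow> ('i, 'a::real_inner) ell2 \<Rightarrow> ('i, 'a) ell2"
  is "\<lambda>\<nu> \<mu> u p. sat_coeff \<nu> \<mu> ((norm (u p))\<^sup>2) *\<^sub>R u p"
proof -
  fix \<nu> \<mu> and u :: "'i \<Rightarrow> 'a"
  assume "square_summable u"
  \<comment> \<open>\<open>square_summable_multiplier\<close> concerns real families, hence the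
    detour through the pointwise norm.\<close>
  then have n: "square_summable (\<lambda>p. norm (u p))"
    by (simp add: square_summable_def)
  have "square_summable (\<lambda>p. sat_coeff \<nu> \<mu> ((norm (u p))\<^sup>2) * norm (u p))"
    by (rule square_summable_multiplier[OF n n, where g = "\<lambda>x. sat_coeff \<nu> \<mu> (x\<^sup>2)"])
      (auto simp: sat_coeff_def intro!: continuous_intros)
  then show "square_summable (\<lambda>p. sat_coeff \<nu> \<mu> ((norm (u p))\<^sup>2) *\<^sub>R u p)"
    by (rule square_summable_dominated[where B = 1]) (simp add: abs_mult)
qed

text \<open>On real families this is \<open>J\<close>; on complex ones it is the Hamiltonian minus
  w/2 times the mass, the conserved quantity behind the Lyapunov function.\<close>

definition energy :: "real \<Rightarrow> real \<Rightarrow> real \<Rightarrow> (site, 'a::real_inner) ell2 \<Rightarrow> real" where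
  "energy \<nu> \<mu> w u = 1 / 2 * inner (- Laplacian u - w *\<^sub>R u) u
     - (\<Sum>\<^sub>\<infinity>p. sat_pot \<nu> \<mu> ((norm (apply_ell2 u p))\<^sup>2))"

definition energy_grad ::
    "real \<Rightarrow> real \<Rightarrow> real \<Rightarrow> (site, 'a::real_inner) ell2 \<Rightarrow> (site, 'a) ell2" where
  "energy_grad \<nu> \<mu> w u = - Laplacian u - w *\<^sub>R u - saturation \<nu> \<mu> u"

text \<open>The second derivative at e = 0 of
  \<open>sat_pot \<nu> \<mu> ((norm (z + e *\<^sub>R y))\<^sup>2)\<close>. The first term comes from
  the curvature of the squared norm, the second from that of \<open>sat_pot\<close>.\<close>

definition hess_density :: "real \<Rightarrow> real \<Rightarrow> 'a::real_inner \<Rightarrow> 'a \<Rightarrow> real" where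
  "hess_density \<nu> \<mu> z y = sat_coeff \<nu> \<mu> ((norm z)\<^sup>2) * (norm y)\<^sup>2
     + 2 * \<nu> / (1 + \<mu> * (norm z)\<^sup>2)\<^sup>2 * (inner z y)\<^sup>2"

definition energy_hess ::
    "real \<Rightarrow> real \<Rightarrow> real \<Rightarrow> (site, 'a::real_inner) ell2 \<Rightarrow> (site, 'a) ell2 \<Rightarrow> real" where
  "energy_hess \<nu> \<mu> w u v = inner (- Laplacian v - w *\<^sub>R v) v
     - (\<Sum>\<^sub>\<infinity>p. hess_density \<nu> \<mu> (apply_ell2 u p) (apply_ell2 v p))"

lemma inner_saturation: "inner (saturation \<nu> \<mu> u) u
    = (\<Sum>\<^sub>\<infinity>p. sat_coeff \<nu> \<mu> ((norm (apply_ell2 u p))\<^sup>2) * (norm (apply_ell2 u p))\<^sup>2)"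
  by (simp add: inner_ell2.rep_eq saturation.rep_eq power2_norm_eq_inner)

lemma summable_on_saturation:
  "(\<lambda>p. sat_coeff \<nu> \<mu> ((norm (apply_ell2 u p))\<^sup>2) * (norm (apply_ell2 u p))\<^sup>2) summable_on UNIV"
  using summable_on_inner_ell2[of "saturation \<nu> \<mu> u" u]
  by (simp add: saturation.rep_eq power2_norm_eq_inner)

context
  fixes \<nu> \<mu> :: real
  assumes \<nu>: "\<nu> > 0" and \<mu>: "\<mu> > 0"
begin

section \<open>Pointwise estimates for the potential\<close>

lemma sat_coeff_nonneg: "0 \<le> s \<Longrightarrow> 0 \<le> sat_coeff \<nu> \<mu> s"
  using \<nu> \<mu> by (simp add: sat_coeff_def)

lemma sat_coeff_le: "0 \<le> s \<Longrightarrow> sat_coeff \<nu> \<mu> s \<le> \<nu> / \<mu>"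
proof -
  assume s: "0 \<le> s"
  then have "0 < 1 + \<mu> * s" using \<mu> by (simp add: add_pos_nonneg)
  then show ?thesis using \<nu> \<mu> s by (simp add: sat_coeff_def divide_simps)
qed

lemma sat_pot_nonneg: "0 \<le> s \<Longrightarrow> 0 \<le> sat_pot \<nu> \<mu> s"
  using \<nu> \<mu> ln_add_one_self_le_self[of "\<mu> * s"] by (simp add: sat_pot_def divide_simps mult.commute)

lemma sat_pot_le: "0 \<le> s \<Longrightarrow> sat_pot \<nu> \<mu> s \<le> \<nu> / (2 * \<mu>) * s"
  unfolding sat_pot_def using \<nu> \<mu> by (intro mult_left_mono) auto

lemma sat_pot_deriv:
  assumes "0 \<le> s"
  shows "(sat_pot \<nu> \<mu> has_real_derivative sat_coeff \<nu> \<mu> s / 2) (at s)"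
proof -
  have pos: "1 + \<mu> * s > 0" using \<mu> assms by (simp add: add_pos_nonneg)
  have "((\<lambda>s. \<nu> / (2 * \<mu>) * (s - ln (1 + \<mu> * s) / \<mu>)) has_real_derivative
      \<nu> / (2 * \<mu>) * (1 - (1 / (1 + \<mu> * s) * \<mu>) / \<mu>)) (at s)"
    using pos by (auto intro!: derivative_eq_intros)
  moreover have "\<nu> / (2 * \<mu>) * (1 - (1 / (1 + \<mu> * s) * \<mu>) / \<mu>) = sat_coeff \<nu> \<mu> s / 2"
    using pos \<mu> by (simp add: sat_coeff_def divide_simps)
  ultimately show ?thesis by (simp only: sat_pot_def[abs_def])
qed

lemma sat_coeff_deriv:
  assumes "0 \<le> s"
  shows "((\<lambda>s. sat_coeff \<nu> \<mu> s / 2) has_real_derivative \<nu> / (2 * (1 + \<mu> * s)\<^sup>2)) (at s)"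
proof -
  have pos: "1 + \<mu> * s > 0" using \<mu> assms by (simp add: add_pos_nonneg)
  have "((\<lambda>s. \<nu> * s / (1 + \<mu> * s)) has_real_derivative
      (\<nu> * (1 + \<mu> * s) - \<nu> * s * \<mu>) / ((1 + \<mu> * s) * (1 + \<mu> * s))) (at s)"
    using pos by (auto intro!: derivative_eq_intros)
  from DERIV_cdivide[OF this, of 2]
  have "((\<lambda>s. \<nu> * s / (1 + \<mu> * s) / 2) has_real_derivative
      (\<nu> * (1 + \<mu> * s) - \<nu> * s * \<mu>) / ((1 + \<mu> * s) * (1 + \<mu> * s)) / 2) (at s)" .
  moreover have "\<nu> * (1 + \<mu> * s) - \<nu> * s * \<mu> = \<nu>" by (simp add: algebra_simps)
  moreover have "\<nu> / (X * X) / 2 = \<nu> / (2 * X\<^sup>2)" for X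
    by (simp add: power2_eq_square mult.commute)
  ultimately show ?thesis by (simp only: sat_coeff_def)
qed

lemma sat_coeff_deriv2:
  assumes "0 \<le> s"
  shows "((\<lambda>s. \<nu> / (2 * (1 + \<mu> * s)\<^sup>2)) has_real_derivative - \<nu> * \<mu> / (1 + \<mu> * s) ^ 3) (at s)"
proof -
  have pos: "1 + \<mu> * s > 0" using \<mu> assms by (simp add: add_pos_nonneg)
  then have "((\<lambda>s. \<nu> / 2 * inverse ((1 + \<mu> * s)\<^sup>2)) has_real_derivative
      \<nu> / 2 * (- (inverse ((1 + \<mu> * s)\<^sup>2) * (2 * (1 + \<mu> * s) * \<mu>) * inverse ((1 + \<mu> * s)\<^sup>2)))) (at s)"
    by (auto intro!: derivative_eq_intros)
  moreover have "\<nu> / 2 * (- (inverse (X\<^sup>2) * (2 * X * \<mu>) * inverse (X\<^sup>2))) = - \<nu> * \<mu> / X ^ 3"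
    if "X > 0" for X
    using that by (simp add: divide_simps power2_eq_square power3_eq_cube)
  moreover have "\<nu> / 2 * inverse Y = \<nu> / (2 * Y)" for Y
    by (simp add: divide_simps)
  ultimately show ?thesis
    using pos by (simp only:)
qed

text \<open>Taylor's formula of order three: the third derivative is bounded by \<nu> \<mu> in
  absolute value on the half line s \<ge> 0.\<close>

lemma sat_pot_Taylor:
  assumes "0 \<le> s" "0 \<le> t"
  shows "\<bar>sat_pot \<nu> \<mu> t - sat_pot \<nu> \<mu> s - sat_coeff \<nu> \<mu> s / 2 * (t - s)
      - \<nu> / (4 * (1 + \<mu> * s)\<^sup>2) * (t - s)\<^sup>2\<bar> \<le> \<nu> * \<mu> / 6 * \<bar>t - s\<bar> ^ 3"
proof (cases "s = t")
  case False
  define diff where "diff = (\<lambda>m::nat. if m = 0 then sat_pot \<nu> \<mu> else if m = 1 then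
      (\<lambda>s. sat_coeff \<nu> \<mu> s / 2) else if m = 2 then (\<lambda>s. \<nu> / (2 * (1 + \<mu> * s)\<^sup>2))
      else (\<lambda>s. - \<nu> * \<mu> / (1 + \<mu> * s) ^ 3))"
  have "\<exists>x. (if t < s then t < x \<and> x < s else s < x \<and> x < t) \<and> sat_pot \<nu> \<mu> t
      = (\<Sum>m<3. diff m s / fact m * (t - s) ^ m) + diff 3 x / fact 3 * (t - s) ^ 3"
  proof (rule Taylor[where a = "min s t" and b = "max s t"])
    show "\<forall>m x. m < 3 \<and> min s t \<le> x \<and> x \<le> max s t
        \<longrightarrow> ((diff m) has_real_derivative diff (Suc m) x) (at x)"
    proof (intro allI impI)
      fix m :: nat and x assume m: "m < 3 \<and> min s t \<le> x \<and> x \<le> max s t"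
      then have x: "0 \<le> x" and "m = 0 \<or> m = 1 \<or> m = 2" using assms by auto
      then show "((diff m) has_real_derivative diff (Suc m) x) (at x)"
        using sat_pot_deriv[OF x] sat_coeff_deriv[OF x] sat_coeff_deriv2[OF x]
        by (auto simp: diff_def)
    qed
  qed (use False in \<open>auto simp: diff_def\<close>)
  then obtain x where xb: "if t < s then t < x \<and> x < s else s < x \<and> x < t"
    and xe: "sat_pot \<nu> \<mu> t = (\<Sum>m<3. diff m s / fact m * (t - s) ^ m) + diff 3 x / fact 3 * (t - s) ^ 3"
    by blast
  have x: "0 \<le> x" using xb assms by (auto split: if_splits)
  have "1 \<le> (1 + \<mu> * x) ^ 3" using x \<mu> by simp
  then have "\<nu> * \<mu> / (1 + \<mu> * x) ^ 3 \<le> \<nu> * \<mu>"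
    using \<nu> \<mu> x divide_left_mono[of 1 "(1 + \<mu> * x) ^ 3" "\<nu> * \<mu>"] by (simp add: add_pos_nonneg)
  moreover have "sat_pot \<nu> \<mu> t - sat_pot \<nu> \<mu> s - sat_coeff \<nu> \<mu> s / 2 * (t - s)
      - \<nu> / (4 * (1 + \<mu> * s)\<^sup>2) * (t - s)\<^sup>2 = - (\<nu> * \<mu> / (1 + \<mu> * x) ^ 3) / 6 * (t - s) ^ 3"
    unfolding xe by (simp add: diff_def numeral_3_eq_3 fact_numeral power2_eq_square)
  moreover have "\<bar>- (\<nu> * \<mu> / (1 + \<mu> * x) ^ 3) / 6 * (t - s) ^ 3\<bar>
      = (\<nu> * \<mu> / (1 + \<mu> * x) ^ 3) / 6 * \<bar>t - s\<bar> ^ 3"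
    using \<nu> \<mu> x by (simp add: abs_mult power_abs)
  ultimately show ?thesis
    by (simp only:) (intro mult_right_mono divide_right_mono, simp_all)
qed simp

text \<open>The second derivative decreases in s, so on [0, B] it is at least its value at B; half
  of that value is the quadratic coefficient.\<close>

lemma sat_pot_strongly_convex:
  assumes "0 \<le> s" "s \<le> B" "0 \<le> t" "t \<le> B"
  shows "sat_pot \<nu> \<mu> s + sat_coeff \<nu> \<mu> s / 2 * (t - s) + \<nu> / (4 * (1 + \<mu> * B)\<^sup>2) * (t - s)\<^sup>2
    \<le> sat_pot \<nu> \<mu> t"
proof (cases "s = t")
  case False
  define diff where "diff = (\<lambda>m::nat. if m = 0 then sat_pot \<nu> \<mu> else if m = 1 then
      (\<lambda>s. sat_coeff \<nu> \<mu> s / 2) else (\<lambda>s. \<nu> / (2 * (1 + \<mu> * s)\<^sup>2)))"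
  have "\<exists>x. (if t < s then t < x \<and> x < s else s < x \<and> x < t) \<and> sat_pot \<nu> \<mu> t
      = (\<Sum>m<2. diff m s / fact m * (t - s) ^ m) + diff 2 x / fact 2 * (t - s) ^ 2"
  proof (rule Taylor[where a = "min s t" and b = "max s t"])
    show "\<forall>m x. m < 2 \<and> min s t \<le> x \<and> x \<le> max s t
        \<longrightarrow> ((diff m) has_real_derivative diff (Suc m) x) (at x)"
    proof (intro allI impI)
      fix m :: nat and x assume m: "m < 2 \<and> min s t \<le> x \<and> x \<le> max s t"
      then have x: "0 \<le> x" and "m = 0 \<or> m = 1" using assms by auto
      then show "((diff m) has_real_derivative diff (Suc m) x) (at x)"
        using sat_pot_deriv[OF x] sat_coeff_deriv[OF x]
        by (auto simp: diff_def)
    qed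
  qed (use False in \<open>auto simp: diff_def\<close>)
  then obtain x where xb: "if t < s then t < x \<and> x < s else s < x \<and> x < t"
    and xe: "sat_pot \<nu> \<mu> t = (\<Sum>m<2. diff m s / fact m * (t - s) ^ m) + diff 2 x / fact 2 * (t - s) ^ 2"
    by blast
  have x: "0 \<le> x" "x \<le> B" using xb assms by (auto split: if_splits)
  have pos: "0 < 1 + \<mu> * x" "0 < 1 + \<mu> * B"
    using x \<mu> by (auto intro!: add_pos_nonneg)
  have "(1 + \<mu> * x)\<^sup>2 \<le> (1 + \<mu> * B)\<^sup>2"
    using x \<mu> by (intro power_mono) auto
  then have "\<nu> / (4 * (1 + \<mu> * B)\<^sup>2) \<le> \<nu> / (4 * (1 + \<mu> * x)\<^sup>2)"
    using \<nu> pos by (intro divide_left_mono) auto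
  then have "\<nu> / (4 * (1 + \<mu> * B)\<^sup>2) * (t - s)\<^sup>2 \<le> \<nu> / (4 * (1 + \<mu> * x)\<^sup>2) * (t - s)\<^sup>2"
    by (rule mult_right_mono) simp
  then show ?thesis
    unfolding xe by (simp add: diff_def numeral_2_eq_2)
qed simp

lemma sat_pot_norm_Taylor:
  fixes z y :: "'a::real_inner"
  assumes R: "norm z \<le> R" "norm y \<le> R"
  shows "\<bar>sat_pot \<nu> \<mu> ((norm (z + y))\<^sup>2) - sat_pot \<nu> \<mu> ((norm z)\<^sup>2)
      - sat_coeff \<nu> \<mu> ((norm z)\<^sup>2) * inner z y - 1 / 2 * hess_density \<nu> \<mu> z y\<bar>
    \<le> (5 / 4 * \<nu> * R + 9 / 2 * \<nu> * \<mu> * R ^ 3) * norm y ^ 3"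
proof -
  define i n where "i = inner z y" and "n = norm y"
  define s where "s = (norm z)\<^sup>2"
  define a where "a = \<nu> / (4 * (1 + \<mu> * s)\<^sup>2)"
  have n0: "0 \<le> n" and R0: "0 \<le> R" and s0: "0 \<le> s" and nR: "n \<le> R"
    using R order_trans[OF norm_ge_zero R(1)] by (auto simp: n_def s_def)
  have i: "\<bar>i\<bar> \<le> R * n"
    unfolding i_def n_def
    using Cauchy_Schwarz_ineq2[of z y] mult_right_mono[OF R(1) norm_ge_zero[of y]] by linarith
  have e: "(norm (z + y))\<^sup>2 - s = 2 * i + n\<^sup>2"
    by (simp add: power2_norm_eq_inner inner_simps i_def n_def s_def inner_commute)
  have n2: "n\<^sup>2 \<le> R * n" using mult_right_mono[OF nR n0] by (simp add: power2_eq_square)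
  have "\<bar>2 * i + n\<^sup>2\<bar> \<le> 3 * R * n"
    using i n2 zero_le_power2[of n] by linarith
  then have "\<bar>2 * i + n\<^sup>2\<bar> ^ 3 \<le> (3 * R * n) ^ 3" by (intro power_mono) auto
  then have "\<nu> * \<mu> / 6 * \<bar>2 * i + n\<^sup>2\<bar> ^ 3 \<le> \<nu> * \<mu> / 6 * (3 * R * n) ^ 3"
    using \<nu> \<mu> by (intro mult_left_mono) auto
  then have 1: "\<nu> * \<mu> / 6 * \<bar>2 * i + n\<^sup>2\<bar> ^ 3 \<le> 9 / 2 * \<nu> * \<mu> * R ^ 3 * n ^ 3"
    by (simp add: power_mult_distrib mult.left_commute[of \<mu>])
  have "1 \<le> (1 + \<mu> * s)\<^sup>2" using s0 \<mu> by simp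
  then have a: "0 \<le> a" "a \<le> \<nu> / 4"
    using \<nu> by (simp_all add: a_def divide_simps)
  have n3: "n\<^sup>2 * n\<^sup>2 \<le> R * n ^ 3"
    using mult_right_mono[OF nR, of "n ^ 3"] n0 by (simp add: power2_eq_square power3_eq_cube)
  have "\<bar>i * n\<^sup>2\<bar> \<le> R * n ^ 3"
    using mult_right_mono[OF i, of "n\<^sup>2"] by (simp add: abs_mult power2_eq_square power3_eq_cube mult.assoc)
  then have "\<bar>4 * (i * n\<^sup>2) + n\<^sup>2 * n\<^sup>2\<bar> \<le> 5 * (R * n ^ 3)"
    using n3 zero_le_power2[of "n * n"] unfolding abs_le_iff power2_eq_square by linarith
  then have "a * \<bar>4 * (i * n\<^sup>2) + n\<^sup>2 * n\<^sup>2\<bar> \<le> \<nu> / 4 * (5 * (R * n ^ 3))"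
    using a \<nu> by (intro mult_mono) auto
  then have 2: "\<bar>a * (4 * (i * n\<^sup>2) + n\<^sup>2 * n\<^sup>2)\<bar> \<le> 5 / 4 * \<nu> * R * n ^ 3"
    using a by (simp add: abs_mult)
  have 3: "\<bar>sat_pot \<nu> \<mu> ((norm (z + y))\<^sup>2) - sat_pot \<nu> \<mu> s - sat_coeff \<nu> \<mu> s / 2 * (2 * i + n\<^sup>2)
      - a * (2 * i + n\<^sup>2)\<^sup>2\<bar> \<le> \<nu> * \<mu> / 6 * \<bar>2 * i + n\<^sup>2\<bar> ^ 3"
    using sat_pot_Taylor[of s "(norm (z + y))\<^sup>2"] s0 unfolding e by (simp add: a_def)
  have "hess_density \<nu> \<mu> z y = sat_coeff \<nu> \<mu> s * n\<^sup>2 + 8 * a * i\<^sup>2"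
    by (simp add: hess_density_def s_def n_def a_def i_def)
  then have "sat_pot \<nu> \<mu> ((norm (z + y))\<^sup>2) - sat_pot \<nu> \<mu> s
      - sat_coeff \<nu> \<mu> s * i - 1 / 2 * hess_density \<nu> \<mu> z y
    = (sat_pot \<nu> \<mu> ((norm (z + y))\<^sup>2) - sat_pot \<nu> \<mu> s - sat_coeff \<nu> \<mu> s / 2 * (2 * i + n\<^sup>2)
      - a * (2 * i + n\<^sup>2)\<^sup>2) + a * (4 * (i * n\<^sup>2) + n\<^sup>2 * n\<^sup>2)"
    by (simp add: algebra_simps power2_eq_square)
  then show ?thesis
    using 1 2 3 unfolding s_def[symmetric] i_def[symmetric] n_def[symmetric] distrib_right
    by linarith
qed

text \<open>The bound uniform in z makes the second variation a bounded form; the bound with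
  \<open>(norm z)\<^sup>2\<close> makes the potential small wherever the profile is small.\<close>

lemma hess_density_bounds:
  fixes z y :: "'a::real_inner"
  shows "0 \<le> hess_density \<nu> \<mu> z y" "hess_density \<nu> \<mu> z y \<le> 3 * \<nu> / \<mu> * (norm y)\<^sup>2"
    "hess_density \<nu> \<mu> z y \<le> 3 * \<nu> * (norm z)\<^sup>2 * (norm y)\<^sup>2"
proof -
  define s where "s = (norm z)\<^sup>2"
  have s: "0 \<le> s" by (simp add: s_def)
  have p: "1 \<le> 1 + \<mu> * s" using s \<mu> by simp
  have i: "(inner z y)\<^sup>2 \<le> s * (norm y)\<^sup>2"
    using Cauchy_Schwarz_ineq[of z y] by (simp add: s_def power2_norm_eq_inner)
  have h: "hess_density \<nu> \<mu> z y
      \<le> sat_coeff \<nu> \<mu> s * (norm y)\<^sup>2 + 2 * \<nu> / (1 + \<mu> * s)\<^sup>2 * (s * (norm y)\<^sup>2)"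
    unfolding hess_density_def s_def[symmetric] using i \<nu>
    by (intro add_left_mono mult_left_mono) auto
  have q: "1 \<le> (1 + \<mu> * s)\<^sup>2" "\<mu> * s \<le> (1 + \<mu> * s)\<^sup>2"
    using p s \<mu> by (simp_all add: power2_eq_square algebra_simps)
  have "2 * \<nu> / (1 + \<mu> * s)\<^sup>2 * s \<le> 2 * \<nu> / \<mu>"
    using q \<nu> \<mu> s p by (simp add: divide_simps) (simp add: mult.commute mult.left_commute)
  from add_mono[OF sat_coeff_le[OF s] this]
  have "sat_coeff \<nu> \<mu> s + 2 * \<nu> / (1 + \<mu> * s)\<^sup>2 * s \<le> 3 * \<nu> / \<mu>"
    by (simp add: add_divide_distrib[symmetric])
  from mult_right_mono[OF this zero_le_power2[of "norm y"]] h
  show "hess_density \<nu> \<mu> z y \<le> 3 * \<nu> / \<mu> * (norm y)\<^sup>2"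
    by (simp add: algebra_simps)
  have "2 * \<nu> / (1 + \<mu> * s)\<^sup>2 * s \<le> 2 * \<nu> * s"
    using q(1) \<nu> s p mult_left_mono[OF q(1) s] by (simp add: divide_simps)
  moreover have "sat_coeff \<nu> \<mu> s \<le> \<nu> * s"
    using p s \<nu> mult_left_mono[OF p s] by (simp add: sat_coeff_def divide_le_eq)
  ultimately have "sat_coeff \<nu> \<mu> s + 2 * \<nu> / (1 + \<mu> * s)\<^sup>2 * s \<le> 3 * \<nu> * s"
    by linarith
  from mult_right_mono[OF this zero_le_power2[of "norm y"]] h
  show "hess_density \<nu> \<mu> z y \<le> 3 * \<nu> * (norm z)\<^sup>2 * (norm y)\<^sup>2"
    unfolding s_def[symmetric] by (simp add: algebra_simps)
  show "0 \<le> hess_density \<nu> \<mu> z y"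
    unfolding hess_density_def using \<nu> by (intro add_nonneg_nonneg mult_nonneg_nonneg sat_coeff_nonneg) auto
qed

section \<open>Summation over the lattice and differentiability\<close>

lemma summable_on_sat_pot: "(\<lambda>p. sat_pot \<nu> \<mu> ((norm (apply_ell2 u p))\<^sup>2)) summable_on UNIV"
  by (rule summable_on_comparison_test
      [where f = "\<lambda>p. \<nu> / (2 * \<mu>) * (norm (apply_ell2 u p))\<^sup>2"])
    (intro summable_on_cmult_right summable_on_norm_ell2_sq, use sat_pot_le sat_pot_nonneg in simp_all)

lemma summable_on_hess_density:
  "(\<lambda>p. hess_density \<nu> \<mu> (apply_ell2 u p) (apply_ell2 v p)) summable_on UNIV"
  by (rule summable_on_comparison_test
      [where f = "\<lambda>p. 3 * \<nu> / \<mu> * (norm (apply_ell2 v p))\<^sup>2"])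
    (intro summable_on_cmult_right summable_on_norm_ell2_sq, use hess_density_bounds in simp_all)

lemma infsum_hess_density_bounds:
  "0 \<le> (\<Sum>\<^sub>\<infinity>p. hess_density \<nu> \<mu> (apply_ell2 u p) (apply_ell2 v p))"
  "(\<Sum>\<^sub>\<infinity>p. hess_density \<nu> \<mu> (apply_ell2 u p) (apply_ell2 v p)) \<le> 3 * \<nu> / \<mu> * (norm v)\<^sup>2"
proof -
  have "(\<Sum>\<^sub>\<infinity>p. hess_density \<nu> \<mu> (apply_ell2 u p) (apply_ell2 v p))
      \<le> (\<Sum>\<^sub>\<infinity>p. 3 * \<nu> / \<mu> * (norm (apply_ell2 v p))\<^sup>2)"
    by (intro infsum_mono summable_on_hess_density summable_on_cmult_right
        summable_on_norm_ell2_sq hess_density_bounds)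
  then show "(\<Sum>\<^sub>\<infinity>p. hess_density \<nu> \<mu> (apply_ell2 u p) (apply_ell2 v p))
      \<le> 3 * \<nu> / \<mu> * (norm v)\<^sup>2"
    by (simp only: infsum_cmult_right[OF summable_on_norm_ell2_sq] norm_ell2_sq)
qed (intro infsum_nonneg hess_density_bounds)

lemma energy_hess_bound: "\<bar>energy_hess \<nu> \<mu> w u v\<bar> \<le> (8 + \<bar>w\<bar> + 3 * \<nu> / \<mu>) * (norm v)\<^sup>2"
proof -
  have "\<bar>w * (norm v)\<^sup>2\<bar> = \<bar>w\<bar> * (norm v)\<^sup>2" by (simp add: abs_mult)
  then show ?thesis
    using infsum_hess_density_bounds[of u v] inner_Laplacian_bounds[of v]
    unfolding energy_hess_def inner_diff_left inner_scaleR_left power2_norm_eq_inner[symmetric]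
      distrib_right by linarith
qed

text \<open>The quadratic form of the Laplacian is expanded exactly, so the remainder comes from the
  potential alone. The pointwise cubic remainder is summable because one factor
  \<open>norm (apply_ell2 v p)\<close> is at most \<open>norm v\<close>, which leaves a
  square-summable family.\<close>

lemma energy_Taylor:
  assumes R: "norm u \<le> R" "norm v \<le> R"
  shows "\<bar>energy \<nu> \<mu> w (u + v) - energy \<nu> \<mu> w u - inner (energy_grad \<nu> \<mu> w u) v
      - 1 / 2 * energy_hess \<nu> \<mu> w u v\<bar> \<le> (5 / 4 * \<nu> * R + 9 / 2 * \<nu> * \<mu> * R ^ 3) * norm v ^ 3"
proof -
  define C where "C = 5 / 4 * \<nu> * R + 9 / 2 * \<nu> * \<mu> * R ^ 3"
  have R0: "0 \<le> R" using R(1) norm_ge_zero order_trans by blast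
  then have C: "0 \<le> C" using \<nu> \<mu> by (simp add: C_def)
  let ?P = "\<lambda>u p. sat_pot \<nu> \<mu> ((norm (apply_ell2 u p))\<^sup>2)"
  let ?S = "\<lambda>p. inner (apply_ell2 (saturation \<nu> \<mu> u) p) (apply_ell2 v p)"
  let ?H = "\<lambda>p. hess_density \<nu> \<mu> (apply_ell2 u p) (apply_ell2 v p)"
  let ?r = "\<lambda>p. ?P (u + v) p - ?P u p - ?S p - 1 / 2 * ?H p"
  note summ = summable_on_sat_pot[of "u + v"] summable_on_sat_pot[of u]
    summable_on_inner_ell2[of "saturation \<nu> \<mu> u" v] summable_on_hess_density[of u v]
  have r: "\<bar>?r p\<bar> \<le> C * norm v * (norm (apply_ell2 v p))\<^sup>2" for p
  proof -
    have "\<bar>?r p\<bar> \<le> C * norm (apply_ell2 v p) ^ 3"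
      using sat_pot_norm_Taylor[of "apply_ell2 u p" R "apply_ell2 v p"] R
        norm_apply_ell2_le[of u p] norm_apply_ell2_le[of v p]
      by (simp add: C_def saturation.rep_eq)
    also have "\<dots> \<le> C * norm v * (norm (apply_ell2 v p))\<^sup>2"
      using C norm_apply_ell2_le[of v p]
      by (simp add: power3_eq_cube power2_eq_square mult.assoc mult_left_mono mult_right_mono)
    finally show ?thesis .
  qed
  have sr: "?r summable_on UNIV"
    by (intro summable_on_diff_real summable_on_cmult_right summ)
  have sb: "(\<lambda>p. C * norm v * (norm (apply_ell2 v p))\<^sup>2) summable_on UNIV"
    by (intro summable_on_cmult_right summable_on_norm_ell2_sq)
  have "(?S has_sum inner (saturation \<nu> \<mu> u) v) UNIV"
    unfolding inner_ell2.rep_eq by (intro has_sum_infsum summ)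
  then have "(?r has_sum (infsum (?P (u + v)) UNIV - infsum (?P u) UNIV
      - inner (saturation \<nu> \<mu> u) v - 1 / 2 * infsum ?H UNIV)) UNIV"
    by (intro has_sum_diff_real has_sum_cmult_right has_sum_infsum summ)
  then have eq: "infsum ?r UNIV = infsum (?P (u + v)) UNIV - infsum (?P u) UNIV
      - inner (saturation \<nu> \<mu> u) v - 1 / 2 * infsum ?H UNIV"
    by (rule infsumI)
  have "infsum ?r UNIV \<le> (\<Sum>\<^sub>\<infinity>p. C * norm v * (norm (apply_ell2 v p))\<^sup>2)"
    using r by (intro infsum_mono sr sb) (simp add: abs_le_iff)
  moreover have "(\<Sum>\<^sub>\<infinity>p. - ?r p) \<le> (\<Sum>\<^sub>\<infinity>p. C * norm v * (norm (apply_ell2 v p))\<^sup>2)"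
    using r by (intro infsum_mono sb summable_on_uminus[THEN iffD2] sr) (simp only: abs_le_iff)
  moreover have "(\<Sum>\<^sub>\<infinity>p. C * norm v * (norm (apply_ell2 v p))\<^sup>2) = C * norm v ^ 3"
    by (simp only: infsum_cmult_right[OF summable_on_norm_ell2_sq] norm_ell2_sq[symmetric])
      (simp add: power2_eq_square power3_eq_cube)
  ultimately have "\<bar>infsum ?r UNIV\<bar> \<le> C * norm v ^ 3"
    by (simp only: infsum_uminus abs_le_iff)
  moreover have "energy \<nu> \<mu> w (u + v) - energy \<nu> \<mu> w u - inner (energy_grad \<nu> \<mu> w u) v
      - 1 / 2 * energy_hess \<nu> \<mu> w u v = - infsum ?r UNIV"
    unfolding eq energy_def energy_grad_def energy_hess_def
    by (simp add: inner_simps linear_add[OF linear_Laplacian] inner_Laplacian[of v u]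
        inner_commute[of u "Laplacian v"] inner_commute[of v u] algebra_simps add_divide_distrib)
      (simp add: inner_Laplacian inner_commute)
  ultimately show ?thesis by (simp add: C_def)
qed

lemma energy_has_derivative:
  "(energy \<nu> \<mu> w has_derivative (\<lambda>v. inner (energy_grad \<nu> \<mu> w u) v)) (at u)"
  unfolding has_derivative_iff_norm
proof (intro conjI bounded_linear_inner_right)
  define R where "R = norm u + 1"
  define C where "C = 5 / 4 * \<nu> * R + 9 / 2 * \<nu> * \<mu> * R ^ 3"
  define H where "H = 8 + \<bar>w\<bar> + 3 * \<nu> / \<mu>"
  have C0: "0 \<le> C" and H0: "0 \<le> H" using \<nu> \<mu> by (auto simp: C_def H_def R_def)
  \<comment> \<open>For increments of norm at most 1 the Hessian term and the cubic remainder are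
    both quadratically small.\<close>
  have bound: "norm (energy \<nu> \<mu> w y - energy \<nu> \<mu> w u - inner (energy_grad \<nu> \<mu> w u) (y - u))
      / norm (y - u) \<le> (H + C) * norm (y - u)" if y: "dist y u < 1" for y
  proof -
    define v where "v = y - u"
    have v: "norm v \<le> 1" "norm v \<le> R" "norm u \<le> R" and y': "y = u + v"
      using y norm_ge_zero[of u] by (auto simp: v_def R_def dist_norm simp del: norm_ge_zero)
    have "norm v ^ 3 \<le> (norm v)\<^sup>2"
      using v(1) by (intro power_decreasing) auto
    then have "C * norm v ^ 3 \<le> C * (norm v)\<^sup>2" using C0 by (rule mult_left_mono)
    moreover have "0 \<le> H * (norm v)\<^sup>2" using H0 by simp
    ultimately have "\<bar>energy \<nu> \<mu> w (u + v) - energy \<nu> \<mu> w u - inner (energy_grad \<nu> \<mu> w u) v\<bar>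
        \<le> (H + C) * (norm v)\<^sup>2"
      using energy_Taylor[OF v(3,2), of w] energy_hess_bound[of w u v]
      unfolding C_def[symmetric] H_def[symmetric] distrib_right by linarith
    then show ?thesis
      unfolding v_def[symmetric] y'
      by (cases "v = 0") (simp_all add: divide_le_eq power2_eq_square mult.assoc)
  qed
  show "((\<lambda>y. norm (energy \<nu> \<mu> w y - energy \<nu> \<mu> w u - inner (energy_grad \<nu> \<mu> w u) (y - u))
      / norm (y - u)) \<longlongrightarrow> 0) (at u)"
  proof (rule tendsto_sandwich[where f = "\<lambda>_. 0" and h = "\<lambda>y. (H + C) * norm (y - u)"])
    have "\<forall>\<^sub>F y in at u. dist y u < 1"
      by (auto simp: eventually_at intro!: exI[of _ 1])
    then show "\<forall>\<^sub>F y in at u. norm (energy \<nu> \<mu> w y - energy \<nu> \<mu> w u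
        - inner (energy_grad \<nu> \<mu> w u) (y - u)) / norm (y - u) \<le> (H + C) * norm (y - u)"
      by eventually_elim (rule bound)
    show "((\<lambda>y. (H + C) * norm (y - u)) \<longlongrightarrow> 0) (at u)"
      by (auto intro!: tendsto_eq_intros)
  qed auto
qed

section \<open>Identification with \<open>J\<close>, the Nehari manifold and the stationary
  equation\<close>

lemma F_sat_eq: "F_sat \<nu> \<mu> x = sat_pot \<nu> \<mu> (x\<^sup>2)"
proof -
  have pos: "1 + \<mu> * t\<^sup>2 > 0" for t using \<mu> by (simp add: add_pos_nonneg)
  have "F_sat \<nu> \<mu> x = sat_pot \<nu> \<mu> (x\<^sup>2) - sat_pot \<nu> \<mu> (0\<^sup>2)"
    unfolding F_sat_def
  proof (rule interval_integral_FTC_finite[where F = "\<lambda>t. sat_pot \<nu> \<mu> (t\<^sup>2)"])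
    show "continuous_on {min 0 x..max 0 x} (\<lambda>\<tau>. \<nu> * \<tau> ^ 3 / (1 + \<mu> * \<tau>\<^sup>2))"
      using pos by (intro continuous_intros) (auto simp: less_imp_neq[symmetric])
    have "((\<lambda>t. sat_pot \<nu> \<mu> (t\<^sup>2)) has_real_derivative \<nu> * t ^ 3 / (1 + \<mu> * t\<^sup>2)) (at t)" for t
    proof -
      have "((\<lambda>t. sat_pot \<nu> \<mu> (t\<^sup>2)) has_real_derivative sat_coeff \<nu> \<mu> (t\<^sup>2) / 2 * (2 * t)) (at t)"
        using DERIV_chain2[OF sat_pot_deriv[of "t\<^sup>2"] DERIV_pow[of 2 t]] by simp
      moreover have "sat_coeff \<nu> \<mu> (t\<^sup>2) / 2 * (2 * t) = \<nu> * t ^ 3 / (1 + \<mu> * t\<^sup>2)"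
        using pos[of t] by (simp add: sat_coeff_def field_simps power2_eq_square power3_eq_cube)
      ultimately show ?thesis by (simp only:)
    qed
    then show "((\<lambda>t. sat_pot \<nu> \<mu> (t\<^sup>2)) has_vector_derivative \<nu> * t ^ 3 / (1 + \<mu> * t\<^sup>2))
        (at t within {min 0 x..max 0 x})" for t
      by (simp add: has_real_derivative_iff_has_vector_derivative has_vector_derivative_at_within)
  qed
  then show ?thesis by (simp add: sat_pot_def)
qed

lemma J_eq_energy: "J \<nu> \<mu> w = energy \<nu> \<mu> w"
  by (rule ext) (simp add: J_def energy_def F_sat_eq)

text \<open>Derivatives are unique, so the one in the definition of \<open>Nehari\<close> is the
  pairing with \<open>energy_grad\<close>.\<close>

lemma Nehari_iff: "u \<in> Nehari \<nu> \<mu> w \<longleftrightarrow> u \<noteq> 0 \<and> inner (energy_grad \<nu> \<mu> w u) u = 0"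
proof -
  have "J' = (\<lambda>v. inner (energy_grad \<nu> \<mu> w u) v)"
    if "(energy \<nu> \<mu> w has_derivative J') (at u)" for J'
    using has_derivative_unique[OF that energy_has_derivative] .
  then show ?thesis
    unfolding Nehari_def J_eq_energy mem_Collect_eq using energy_has_derivative[of w u] by metis
qed

lemma stationary_imp_energy_grad_eq_0:
  assumes "stationary_solution \<nu> \<mu> w u"
  shows "energy_grad \<nu> \<mu> w u = 0"
proof (rule ell2_eqI)
  fix p
  show "apply_ell2 (energy_grad \<nu> \<mu> w u) p = apply_ell2 0 p"
    using assms[unfolded stationary_solution_def, rule_format, of p]
    by (simp add: energy_grad_def Laplacian.rep_eq saturation.rep_eq sat_coeff_def
        power2_eq_square power3_eq_cube)
qed

end

section \<open>Monotonicity and Cauchy criteria\<close>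

text \<open>On a partition into n + 1 equal steps the quadratic errors add up to
  \<open>K * (b - a)\<^sup>2\<close> divided by n + 1, which tends to 0. Neither continuity nor
  differentiability of p enters.\<close>

lemma nondecreasing_if_quadratic_lower_bound:
  fixes p :: "real \<Rightarrow> real"
  assumes K: "\<And>x y. \<lbrakk>a \<le> x; x \<le> y; y \<le> b\<rbrakk> \<Longrightarrow> p x - K * (y - x)\<^sup>2 \<le> p y" and ab: "a \<le> b"
  shows "p a \<le> p b"
proof -
  have step: "p a - K * (b - a)\<^sup>2 / real (Suc n) \<le> p b" for n
  proof -
    define h where "h = (b - a) / real (Suc n)"
    have h: "0 \<le> h" and hn: "real (Suc n) * h = b - a" using ab by (simp_all add: h_def)
    have "p a - real k * (K * h\<^sup>2) \<le> p (a + real k * h)" if "k \<le> Suc n" for k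
      using that
    proof (induction k)
      case (Suc k)
      have "real (Suc k) * h \<le> real (Suc n) * h"
        using Suc.prems h by (intro mult_right_mono) auto
      then have "p (a + real k * h) - K * (a + real (Suc k) * h - (a + real k * h))\<^sup>2
          \<le> p (a + real (Suc k) * h)"
        using h hn by (intro K) (auto simp: distrib_right)
      moreover have "a + real (Suc k) * h - (a + real k * h) = h" by (simp add: algebra_simps)
      ultimately show ?case using Suc by (simp add: algebra_simps)
    qed simp
    from this[OF order_refl] have "p a - real (Suc n) * (K * h\<^sup>2) \<le> p b"
      unfolding hn by simp
    moreover have "real (Suc n) * (K * h\<^sup>2) = K * (b - a)\<^sup>2 / real (Suc n)"
      by (simp add: h_def power2_eq_square divide_simps)
    ultimately show ?thesis by simp
  qed
  have "(\<lambda>n. p a - K * (b - a)\<^sup>2 / real (Suc n)) \<longlonglongrightarrow> p a - 0"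
    by (intro tendsto_intros LIMSEQ_Suc lim_const_over_n)
  from LIMSEQ_le_const2[OF this] show ?thesis using step by simp
qed

lemma Cauchy_if_dist_sq_le:
  fixes X :: "nat \<Rightarrow> 'a::real_normed_vector"
  assumes "\<And>m n. (norm (X m - X n))\<^sup>2 \<le> g m + g n" "g \<longlonglongrightarrow> (0::real)"
  shows "Cauchy X"
proof (rule metric_CauchyI)
  fix e :: real assume e: "0 < e"
  then have "\<forall>\<^sub>F n in sequentially. g n < e\<^sup>2 / 2"
    using order_tendstoD(2)[OF assms(2), of "e\<^sup>2 / 2"] by simp
  then obtain N where N: "\<And>n. n \<ge> N \<Longrightarrow> g n < e\<^sup>2 / 2"
    by (auto simp: eventually_sequentially)
  have "dist (X m) (X n) < e" if "m \<ge> N" "n \<ge> N" for m n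
  proof -
    have "(norm (X m - X n))\<^sup>2 < e\<^sup>2"
      using assms(1)[of m n] N[OF that(1)] N[OF that(2)] by linarith
    then show ?thesis using e by (simp add: dist_norm power2_less_imp_less)
  qed
  then show "\<exists>M. \<forall>m\<ge>M. \<forall>n\<ge>M. dist (X m) (X n) < e" by blast
qed

section \<open>The second variation at a real profile\<close>

lemma energy_change_frequency:
  "energy \<nu> \<mu> w u = energy \<nu> \<mu> w' u - (w - w') / 2 * (norm u)\<^sup>2"
  by (simp add: energy_def inner_simps power2_norm_eq_inner field_simps)

context
  fixes \<nu> \<mu> :: real
  assumes \<nu>: "\<nu> > 0" and \<mu>: "\<mu> > 0"
begin

lemma hess_density_real:
  fixes x y :: real
  shows "hess_density \<nu> \<mu> x y = \<nu> * (x\<^sup>2 * (3 + \<mu> * x\<^sup>2) / (1 + \<mu> * x\<^sup>2)\<^sup>2) * (y * y)"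
proof -
  have "0 < 1 + \<mu> * x\<^sup>2" using \<mu> by (simp add: add_pos_nonneg)
  then have "sat_coeff \<nu> \<mu> (x\<^sup>2) + 2 * \<nu> / (1 + \<mu> * x\<^sup>2)\<^sup>2 * x\<^sup>2
      = \<nu> * (x\<^sup>2 * (3 + \<mu> * x\<^sup>2) / (1 + \<mu> * x\<^sup>2)\<^sup>2)"
    by (simp add: sat_coeff_def divide_simps) (simp add: algebra_simps power2_eq_square)
  moreover have "hess_density \<nu> \<mu> x y
      = (sat_coeff \<nu> \<mu> (x\<^sup>2) + 2 * \<nu> / (1 + \<mu> * x\<^sup>2)\<^sup>2 * x\<^sup>2) * (y * y)"
    by (simp add: hess_density_def power2_eq_square distrib_right)
  ultimately show ?thesis by (simp only:)
qed

lemma inner_L_plus: "inner (L_plus \<nu> \<mu> w u r) s = inner (- Laplacian r - w *\<^sub>R r) s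
    - (\<Sum>\<^sub>\<infinity>p. \<nu> * ((apply_ell2 u p)\<^sup>2 * (3 + \<mu> * (apply_ell2 u p)\<^sup>2)
        / (1 + \<mu> * (apply_ell2 u p)\<^sup>2)\<^sup>2) * (apply_ell2 r p * apply_ell2 s p))"
proof -
  \<comment> \<open>\<open>z\<close> is the potential part of \<open>L_plus\<close> as an element of
    the sequence space, so its pairing with s splits off by linearity of the inner product.\<close>
  define z where "z = - Laplacian r - w *\<^sub>R r - L_plus \<nu> \<mu> w u r"
  have z: "apply_ell2 z p = \<nu> * ((apply_ell2 u p)\<^sup>2 * (3 + \<mu> * (apply_ell2 u p)\<^sup>2)
      / (1 + \<mu> * (apply_ell2 u p)\<^sup>2)\<^sup>2) * apply_ell2 r p" for p
    by (simp add: z_def L_plus.rep_eq Laplacian.rep_eq)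
  have "L_plus \<nu> \<mu> w u r = (- Laplacian r - w *\<^sub>R r) - z"
    by (simp add: z_def)
  then show ?thesis
    by (simp only: inner_diff_left[of _ z] inner_ell2.rep_eq[of z] z inner_real_def mult.assoc)
qed

lemma L_plus_symmetric: "inner (L_plus \<nu> \<mu> w u r) s = inner r (L_plus \<nu> \<mu> w u s)"
proof -
  have "inner (Laplacian r) s = inner (Laplacian s) r"
    by (metis inner_Laplacian inner_commute)
  then have "inner (- Laplacian r - w *\<^sub>R r) s = inner (- Laplacian s - w *\<^sub>R s) r"
    by (simp add: inner_simps inner_commute)
  then show ?thesis
    unfolding inner_commute[of r] inner_L_plus by (simp add: mult.commute)
qed

lemma inner_L_plus_self: "inner (L_plus \<nu> \<mu> w u r) r = energy_hess \<nu> \<mu> w u r"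
  unfolding inner_L_plus energy_hess_def hess_density_real ..

lemma bounded_linear_L_plus: "bounded_linear (L_plus \<nu> \<mu> w u)"
proof (rule bounded_linear_intro)
  define V where "V p = \<nu> * ((apply_ell2 u p)\<^sup>2 * (3 + \<mu> * (apply_ell2 u p)\<^sup>2)
    / (1 + \<mu> * (apply_ell2 u p)\<^sup>2)\<^sup>2)" for p
  have L: "apply_ell2 (L_plus \<nu> \<mu> w u r) p
      = - apply_ell2 (Laplacian r) p - w * apply_ell2 r p - V p * apply_ell2 r p" for r p
    by (simp add: L_plus.rep_eq Laplacian.rep_eq V_def)
  show "L_plus \<nu> \<mu> w u (r + s) = L_plus \<nu> \<mu> w u r + L_plus \<nu> \<mu> w u s" for r s
    by (rule ell2_eqI) (simp add: L linear_add[OF linear_Laplacian] algebra_simps)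
  show "L_plus \<nu> \<mu> w u (c *\<^sub>R r) = c *\<^sub>R L_plus \<nu> \<mu> w u r" for c r
    by (rule ell2_eqI) (simp add: L linear_scale[OF linear_Laplacian] algebra_simps)
  show "norm (L_plus \<nu> \<mu> w u r) \<le> norm r * (onorm (Laplacian :: (site, real) ell2 \<Rightarrow> _)
      + \<bar>w\<bar> + 3 * \<nu> / \<mu>)" for r
  proof -
    define z where "z = - Laplacian r - w *\<^sub>R r - L_plus \<nu> \<mu> w u r"
    have "norm z \<le> 3 * \<nu> / \<mu> * norm r"
    proof (rule norm_ell2_mono)
      fix p
      \<comment> \<open>The potential is the Hessian density in the direction 1, so the uniform
        bound applies.\<close>
      have "V p \<le> 3 * \<nu> / \<mu>" "0 \<le> V p"
        using hess_density_bounds[OF \<nu> \<mu>, of "apply_ell2 u p" 1]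
        by (simp_all add: hess_density_real V_def)
      moreover have "apply_ell2 z p = V p * apply_ell2 r p"
        by (simp add: z_def L)
      ultimately show "norm (apply_ell2 z p) \<le> 3 * \<nu> / \<mu> * norm (apply_ell2 r p)"
        unfolding norm_mult by (simp only: norm_mult) (intro mult_right_mono, auto)
    qed (use \<nu> \<mu> in simp)
    moreover have "norm (Laplacian r) \<le> onorm (Laplacian :: (site, real) ell2 \<Rightarrow> _) * norm r"
      by (rule onorm[OF bounded_linear_Laplacian])
    moreover have "norm (- Laplacian r - w *\<^sub>R r - z) \<le> norm (Laplacian r) + \<bar>w\<bar> * norm r + norm z"
      using norm_triangle_ineq4[of "- Laplacian r - w *\<^sub>R r" z]
        norm_triangle_ineq4[of "- Laplacian r" "w *\<^sub>R r"] by simp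
    moreover have "L_plus \<nu> \<mu> w u r = - Laplacian r - w *\<^sub>R r - z" by (simp add: z_def)
    ultimately show ?thesis
      by (simp only:) (simp add: algebra_simps)
  qed
qed

lemmas linear_L_plus = bounded_linear.linear[OF bounded_linear_L_plus]

lemma energy_hess_linear_combination:
  fixes u r s :: "(site, real) ell2"
  shows "energy_hess \<nu> \<mu> w u (a *\<^sub>R r + b *\<^sub>R s) = a\<^sup>2 * energy_hess \<nu> \<mu> w u r
    + 2 * a * b * inner (L_plus \<nu> \<mu> w u s) r + b\<^sup>2 * energy_hess \<nu> \<mu> w u s"
  unfolding inner_L_plus_self[symmetric] linear_add[OF linear_L_plus] linear_scale[OF linear_L_plus]
  by (simp add: inner_simps L_plus_symmetric[of w u r s] inner_commute[of r] power2_eq_square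
      algebra_simps)

text \<open>Pairing the stationary equation with u cancels the quadratic part against the
  \<open>sat_coeff\<close> part of the Hessian. What is left is minus the sum of the terms
  \<open>2 * \<nu> * x ^ 4 / (1 + \<mu> * x\<^sup>2)\<^sup>2\<close>, x running through the values
  of u.\<close>

lemma energy_hess_ray_neg:
  fixes u :: "(site, real) ell2"
  assumes "energy_grad \<nu> \<mu> w u = 0" "u \<noteq> 0"
  shows "energy_hess \<nu> \<mu> w u u < 0"
proof -
  let ?f = "\<lambda>p. sat_coeff \<nu> \<mu> ((norm (apply_ell2 u p))\<^sup>2) * (norm (apply_ell2 u p))\<^sup>2"
  let ?h = "\<lambda>p. hess_density \<nu> \<mu> (apply_ell2 u p) (apply_ell2 u p)"
  have pos: "0 < 1 + \<mu> * x\<^sup>2" for x using \<mu> by (simp add: add_pos_nonneg)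
  have hf: "?h p - ?f p = 2 * \<nu> / (1 + \<mu> * (apply_ell2 u p)\<^sup>2)\<^sup>2 * ((apply_ell2 u p)\<^sup>2)\<^sup>2" for p
    by (simp add: hess_density_def power2_eq_square)
  obtain q where q: "apply_ell2 u q \<noteq> 0"
    using assms(2) ell2_eqI[of u 0] by auto
  have "0 < ?h q - ?f q"
    unfolding hf using \<nu> q pos[of "apply_ell2 u q"] by simp
  also have "\<dots> = (\<Sum>p\<in>{q}. ?h p - ?f p)" by simp
  also have "\<dots> \<le> (\<Sum>\<^sub>\<infinity>p. ?h p - ?f p)"
  proof (intro finite_sum_le_infsum summable_on_diff_real summable_on_hess_density[OF \<nu> \<mu>]
      summable_on_saturation)
    show "0 \<le> ?h p - ?f p" for p
      unfolding hf using \<nu> pos[of "apply_ell2 u p"] by simp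
  qed auto
  also have "\<dots> = infsum ?h UNIV - infsum ?f UNIV"
    by (intro infsum_diff_real summable_on_hess_density[OF \<nu> \<mu>] summable_on_saturation)
  finally have "infsum ?f UNIV < infsum ?h UNIV" by simp
  moreover have "inner (- Laplacian u - w *\<^sub>R u) u = infsum ?f UNIV"
    using assms(1) unfolding inner_saturation[symmetric] energy_grad_def by (simp only: right_minus_eq)
  ultimately show ?thesis by (simp add: energy_hess_def)
qed

section \<open>Dependence of the ground state energy on the frequency\<close>

lemma ground_stateD:
  assumes "ground_state \<nu> \<mu> w u"
  shows "energy_grad \<nu> \<mu> w u = 0" "u \<noteq> 0"
    "\<And>v. v \<in> Nehari \<nu> \<mu> w \<Longrightarrow> energy \<nu> \<mu> w u \<le> energy \<nu> \<mu> w v"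
  using assms stationary_imp_energy_grad_eq_0[OF \<nu> \<mu>]
  by (auto simp: ground_state_def Nehari_iff[OF \<nu> \<mu>] J_eq_energy[OF \<nu> \<mu>])

text \<open>The witness \<open>s\<close> is an interior maximum of the energy along the ray, which puts
  \<open>s *\<^sub>R v\<close> on the Nehari manifold.\<close>

lemma ground_state_energy_le_ray:
  fixes v :: "(site, real) ell2"
  assumes gs: "ground_state \<nu> \<mu> w u"
    and t: "0 < a" "a < t" "t < b"
    and ends: "energy \<nu> \<mu> w (a *\<^sub>R v) < energy \<nu> \<mu> w (t *\<^sub>R v)"
      "energy \<nu> \<mu> w (b *\<^sub>R v) < energy \<nu> \<mu> w (t *\<^sub>R v)"
  shows "\<exists>s\<in>{a..b}. energy \<nu> \<mu> w u \<le> energy \<nu> \<mu> w (s *\<^sub>R v)"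
proof -
  define f where "f s = energy \<nu> \<mu> w (s *\<^sub>R v)" for s
  have "((\<lambda>s. energy \<nu> \<mu> w (s *\<^sub>R v)) has_derivative
      (\<lambda>h. inner (energy_grad \<nu> \<mu> w (s *\<^sub>R v)) (h *\<^sub>R v))) (at s)" for s
    by (rule has_derivative_compose[OF _ energy_has_derivative[OF \<nu> \<mu>], of "\<lambda>s. s *\<^sub>R v"])
      (auto intro!: derivative_eq_intros)
  then have f': "(f has_real_derivative inner (energy_grad \<nu> \<mu> w (s *\<^sub>R v)) v) (at s)" for s
    unfolding f_def has_field_derivative_def by (simp add: mult.commute[of _ "inner _ _"])
  have "continuous_on {a..b} f"
    using f' by (meson DERIV_isCont continuous_at_imp_continuous_on)
  then obtain s where s: "s \<in> {a..b}" "\<And>x. x \<in> {a..b} \<Longrightarrow> f x \<le> f s"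
    using continuous_attains_sup[of "{a..b}" f] t by force
  from s(2)[of t] have "s \<noteq> a" "s \<noteq> b" using t ends by (auto simp: f_def)
  then have s': "a < s" "s < b" using s(1) by auto
  have "inner (energy_grad \<nu> \<mu> w (s *\<^sub>R v)) v = 0"
  proof (rule DERIV_local_max[OF f', of "min (s - a) (b - s)"])
    show "0 < min (s - a) (b - s)" using s' by simp
    show "\<forall>y. \<bar>s - y\<bar> < min (s - a) (b - s) \<longrightarrow> f y \<le> f s"
      using s(2) by (auto simp: abs_less_iff)
  qed
  moreover have "v \<noteq> 0" using ends by auto
  ultimately have "s *\<^sub>R v \<in> Nehari \<nu> \<mu> w"
    using s' t by (simp add: Nehari_iff[OF \<nu> \<mu>])
  then show ?thesis using ground_stateD(3)[OF gs] s(1) by blast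
qed

lemma energy_ray_upper_bound:
  fixes v :: "(site, real) ell2"
  assumes grad: "energy_grad \<nu> \<mu> w v = 0" and U: "(norm v)\<^sup>2 \<le> U" and t: "t\<^sup>2 \<le> 2"
    and \<beta>: "\<beta> \<le> - w"
  shows "energy \<nu> \<mu> w (t *\<^sub>R v)
    \<le> energy \<nu> \<mu> w v - \<beta> / (4 * (1 + 2 * \<mu> * U)\<^sup>2) * (t\<^sup>2 - 1)\<^sup>2 * (norm v)\<^sup>2"
proof -
  define \<kappa> where "\<kappa> = 1 / (4 * (1 + \<mu> * (2 * U))\<^sup>2)"
  define A where "A = inner (- Laplacian v - w *\<^sub>R v) v"
  let ?S = "\<lambda>p. (norm (apply_ell2 v p))\<^sup>2"
  let ?P = "\<lambda>v p. sat_pot \<nu> \<mu> ((norm (apply_ell2 v p))\<^sup>2)"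
  let ?f = "\<lambda>p. sat_coeff \<nu> \<mu> (?S p) * ?S p"
  have U0: "0 \<le> U" using U zero_le_power2 order_trans by blast
  have A: "A = infsum ?f UNIV"
    using grad unfolding inner_saturation[symmetric] energy_grad_def A_def by (simp only: right_minus_eq)
  have pt: "?P v p + ((t\<^sup>2 - 1) / 2 + \<kappa> * (t\<^sup>2 - 1)\<^sup>2) * ?f p \<le> ?P (t *\<^sub>R v) p" for p
  proof -
    define s where "s = ?S p"
    have s: "0 \<le> s" "s \<le> U"
      using power_mono[OF norm_apply_ell2_le[of v p], of 2] U by (auto simp: s_def)
    have ts: "0 \<le> t\<^sup>2 * s" "t\<^sup>2 * s \<le> 2 * U"
      using mult_mono[OF t s(2)] s by auto
    have st: "s \<le> 2 * U" using s by simp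
    \<comment> \<open>This trades the gain \<nu> times the square of s for
      \<open>sat_coeff \<nu> \<mu> s * s\<close>, whose sum is A; and A is at least \<beta> times
      the mass.\<close>
    have "sat_coeff \<nu> \<mu> s \<le> \<nu> * s"
      using s \<mu> \<nu> mult_left_mono[of 1 "1 + \<mu> * s" "\<nu> * s"]
      by (simp add: sat_coeff_def divide_le_eq add_pos_nonneg)
    then have "sat_coeff \<nu> \<mu> s * s * (\<kappa> * (t\<^sup>2 - 1)\<^sup>2) \<le> \<nu> * s * s * (\<kappa> * (t\<^sup>2 - 1)\<^sup>2)"
      using s by (intro mult_right_mono) (auto simp: \<kappa>_def)
    also have "\<dots> = \<nu> / (4 * (1 + \<mu> * (2 * U))\<^sup>2) * (t\<^sup>2 * s - s)\<^sup>2"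
      by (simp add: \<kappa>_def power2_eq_square algebra_simps)
    finally have "sat_pot \<nu> \<mu> s + sat_coeff \<nu> \<mu> s / 2 * (t\<^sup>2 * s - s)
        + sat_coeff \<nu> \<mu> s * s * (\<kappa> * (t\<^sup>2 - 1)\<^sup>2) \<le> sat_pot \<nu> \<mu> (t\<^sup>2 * s)"
      using sat_pot_strongly_convex[OF \<nu> \<mu> s(1) st ts] by linarith
    moreover have "(norm (apply_ell2 (t *\<^sub>R v) p))\<^sup>2 = t\<^sup>2 * s"
      by (simp add: s_def power_mult_distrib)
    moreover have "((t\<^sup>2 - 1) / 2 + \<kappa> * (t\<^sup>2 - 1)\<^sup>2) * (sat_coeff \<nu> \<mu> s * s)
        = sat_coeff \<nu> \<mu> s / 2 * (t\<^sup>2 * s - s) + sat_coeff \<nu> \<mu> s * s * (\<kappa> * (t\<^sup>2 - 1)\<^sup>2)"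
      by (simp add: algebra_simps add_divide_distrib diff_divide_distrib)
    ultimately show ?thesis
      unfolding s_def[symmetric] by simp
  qed
  have "(\<Sum>\<^sub>\<infinity>p. ?P v p + ((t\<^sup>2 - 1) / 2 + \<kappa> * (t\<^sup>2 - 1)\<^sup>2) * ?f p) \<le> infsum (?P (t *\<^sub>R v)) UNIV"
    by (intro infsum_mono pt summable_on_add summable_on_cmult_right summable_on_saturation
        summable_on_sat_pot[OF \<nu> \<mu>])
  moreover have "(\<Sum>\<^sub>\<infinity>p. ?P v p + ((t\<^sup>2 - 1) / 2 + \<kappa> * (t\<^sup>2 - 1)\<^sup>2) * ?f p)
      = infsum (?P v) UNIV + ((t\<^sup>2 - 1) / 2 + \<kappa> * (t\<^sup>2 - 1)\<^sup>2) * A"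
    unfolding A
    by (simp only: infsum_add[OF summable_on_sat_pot[OF \<nu> \<mu>] summable_on_cmult_right[OF summable_on_saturation]]
        infsum_cmult_right[OF summable_on_saturation])
  moreover have "inner (- Laplacian (t *\<^sub>R v) - w *\<^sub>R t *\<^sub>R v) (t *\<^sub>R v) = t\<^sup>2 * A"
    by (simp add: A_def linear_scale[OF linear_Laplacian] inner_simps power2_eq_square algebra_simps)
  ultimately have "energy \<nu> \<mu> w (t *\<^sub>R v) \<le> energy \<nu> \<mu> w v - \<kappa> * (t\<^sup>2 - 1)\<^sup>2 * A"
    unfolding energy_def A_def[symmetric] by (simp add: algebra_simps add_divide_distrib diff_divide_distrib)
  moreover have "\<beta> * (norm v)\<^sup>2 \<le> A"
    using inner_Laplacian_bounds(1)[of v] mult_right_mono[OF \<beta>, of "(norm v)\<^sup>2"]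
    by (simp add: A_def inner_simps power2_norm_eq_inner)
  then have "\<kappa> * (t\<^sup>2 - 1)\<^sup>2 * (\<beta> * (norm v)\<^sup>2) \<le> \<kappa> * (t\<^sup>2 - 1)\<^sup>2 * A"
    by (intro mult_left_mono) (auto simp: \<kappa>_def)
  moreover have "\<kappa> * (t\<^sup>2 - 1)\<^sup>2 * (\<beta> * (norm v)\<^sup>2)
      = \<beta> / (4 * (1 + 2 * \<mu> * U)\<^sup>2) * (t\<^sup>2 - 1)\<^sup>2 * (norm v)\<^sup>2"
    by (simp add: \<kappa>_def mult.assoc mult.left_commute)
  ultimately show ?thesis by linarith
qed

text \<open>The ray through v is the test curve at frequency w. The constants depend only on \<beta>
  and U, not on the pair of frequencies, as summation over a partition requires.\<close>

lemma ground_state_energy_comparison: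
  assumes \<beta>: "0 < \<beta>" and U: "0 \<le> U"
  obtains K \<delta> where "0 \<le> K" "0 < \<delta>"
    "\<And>w w' u v. \<lbrakk>ground_state \<nu> \<mu> w u; ground_state \<nu> \<mu> w' v; \<beta> \<le> - w'; (norm v)\<^sup>2 \<le> U; \<bar>w - w'\<bar> < \<delta>\<rbrakk>
      \<Longrightarrow> energy \<nu> \<mu> w u \<le> energy \<nu> \<mu> w' v - (w - w') / 2 * (norm v)\<^sup>2 + K * (w - w')\<^sup>2"
proof -
  define \<gamma> where "\<gamma> = \<beta> / (4 * (1 + 2 * \<mu> * U)\<^sup>2)"
  have "0 < 1 + 2 * \<mu> * U" using U \<mu> by (simp add: add_pos_nonneg)
  then have \<gamma>: "0 < \<gamma>" using \<beta> by (simp add: \<gamma>_def)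
  have "energy \<nu> \<mu> w u \<le> energy \<nu> \<mu> w' v - (w - w') / 2 * (norm v)\<^sup>2 + U / (16 * \<gamma>) * (w - w')\<^sup>2"
    if gu: "ground_state \<nu> \<mu> w u" and gv: "ground_state \<nu> \<mu> w' v" and w': "\<beta> \<le> - w'"
      and v: "(norm v)\<^sup>2 \<le> U" and d: "\<bar>w - w'\<bar> < \<gamma> / 2" for w w' and u v
  proof -
    define d where "d = w - w'"
    define m where "m = (norm v)\<^sup>2"
    have m: "0 < m" using ground_stateD(2)[OF gv] by (simp add: m_def)
    have bd: "energy \<nu> \<mu> w (t *\<^sub>R v)
        \<le> energy \<nu> \<mu> w' v - d / 2 * m - m * (\<gamma> * (t\<^sup>2 - 1)\<^sup>2 + d / 2 * (t\<^sup>2 - 1))"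
      if "t\<^sup>2 \<le> 2" for t
      using energy_ray_upper_bound[OF ground_stateD(1)[OF gv] v that w']
      unfolding energy_change_frequency[of \<nu> \<mu> w _ w'] d_def[symmetric] \<gamma>_def[symmetric]
      by (simp add: power_mult_distrib m_def[symmetric] algebra_simps diff_divide_distrib)
    have one: "energy \<nu> \<mu> w (1 *\<^sub>R v) = energy \<nu> \<mu> w' v - d / 2 * m"
      unfolding energy_change_frequency[of \<nu> \<mu> w _ w'] by (simp add: d_def m_def)
    \<comment> \<open>At these two ends y = t^2 - 1 is -7/16 or 9/16. Since \<bar>d\<bar> <
      \<gamma>/2, the term \<gamma> y^2 dominates d y/2, so the window has an interior
      maximum.\<close>
    have pos: "0 < m * (\<gamma> * (t\<^sup>2 - 1)\<^sup>2 + d / 2 * (t\<^sup>2 - 1))" if t: "t = 3 / 4 \<or> t = 5 / 4" for t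
    proof -
      have "\<bar>d\<bar> < \<gamma> / 2" using d by (simp add: d_def)
      then have d: "- \<gamma> / 2 < d" "d < \<gamma> / 2" by auto
      have "t\<^sup>2 - 1 = - 7 / 16 \<or> t\<^sup>2 - 1 = 9 / 16"
        using t by (elim disjE) (simp_all only: power2_eq_square, simp_all)
      then have "0 < \<gamma> * (t\<^sup>2 - 1)\<^sup>2 + d / 2 * (t\<^sup>2 - 1)"
        using \<gamma> d by (elim disjE ssubst) (simp_all add: power2_eq_square)
      then show ?thesis using m by simp
    qed
    have "\<exists>s\<in>{3 / 4..5 / 4}. energy \<nu> \<mu> w u \<le> energy \<nu> \<mu> w (s *\<^sub>R v)"
    proof (rule ground_state_energy_le_ray[OF gu, where t = 1])
      show "energy \<nu> \<mu> w ((3 / 4) *\<^sub>R v) < energy \<nu> \<mu> w (1 *\<^sub>R v)"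
        using bd[of "3 / 4"] pos[of "3 / 4"] unfolding one by (simp add: power2_eq_square)
      show "energy \<nu> \<mu> w ((5 / 4) *\<^sub>R v) < energy \<nu> \<mu> w (1 *\<^sub>R v)"
        using bd[of "5 / 4"] pos[of "5 / 4"] unfolding one by (simp add: power2_eq_square)
    qed auto
    then obtain s where s: "3 / 4 \<le> s" "s \<le> 5 / 4" "energy \<nu> \<mu> w u \<le> energy \<nu> \<mu> w (s *\<^sub>R v)" by auto
    have "s\<^sup>2 \<le> (5 / 4)\<^sup>2" using s by (intro power_mono) auto
    then have "s\<^sup>2 \<le> 2" by (simp add: power2_eq_square)
    from bd[OF this] s(3) have 1: "energy \<nu> \<mu> w u
        \<le> energy \<nu> \<mu> w' v - d / 2 * m - m * (\<gamma> * (s\<^sup>2 - 1)\<^sup>2 + d / 2 * (s\<^sup>2 - 1))"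
      by linarith
    \<comment> \<open>Completing the square bounds the possible gain along the ray by m d^2 / (16
      \<gamma>), which explains \<open>K\<close>.\<close>
    have "\<gamma> * y\<^sup>2 + d / 2 * y + d\<^sup>2 / (16 * \<gamma>) = \<gamma> * (y + d / (4 * \<gamma>))\<^sup>2" for y
      using \<gamma> by (simp add: field_simps power2_eq_square)
    then have "0 \<le> \<gamma> * y\<^sup>2 + d / 2 * y + d\<^sup>2 / (16 * \<gamma>)" for y
      using \<gamma> by simp
    then have "0 \<le> m * (\<gamma> * (s\<^sup>2 - 1)\<^sup>2 + d / 2 * (s\<^sup>2 - 1) + d\<^sup>2 / (16 * \<gamma>))"
      using m by simp
    moreover have "m * (d\<^sup>2 / (16 * \<gamma>)) \<le> U * (d\<^sup>2 / (16 * \<gamma>))"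
      using v \<gamma> by (intro mult_right_mono) (auto simp: m_def)
    ultimately have "- (m * (\<gamma> * (s\<^sup>2 - 1)\<^sup>2 + d / 2 * (s\<^sup>2 - 1))) \<le> U * (d\<^sup>2 / (16 * \<gamma>))"
      unfolding distrib_left by linarith
    with 1 show ?thesis
      by (simp add: d_def m_def)
  qed
  then show ?thesis
    using U \<gamma> by (intro that[of "U / (16 * \<gamma>)" "\<gamma> / 2"]) auto
qed

end

section \<open>Coercivity of the second variation\<close>

context
  fixes \<nu> \<mu> :: real
  assumes \<nu>: "\<nu> > 0" and \<mu>: "\<mu> > 0"
begin

text \<open>Formally the derivative of the least energy is minus half the mass, and the mass at w
  lies below its value at \<omega> plus D/2 times (w - \<omega>). Integration gives the claim. The
  partition lemma replaces the integration, since differentiability of the least energy is not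
  known.\<close>

lemma ground_state_energy_lower_expansion:
  fixes \<phi> :: "real \<Rightarrow> (site, real) ell2"
  assumes \<omega>: "\<omega> < 0" and gs: "ground_state \<nu> \<mu> \<omega> (\<phi> \<omega>)"
    and family: "\<forall>\<^sub>F w in at \<omega>. ground_state \<nu> \<mu> w (\<phi> w)"
    and slope: "((\<lambda>w. mass (\<phi> w)) has_real_derivative D) (at \<omega>)" "D < 0"
  obtains e\<^sub>0 where "0 < e\<^sub>0" "\<And>e. \<lbrakk>0 < e; e < e\<^sub>0\<rbrakk> \<Longrightarrow> ground_state \<nu> \<mu> (\<omega> + e) (\<phi> (\<omega> + e))"
    "\<And>e. \<lbrakk>0 < e; e < e\<^sub>0\<rbrakk> \<Longrightarrow> energy \<nu> \<mu> \<omega> (\<phi> \<omega>) - e / 2 * mass (\<phi> \<omega>) - D / 8 * e\<^sup>2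
      \<le> energy \<nu> \<mu> (\<omega> + e) (\<phi> (\<omega> + e))"
proof -
  define m where "m w = mass (\<phi> w)" for w
  define d where "d w = energy \<nu> \<mu> w (\<phi> w)" for w
  define U where "U = m \<omega> + 1"
  have slope': "(m has_real_derivative D) (at \<omega>)" using slope(1) by (simp add: m_def[abs_def])
  have U0: "0 \<le> U" by (simp add: U_def m_def mass_eq_norm_sq)
  obtain K \<delta> where K: "0 \<le> K" "0 < \<delta>"
    "\<And>w w' u v. \<lbrakk>ground_state \<nu> \<mu> w u; ground_state \<nu> \<mu> w' v; - \<omega> / 2 \<le> - w'; (norm v)\<^sup>2 \<le> U; \<bar>w - w'\<bar> < \<delta>\<rbrakk>
      \<Longrightarrow> energy \<nu> \<mu> w u \<le> energy \<nu> \<mu> w' v - (w - w') / 2 * (norm v)\<^sup>2 + K * (w - w')\<^sup>2"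
    using ground_state_energy_comparison[OF \<nu> \<mu>, of "- \<omega> / 2" U] \<omega> U0 by auto
  have "(m \<longlongrightarrow> m \<omega>) (at \<omega>)"
    using DERIV_isCont[OF slope'] by (simp add: isCont_def)
  then have ev1: "\<forall>\<^sub>F w in at \<omega>. m w < U" by (rule order_tendstoD) (simp add: U_def)
  have "((\<lambda>w. (m w - m \<omega>) / (w - \<omega>)) \<longlongrightarrow> D) (at \<omega>)"
    using slope' by (simp add: has_field_derivative_iff)
  \<comment> \<open>The difference quotient tends to D < 0, so it is eventually below the larger
    number D/2. This slack makes the final coefficient D/8.\<close>
  then have ev2: "\<forall>\<^sub>F w in at \<omega>. (m w - m \<omega>) / (w - \<omega>) < D / 2"
    by (rule order_tendstoD) (use slope(2) in simp)
  have "\<forall>\<^sub>F w in at \<omega>. ground_state \<nu> \<mu> w (\<phi> w) \<and> m w < U \<and> (m w - m \<omega>) / (w - \<omega>) < D / 2"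
    using family ev1 ev2 by (simp add: eventually_conj_iff)
  then obtain r where r: "0 < r" "\<And>w. \<lbrakk>w \<noteq> \<omega>; dist w \<omega> < r\<rbrakk> \<Longrightarrow>
      ground_state \<nu> \<mu> w (\<phi> w) \<and> m w < U \<and> (m w - m \<omega>) / (w - \<omega>) < D / 2"
    unfolding eventually_at by auto
  \<comment> \<open>The bound -\<omega>/2 keeps all frequencies below \<omega>/2, where the
    comparison constants are uniform.\<close>
  define e\<^sub>0 where "e\<^sub>0 = min r (min \<delta> (- \<omega> / 2))"
  have e0: "0 < e\<^sub>0" using r(1) K(2) \<omega> by (simp add: e\<^sub>0_def)
  have near: "ground_state \<nu> \<mu> w (\<phi> w)" "m w \<le> U" "m w \<le> m \<omega> + D / 2 * (w - \<omega>)"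
    if "\<omega> \<le> w" "w < \<omega> + e\<^sub>0" for w
  proof -
    have "ground_state \<nu> \<mu> w (\<phi> w) \<and> m w \<le> U \<and> m w \<le> m \<omega> + D / 2 * (w - \<omega>)"
    proof (cases "w = \<omega>")
      case False
      then have "dist w \<omega> < r" "0 < w - \<omega>" using that by (auto simp: e\<^sub>0_def dist_real_def)
      then show ?thesis using r(2)[OF False] by (simp add: divide_less_eq)
    qed (use gs in \<open>simp add: U_def\<close>)
    then show "ground_state \<nu> \<mu> w (\<phi> w)" "m w \<le> U" "m w \<le> m \<omega> + D / 2 * (w - \<omega>)" by auto
  qed
  have lower: "d \<omega> - e / 2 * m \<omega> - D / 8 * e\<^sup>2 \<le> d (\<omega> + e)" if e: "0 < e" "e < e\<^sub>0" for e
  proof -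
    \<comment> \<open>The least energy minus its claimed lower bound, up to a constant. Monotonicity
      of \<open>p\<close> is the assertion.\<close>
    define p where "p w = d w + (w - \<omega>) / 2 * m \<omega> + D / 8 * (w - \<omega>)\<^sup>2" for w
    have "p \<omega> \<le> p (\<omega> + e)"
    proof (rule nondecreasing_if_quadratic_lower_bound[where p = p and K = K])
      fix x y assume xy: "\<omega> \<le> x" "x \<le> y" "y \<le> \<omega> + e"
      have y: "\<omega> \<le> y" "y < \<omega> + e\<^sub>0" and x: "x < \<omega> + e\<^sub>0" using xy e by auto
      \<comment> \<open>The ground state at the upper frequency y is the test function at the lower
        frequency x.\<close>
      have "d x \<le> d y - (x - y) / 2 * m y + K * (y - x)\<^sup>2"
        unfolding d_def m_def mass_eq_norm_sq power2_commute[of y x]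
        by (rule K(3)[OF near(1)[OF xy(1) x] near(1)[OF y]])
          (use near(2)[OF y] xy y x in \<open>auto simp: m_def mass_eq_norm_sq e\<^sub>0_def\<close>)
      moreover have "(y - x) / 2 * m y \<le> (y - x) / 2 * (m \<omega> + D / 2 * (y - \<omega>))"
        using near(3)[OF y] xy(2) by (intro mult_left_mono) auto
      moreover have "p y - p x = d y - d x + (y - x) / 2 * (m \<omega> + D / 2 * (y - \<omega>)) - D / 8 * (y - x)\<^sup>2"
        by (simp add: p_def field_simps power2_eq_square)
      moreover have "D / 8 * (y - x)\<^sup>2 \<le> 0" using slope(2) by (simp add: mult_nonpos_nonneg)
      moreover have "- ((x - y) / 2 * m y) = (y - x) / 2 * m y" by (simp add: field_simps)
      ultimately show "p x - K * (y - x)\<^sup>2 \<le> p y" by linarith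
    qed (use e in simp)
    then show ?thesis by (simp add: p_def)
  qed
  show ?thesis
  proof (rule that[OF e0])
    show "ground_state \<nu> \<mu> (\<omega> + e) (\<phi> (\<omega> + e))" if "0 < e" "e < e\<^sub>0" for e
      using near(1) that by simp
  qed (use lower in \<open>simp add: d_def m_def\<close>)
qed

text \<open>The test functions are \<open>(1 + e \<tau>) (u + e h)\<close> with \<open>-1 \<le> \<tau> \<le> 1\<close>. The constraint on \<open>h\<close>
  makes the coefficient of \<open>e\<^sup>2 \<tau>\<close> vanish, so that the maximum over \<open>\<tau>\<close> is interior.\<close>

lemma ground_state_energy_upper_expansion:
  fixes u h :: "(site, real) ell2"
  assumes gs: "ground_state \<nu> \<mu> \<omega> u"
    and h: "inner (L_plus \<nu> \<mu> \<omega> u u) h = (norm u)\<^sup>2"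
  obtains C e\<^sub>0 where "0 < e\<^sub>0" "\<And>e v. \<lbrakk>0 < e; e < e\<^sub>0; ground_state \<nu> \<mu> (\<omega> + e) v\<rbrakk> \<Longrightarrow>
    energy \<nu> \<mu> (\<omega> + e) v \<le> energy \<nu> \<mu> \<omega> u - e / 2 * (norm u)\<^sup>2
      + e\<^sup>2 * (energy_hess \<nu> \<mu> \<omega> u h / 2 - inner u h) + C * e ^ 3"
proof -
  define M q a b where "M = (norm u)\<^sup>2" and "q = energy_hess \<nu> \<mu> \<omega> u h"
    and "a = energy_hess \<nu> \<mu> \<omega> u u" and "b = inner u h"
  define N where "N = 2 * norm h + norm u"
  define C\<^sub>0 where "C\<^sub>0 = 5 / 4 * \<nu> * N + 9 / 2 * \<nu> * \<mu> * N ^ 3"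
  define C where "C = C\<^sub>0 * N ^ 3 + (3 / 2 * \<bar>q\<bar> + M + \<bar>b\<bar> + 1 / 2 * N\<^sup>2)"
  have N0: "0 \<le> N" and M0: "0 \<le> M" by (auto simp: N_def M_def)
  then have C00: "0 \<le> C\<^sub>0" using \<nu> \<mu> by (simp add: C\<^sub>0_def)
  have C: "0 \<le> C" using N0 M0 C00 by (simp add: C_def)
  have a: "a < 0"
    unfolding a_def using ground_stateD(1,2)[OF \<nu> \<mu> gs] by (intro energy_hess_ray_neg \<nu> \<mu>)
  have expand: "\<bar>energy \<nu> \<mu> (\<omega> + e) ((1 + e * \<tau>) *\<^sub>R (u + e *\<^sub>R h))
      - (energy \<nu> \<mu> \<omega> u - e / 2 * M + e\<^sup>2 * (q / 2 - b) + e\<^sup>2 * \<tau>\<^sup>2 * a / 2)\<bar> \<le> C * e ^ 3"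
    if e: "0 < e" "e < 1" and \<tau>: "\<bar>\<tau>\<bar> \<le> 1" for e \<tau>
  proof -
    define g where "g = (1 + e * \<tau>) *\<^sub>R h + \<tau> *\<^sub>R u"
    \<comment> \<open>\<open>X\<close> collects everything of order three in e that the change of
      frequency and the quadratic form produce; the Taylor remainder is bounded separately.\<close>
    define X where "X = (\<tau> + e * \<tau>\<^sup>2 / 2) * q + \<tau>\<^sup>2 * M - \<tau> * b - (norm g)\<^sup>2 / 2"
    have split: "(1 + e * \<tau>) *\<^sub>R (u + e *\<^sub>R h) = u + e *\<^sub>R g"
      by (simp add: g_def algebra_simps)
    have et: "\<bar>e * \<tau>\<bar> \<le> 1" using mult_mono[of e 1 "\<bar>\<tau>\<bar>" 1] e \<tau> by (simp add: abs_mult)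
    have "norm g \<le> \<bar>1 + e * \<tau>\<bar> * norm h + \<bar>\<tau>\<bar> * norm u"
      unfolding g_def using norm_triangle_ineq[of "(1 + e * \<tau>) *\<^sub>R h" "\<tau> *\<^sub>R u"] by simp
    also have "\<dots> \<le> 2 * norm h + 1 * norm u"
      using et \<tau> by (intro add_mono mult_right_mono) auto
    finally have g: "norm g \<le> N" by (simp add: N_def)
    have eg: "norm (e *\<^sub>R g) \<le> N" using mult_mono[of e 1 "norm g" N] e g by simp
    have g3: "C\<^sub>0 * norm (e *\<^sub>R g) ^ 3 \<le> C\<^sub>0 * N ^ 3 * e ^ 3"
      using C00 e mult_left_mono[OF power_mono[OF g norm_ge_zero, of 3], of "C\<^sub>0 * e ^ 3"]
      by (simp add: power_mult_distrib mult.assoc mult.left_commute mult.commute[of "e ^ 3"])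
    have Qg: "energy_hess \<nu> \<mu> \<omega> u (e *\<^sub>R g) = e\<^sup>2 * ((1 + e * \<tau>)\<^sup>2 * q + 2 * (1 + e * \<tau>) * \<tau> * M + \<tau>\<^sup>2 * a)"
      using energy_hess_linear_combination[OF \<nu> \<mu>, of \<omega> u e g 0 0]
        energy_hess_linear_combination[OF \<nu> \<mu>, of \<omega> u "1 + e * \<tau>" h \<tau> u] h
      by (simp add: g_def q_def a_def M_def)
    have "inner u g = (1 + e * \<tau>) * b + \<tau> * M"
      by (simp add: g_def b_def M_def inner_simps power2_norm_eq_inner)
    moreover have "(norm (u + e *\<^sub>R g))\<^sup>2 = M + 2 * e * inner u g + e\<^sup>2 * (norm g)\<^sup>2"
      unfolding M_def power2_norm_eq_inner
      by (simp add: inner_simps inner_commute[of g u] power2_eq_square[of e] distrib_left)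
    ultimately have ug: "(norm (u + e *\<^sub>R g))\<^sup>2
        = M + 2 * e * ((1 + e * \<tau>) * b + \<tau> * M) + e\<^sup>2 * (norm g)\<^sup>2"
      by (simp only:)
    have "\<bar>energy \<nu> \<mu> \<omega> (u + e *\<^sub>R g) - energy \<nu> \<mu> \<omega> u - 1 / 2 * energy_hess \<nu> \<mu> \<omega> u (e *\<^sub>R g)\<bar>
        \<le> C\<^sub>0 * norm (e *\<^sub>R g) ^ 3"
      using energy_Taylor[OF \<nu> \<mu> _ eg, of u \<omega>] ground_stateD(1)[OF \<nu> \<mu> gs]
      by (simp add: N_def C\<^sub>0_def)
    then have 1: "\<bar>energy \<nu> \<mu> \<omega> (u + e *\<^sub>R g) - energy \<nu> \<mu> \<omega> u - 1 / 2 * energy_hess \<nu> \<mu> \<omega> u (e *\<^sub>R g)\<bar>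
        \<le> C\<^sub>0 * N ^ 3 * e ^ 3"
      using g3 by linarith
    have \<tau>2: "\<tau>\<^sup>2 \<le> 1" using \<tau> by (simp add: abs_square_le_1)
    have "\<bar>(\<tau> + e * \<tau>\<^sup>2 / 2) * q\<bar> \<le> 3 / 2 * \<bar>q\<bar>"
    proof -
      have "e * \<tau>\<^sup>2 \<le> 1" "0 \<le> e * \<tau>\<^sup>2" using mult_mono[of e 1 "\<tau>\<^sup>2" 1] e \<tau>2 by auto
      then have "\<bar>\<tau> + e * \<tau>\<^sup>2 / 2\<bar> \<le> 3 / 2" using \<tau> by linarith
      then show ?thesis unfolding abs_mult by (rule mult_right_mono) simp
    qed
    moreover have "\<tau>\<^sup>2 * M \<le> M" "0 \<le> \<tau>\<^sup>2 * M" using \<tau>2 M0 by (auto simp: mult_left_le_one_le)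
    moreover have "\<bar>\<tau> * b\<bar> \<le> \<bar>b\<bar>" using \<tau> by (simp add: abs_mult mult_left_le_one_le)
    moreover have "(norm g)\<^sup>2 / 2 \<le> 1 / 2 * N\<^sup>2" using power_mono[OF g, of 2] by simp
    moreover have "0 \<le> (norm g)\<^sup>2 / 2" by simp
    ultimately have "\<bar>X\<bar> \<le> 3 / 2 * \<bar>q\<bar> + M + \<bar>b\<bar> + 1 / 2 * N\<^sup>2"
      unfolding X_def by linarith
    then have 2: "\<bar>e ^ 3 * X\<bar> \<le> (3 / 2 * \<bar>q\<bar> + M + \<bar>b\<bar> + 1 / 2 * N\<^sup>2) * e ^ 3"
      using e by (simp add: abs_mult)
    have "energy \<nu> \<mu> (\<omega> + e) ((1 + e * \<tau>) *\<^sub>R (u + e *\<^sub>R h))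
        - (energy \<nu> \<mu> \<omega> u - e / 2 * M + e\<^sup>2 * (q / 2 - b) + e\<^sup>2 * \<tau>\<^sup>2 * a / 2)
      = (energy \<nu> \<mu> \<omega> (u + e *\<^sub>R g) - energy \<nu> \<mu> \<omega> u - 1 / 2 * energy_hess \<nu> \<mu> \<omega> u (e *\<^sub>R g))
        + e ^ 3 * X"
      unfolding split energy_change_frequency[of \<nu> \<mu> "\<omega> + e" _ \<omega>] ug Qg X_def
      by (simp add: field_simps power2_eq_square power3_eq_cube)
    then show ?thesis using 1 2 unfolding C_def distrib_right by linarith
  qed
  show ?thesis
  proof (rule that[of "min 1 (- a / (4 * C + 1))" C])
    \<comment> \<open>Below this threshold 4 C e < -a, so the drop of size -a/2 times e^2 at \<tau>
      = 1 and \<tau> = -1 exceeds the two cubic errors; the summand 1 keeps the denominator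
      positive.\<close>
    show "0 < min 1 (- a / (4 * C + 1))" using a C by (simp add: divide_neg_pos)
    fix e v assume e: "0 < e" "e < min 1 (- a / (4 * C + 1))"
      and gv: "ground_state \<nu> \<mu> (\<omega> + e) v"
    define B where "B = energy \<nu> \<mu> \<omega> u - e / 2 * M + e\<^sup>2 * (q / 2 - b)"
    have e1: "e < 1" and "e < - a / (4 * C + 1)" using e by simp_all
    then have "e * (4 * C + 1) < - a" using C by (subst (asm) pos_less_divide_eq) auto
    then have "4 * C * e < - a" using e(1) by (simp add: algebra_simps)
    then have "e\<^sup>2 * (4 * C * e) < e\<^sup>2 * (- a)" using e(1) by (intro mult_strict_left_mono) auto
    then have gap: "4 * (C * e ^ 3) < - (e\<^sup>2 * a)"
      by (simp add: power2_eq_square power3_eq_cube algebra_simps)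
    have "\<exists>s\<in>{1 - e..1 + e}. energy \<nu> \<mu> (\<omega> + e) v \<le> energy \<nu> \<mu> (\<omega> + e) (s *\<^sub>R (u + e *\<^sub>R h))"
    proof (rule ground_state_energy_le_ray[OF \<nu> \<mu> gv, where t = 1])
      show "energy \<nu> \<mu> (\<omega> + e) ((1 - e) *\<^sub>R (u + e *\<^sub>R h)) < energy \<nu> \<mu> (\<omega> + e) (1 *\<^sub>R (u + e *\<^sub>R h))"
        using expand[OF e(1) e1, of "- 1"] expand[OF e(1) e1, of 0] gap
        unfolding B_def[symmetric] by (simp add: abs_le_iff)
      show "energy \<nu> \<mu> (\<omega> + e) ((1 + e) *\<^sub>R (u + e *\<^sub>R h)) < energy \<nu> \<mu> (\<omega> + e) (1 *\<^sub>R (u + e *\<^sub>R h))"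
        using expand[OF e(1) e1, of 1] expand[OF e(1) e1, of 0] gap
        unfolding B_def[symmetric] by (simp add: abs_le_iff)
    qed (use e1 e(1) in auto)
    then obtain s where s: "1 - e \<le> s" "s \<le> 1 + e"
      "energy \<nu> \<mu> (\<omega> + e) v \<le> energy \<nu> \<mu> (\<omega> + e) (s *\<^sub>R (u + e *\<^sub>R h))" by auto
    define \<tau> where "\<tau> = (s - 1) / e"
    have \<tau>: "\<bar>\<tau>\<bar> \<le> 1" "s = 1 + e * \<tau>"
      using s e(1) by (auto simp: \<tau>_def abs_le_iff divide_le_eq)
    have "e\<^sup>2 * \<tau>\<^sup>2 * a / 2 \<le> 0" using a by (simp add: mult_nonneg_nonpos)
    then show "energy \<nu> \<mu> (\<omega> + e) v \<le> energy \<nu> \<mu> \<omega> u - e / 2 * (norm u)\<^sup>2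
        + e\<^sup>2 * (energy_hess \<nu> \<mu> \<omega> u h / 2 - inner u h) + C * e ^ 3"
      using s(3) expand[OF e(1) e1 \<tau>(1)]
      unfolding \<tau>(2) M_def[symmetric] q_def[symmetric] b_def[symmetric] by linarith
  qed
qed

text \<open>The lower and upper expansions agree to first order in e. Dividing the comparison of the
  remaining terms by e^2 and letting e tend to 0 from the right leaves the coefficients of second
  order.\<close>

lemma second_variation_lower_bound:
  fixes \<phi> :: "real \<Rightarrow> (site, real) ell2"
  assumes \<omega>: "\<omega> < 0" and gs: "ground_state \<nu> \<mu> \<omega> (\<phi> \<omega>)"
    and family: "\<forall>\<^sub>F w in at \<omega>. ground_state \<nu> \<mu> w (\<phi> w)"
    and slope: "((\<lambda>w. mass (\<phi> w)) has_real_derivative D) (at \<omega>)" "D < 0"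
    and h: "inner (L_plus \<nu> \<mu> \<omega> (\<phi> \<omega>) (\<phi> \<omega>)) h = (norm (\<phi> \<omega>))\<^sup>2"
  shows "- D / 8 \<le> energy_hess \<nu> \<mu> \<omega> (\<phi> \<omega>) h / 2 - inner (\<phi> \<omega>) h"
proof -
  define Y where "Y = energy_hess \<nu> \<mu> \<omega> (\<phi> \<omega>) h / 2 - inner (\<phi> \<omega>) h"
  obtain e\<^sub>1 where e1: "0 < e\<^sub>1" "\<And>e. \<lbrakk>0 < e; e < e\<^sub>1\<rbrakk> \<Longrightarrow> ground_state \<nu> \<mu> (\<omega> + e) (\<phi> (\<omega> + e))"
    "\<And>e. \<lbrakk>0 < e; e < e\<^sub>1\<rbrakk> \<Longrightarrow> energy \<nu> \<mu> \<omega> (\<phi> \<omega>) - e / 2 * mass (\<phi> \<omega>) - D / 8 * e\<^sup>2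
      \<le> energy \<nu> \<mu> (\<omega> + e) (\<phi> (\<omega> + e))"
    by (rule ground_state_energy_lower_expansion[OF \<omega> gs family slope]) (rule that)
  obtain C e\<^sub>2 where e2: "0 < e\<^sub>2" "\<And>e v. \<lbrakk>0 < e; e < e\<^sub>2; ground_state \<nu> \<mu> (\<omega> + e) v\<rbrakk> \<Longrightarrow>
    energy \<nu> \<mu> (\<omega> + e) v \<le> energy \<nu> \<mu> \<omega> (\<phi> \<omega>) - e / 2 * (norm (\<phi> \<omega>))\<^sup>2 + e\<^sup>2 * Y + C * e ^ 3"
    by (rule ground_state_energy_upper_expansion[OF gs h, folded Y_def]) (rule that)
  have "- D / 8 \<le> Y + C * e" if "0 < e" "e < min e\<^sub>1 e\<^sub>2" for e
  proof -
    have "e\<^sup>2 * (- D / 8) \<le> e\<^sup>2 * (Y + C * e)"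
      using e1(3)[of e] e2(2)[OF _ _ e1(2)[of e]] that
      by (simp add: mass_eq_norm_sq algebra_simps power2_eq_square power3_eq_cube)
    moreover have "0 < e\<^sup>2" using that by simp
    ultimately show ?thesis by (rule mult_left_le_imp_le)
  qed
  then have "\<forall>\<^sub>F e in at_right 0. - D / 8 \<le> Y + C * e"
    unfolding eventually_at_right_field using e1(1) e2(1) by (intro exI[of _ "min e\<^sub>1 e\<^sub>2"]) auto
  moreover have "((\<lambda>e. Y + C * e) \<longlongrightarrow> Y + C * 0) (at_right 0)"
    by (intro tendsto_intros)
  ultimately show ?thesis
    using tendsto_lowerbound[of "\<lambda>e. Y + C * e" "Y + C * 0" "at_right (0::real)" "- D / 8"] by (simp add: Y_def)
qed

section \<open>From a rank-one lower bound to coercivity\<close>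

lemma energy_hess_ge_on_complement:
  fixes u r :: "(site, real) ell2"
  assumes \<kappa>: "0 < \<kappa>" and h: "\<And>h. inner (L_plus \<nu> \<mu> w u u) h = (norm u)\<^sup>2 \<Longrightarrow>
      \<kappa> \<le> energy_hess \<nu> \<mu> w u h / 2 - inner u h"
    and neg: "energy_hess \<nu> \<mu> w u u < 0" and r: "inner u r = 0"
  shows "2 * \<kappa> / (norm u) ^ 4 * (inner (L_plus \<nu> \<mu> w u u) r)\<^sup>2 \<le> energy_hess \<nu> \<mu> w u r"
proof -
  define M l q where "M = (norm u)\<^sup>2" and "l = inner (L_plus \<nu> \<mu> w u u) r"
    and "q = energy_hess \<nu> \<mu> w u r"
  define a where "a = energy_hess \<nu> \<mu> w u u"
  have a: "a < 0" using neg by (simp add: a_def)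
  have "u \<noteq> 0" using neg inner_L_plus_self[OF \<nu> \<mu>, of w u 0] by auto
  then have M: "0 < M" by (simp add: M_def)
  note comb = energy_hess_linear_combination[OF \<nu> \<mu>, of w u _ r _ u,
      folded l_def q_def a_def]
  have lin: "inner (L_plus \<nu> \<mu> w u u) (x *\<^sub>R r + c *\<^sub>R u) = x * l + c * a" for x c
    by (simp add: inner_simps l_def a_def inner_L_plus_self[OF \<nu> \<mu>])
  have iu: "inner u (x *\<^sub>R r + c *\<^sub>R u) = c * M" for x c
    using r by (simp add: inner_simps M_def power2_norm_eq_inner)
  have key: "\<kappa> \<le> (x\<^sup>2 * q + 2 * x * c * l + c\<^sup>2 * a) / 2 - c * M" if "x * l + c * a = M" for x c
    using h[of "x *\<^sub>R r + c *\<^sub>R u"] that unfolding lin iu comb M_def[symmetric] by simp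
  show ?thesis
  proof (cases "l = 0")
    case False
    \<comment> \<open>The multiple M/l of r is admissible and orthogonal to u, so the linear term
      drops out.\<close>
    then have "\<kappa> \<le> (M / l)\<^sup>2 * q / 2" using key[of "M / l" 0] by simp
    then have "2 * \<kappa> * l\<^sup>2 / M\<^sup>2 \<le> q"
      using False M by (simp add: divide_simps power_divide mult.commute split: if_splits)
    then show ?thesis by (simp add: M_def l_def q_def flip: power_mult)
  next
    case True
    have "0 \<le> q"
    proof (rule ccontr)
      assume q: "\<not> 0 \<le> q"
      \<comment> \<open>When l = 0 the constraint fixes only the component c along u, so the
        multiple x of r is free. A negative q would make the lower bound fail for large x; the
        chosen x gives \<open>x * q = - 2 * k + q\<close>.\<close>
      define c k where "c = M / a" and "k = c\<^sup>2 * a / 2 - c * M - \<kappa>"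
      define x where "x = 2 * k / (- q) + 1"
      have ca: "c * a = M" using a by (simp add: c_def)
      have k: "0 \<le> x\<^sup>2 * q / 2 + k" for x
        using key[of x c] ca True by (simp add: k_def add_divide_distrib)
      have k0: "0 \<le> k" using k[of 0] by simp
      then have x1: "1 \<le> x" using q by (simp add: x_def divide_nonneg_neg)
      then have "x \<le> x\<^sup>2" using power_increasing[of 1 2 x] by simp
      then have "x\<^sup>2 * q \<le> x * q" using q by (intro mult_right_mono_neg) auto
      moreover have "x * q = - 2 * k + q" using q by (simp add: x_def field_simps)
      ultimately show False using k[of x] q by linarith
    qed
    then show ?thesis using True by (simp add: l_def[symmetric] q_def)
  qed
qed

text \<open>The profile is small outside a finite set, where the potential absorbs at most half of
  -w; on that set the uniform bound is used. Thus the form is positive definite up to finitely many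
  coordinates.\<close>

lemma energy_hess_finite_perturbation:
  fixes u :: "(site, real) ell2"
  assumes "w < 0"
  obtains A where "finite A"
    "\<And>r. - w / 2 * (norm r)\<^sup>2 - 3 * \<nu> / \<mu> * (\<Sum>p\<in>A. (apply_ell2 r p)\<^sup>2) \<le> energy_hess \<nu> \<mu> w u r"
proof
  define A where "A = {p. - w \<le> (norm (apply_ell2 u p))\<^sup>2 * (6 * \<nu>)}"
  show A: "finite A"
  proof (rule finite_subset)
    show "A \<subseteq> {p. - w / (6 * \<nu>) \<le> (norm (apply_ell2 u p))\<^sup>2}"
      using \<nu> unfolding A_def by (subst pos_divide_le_eq) auto
    show "finite {p. - w / (6 * \<nu>) \<le> (norm (apply_ell2 u p))\<^sup>2}"
      using assms \<nu> by (intro finite_apply_ell2_ge) (simp add: divide_neg_pos)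
  qed
  fix r :: "(site, real) ell2"
  let ?g = "\<lambda>p. if p \<in> A then (apply_ell2 r p)\<^sup>2 else 0"
  have "(?g has_sum (\<Sum>p\<in>A. (apply_ell2 r p)\<^sup>2)) UNIV"
    by (rule has_sum_cong_neutral[THEN iffD1, OF _ _ _ has_sum_finite[OF A]]) auto
  moreover have "((\<lambda>p. (norm (apply_ell2 r p))\<^sup>2) has_sum (norm r)\<^sup>2) UNIV"
    unfolding norm_ell2_sq by (intro has_sum_infsum summable_on_norm_ell2_sq)
  ultimately have bound: "((\<lambda>p. - w / 2 * (norm (apply_ell2 r p))\<^sup>2 + 3 * \<nu> / \<mu> * ?g p) has_sum
      (- w / 2 * (norm r)\<^sup>2 + 3 * \<nu> / \<mu> * (\<Sum>p\<in>A. (apply_ell2 r p)\<^sup>2))) UNIV"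
    by (intro has_sum_add has_sum_cmult_right)
  have "(\<Sum>\<^sub>\<infinity>p. hess_density \<nu> \<mu> (apply_ell2 u p) (apply_ell2 r p))
      \<le> - w / 2 * (norm r)\<^sup>2 + 3 * \<nu> / \<mu> * (\<Sum>p\<in>A. (apply_ell2 r p)\<^sup>2)"
  proof (rule has_sum_mono[OF has_sum_infsum[OF summable_on_hess_density[OF \<nu> \<mu>, of u r]] bound])
    fix p
    show "hess_density \<nu> \<mu> (apply_ell2 u p) (apply_ell2 r p)
        \<le> - w / 2 * (norm (apply_ell2 r p))\<^sup>2 + 3 * \<nu> / \<mu> * ?g p"
    proof (cases "p \<in> A")
      case True
      have "0 \<le> - w / 2 * (norm (apply_ell2 r p))\<^sup>2"
        using assms by (intro mult_nonneg_nonneg) auto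
      then show ?thesis
        using True hess_density_bounds(2)[OF \<nu> \<mu>, of "apply_ell2 u p" "apply_ell2 r p"] by simp
    next
      case False
      then have "3 * \<nu> * (norm (apply_ell2 u p))\<^sup>2 \<le> - w / 2"
        by (simp add: A_def algebra_simps)
      from mult_right_mono[OF this zero_le_power2[of "norm (apply_ell2 r p)"]]
      show ?thesis
        using False hess_density_bounds(3)[OF \<nu> \<mu>, of "apply_ell2 u p" "apply_ell2 r p"] by simp
    qed
  qed
  moreover have "- w * (norm r)\<^sup>2 \<le> inner (- Laplacian r - w *\<^sub>R r) r"
    using inner_Laplacian_bounds(1)[of r] by (simp add: inner_simps power2_norm_eq_inner)
  ultimately show "- w / 2 * (norm r)\<^sup>2 - 3 * \<nu> / \<mu> * (\<Sum>p\<in>A. (apply_ell2 r p)\<^sup>2) \<le> energy_hess \<nu> \<mu> w u r"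
    unfolding energy_hess_def by (simp add: algebra_simps)
qed

lemma energy_hess_parallelogram:
  fixes u r s :: "(site, real) ell2"
  shows "energy_hess \<nu> \<mu> w u (r + s) + energy_hess \<nu> \<mu> w u (r - s)
    = 2 * energy_hess \<nu> \<mu> w u r + 2 * energy_hess \<nu> \<mu> w u s"
  using energy_hess_linear_combination[OF \<nu> \<mu>, of w u 1 r 1 s]
    energy_hess_linear_combination[OF \<nu> \<mu>, of w u 1 r "- 1" s] by simp

text \<open>Since the Hessian is nonnegative on the orthogonal complement of \<open>u\<close> and coercive up to
  finitely many coordinates, the parallelogram law turns a minimizing sequence into a Cauchy
  sequence once these coordinates converge.\<close>

lemma energy_hess_null_vector_on_complement:
  fixes u :: "(site, real) ell2"
  assumes w: "w < 0" and nonneg: "\<And>r. inner u r = 0 \<Longrightarrow> 0 \<le> energy_hess \<nu> \<mu> w u r"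
    and no_gap: "\<not> (\<exists>c>0. \<forall>r. inner u r = 0 \<longrightarrow> c * (norm r)\<^sup>2 \<le> energy_hess \<nu> \<mu> w u r)"
  obtains r where "inner u r = 0" "norm r = 1" "energy_hess \<nu> \<mu> w u r = 0"
proof -
  let ?Q = "energy_hess \<nu> \<mu> w u"
  have scale: "?Q (c *\<^sub>R r) = c\<^sup>2 * ?Q r" for c r
    using energy_hess_linear_combination[OF \<nu> \<mu>, of w u c r 0 0] by simp
  have "\<exists>r. inner u r = 0 \<and> norm r = 1 \<and> ?Q r \<le> 1 / real (Suc n)" for n
  proof -
    obtain r where r: "inner u r = 0" "?Q r < 1 / real (Suc n) * (norm r)\<^sup>2"
      using no_gap by (auto simp: not_le simp del: of_nat_Suc dest!: spec[of _ "1 / real (Suc n)"])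
    have "r \<noteq> 0" using r(2) scale[of 0 0] by auto
    then have "?Q (inverse (norm r) *\<^sub>R r) \<le> 1 / real (Suc n)"
      using r(2) unfolding scale by (simp add: field_simps)
    moreover have "inner u (inverse (norm r) *\<^sub>R r) = 0" using r(1) by simp
    ultimately show ?thesis using \<open>r \<noteq> 0\<close> by (intro exI[of _ "inverse (norm r) *\<^sub>R r"]) simp
  qed
  then obtain X where X: "\<And>n. inner u (X n) = 0" "\<And>n. norm (X n) = 1"
    "\<And>n. ?Q (X n) \<le> 1 / real (Suc n)" by metis
  obtain A where A: "finite A"
    "\<And>r. - w / 2 * (norm r)\<^sup>2 - 3 * \<nu> / \<mu> * (\<Sum>p\<in>A. (apply_ell2 r p)\<^sup>2) \<le> ?Q r"
    using energy_hess_finite_perturbation[OF w] by metis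
  have "\<bar>apply_ell2 (X n) p\<bar> \<le> 1" for n p
    using norm_apply_ell2_le[of "X n" p] X(2)[of n] by simp
  then obtain s :: "nat \<Rightarrow> nat" where s: "strict_mono s"
    "\<And>p. p \<in> A \<Longrightarrow> convergent (\<lambda>n. apply_ell2 (X (s n)) p)"
    using bounded_sequences_convergent_subseq[OF A(1), of "\<lambda>n. apply_ell2 (X n)" 1] by blast
  define Y where "Y n = X (s n)" for n
  define l where "l p = lim (\<lambda>n. apply_ell2 (Y n) p)" for p
  have l: "(\<lambda>n. apply_ell2 (Y n) p) \<longlonglongrightarrow> l p" if "p \<in> A" for p
    using s(2)[OF that] by (simp add: l_def Y_def convergent_LIMSEQ_iff)
  have QY: "?Q (Y n) \<le> 1 / real (Suc n)" for n
  proof -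
    have "1 / real (Suc (s n)) \<le> 1 / real (Suc n)"
      using seq_suble[OF s(1), of n] by (intro divide_left_mono) auto
    then show ?thesis using X(3)[of "s n"] by (simp add: Y_def)
  qed
  have QY0: "(\<lambda>n. ?Q (Y n)) \<longlonglongrightarrow> 0"
  proof (rule tendsto_sandwich[where f = "\<lambda>_. 0"])
    show "(\<lambda>n. 1 / real (Suc n)) \<longlonglongrightarrow> 0"
      by (rule LIMSEQ_Suc[OF lim_const_over_n])
    show "\<forall>\<^sub>F n in sequentially. 0 \<le> ?Q (Y n)"
      using nonneg X(1) by (simp add: Y_def)
  qed (use QY in auto)
  \<comment> \<open>Twice the Hessian comes from the parallelogram law; the factor 6 is twice the
    constant of the finite perturbation, since each coordinate difference is split at its limit; the
    prefactor undoes -w/2.\<close>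
  define g where "g n = 2 / (- w) * (2 * ?Q (Y n) + 6 * \<nu> / \<mu> * (\<Sum>p\<in>A. (apply_ell2 (Y n) p - l p)\<^sup>2))" for n
  have "Cauchy Y"
  proof (rule Cauchy_if_dist_sq_le)
    have "g \<longlonglongrightarrow> 2 / (- w) * (2 * 0 + 6 * \<nu> / \<mu> * (\<Sum>p\<in>A. (l p - l p)\<^sup>2))"
      unfolding g_def by (intro tendsto_intros QY0 l)
    then show "g \<longlonglongrightarrow> 0" by simp
    fix m n
    \<comment> \<open>Nonnegativity at the sum bounds the Hessian at the difference.\<close>
    have "0 \<le> ?Q (Y m + Y n)" using X(1) by (intro nonneg) (simp add: Y_def inner_simps)
    then have 1: "?Q (Y m - Y n) \<le> 2 * ?Q (Y m) + 2 * ?Q (Y n)"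
      using energy_hess_parallelogram[of w u "Y m" "Y n"] by linarith
    have "(a - b)\<^sup>2 \<le> 2 * (a - c)\<^sup>2 + 2 * (b - c)\<^sup>2" for a b c :: real
      using zero_le_power2[of "a + b - 2 * c"] by (simp add: power2_eq_square algebra_simps)
    then have "(\<Sum>p\<in>A. (apply_ell2 (Y m - Y n) p)\<^sup>2)
        \<le> (\<Sum>p\<in>A. 2 * (apply_ell2 (Y m) p - l p)\<^sup>2 + 2 * (apply_ell2 (Y n) p - l p)\<^sup>2)"
      by (intro sum_mono) simp
    then have "3 * \<nu> / \<mu> * (\<Sum>p\<in>A. (apply_ell2 (Y m - Y n) p)\<^sup>2)
        \<le> 3 * \<nu> / \<mu> * (2 * (\<Sum>p\<in>A. (apply_ell2 (Y m) p - l p)\<^sup>2) + 2 * (\<Sum>p\<in>A. (apply_ell2 (Y n) p - l p)\<^sup>2))"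
      using \<nu> \<mu> by (intro mult_left_mono) (simp_all add: sum.distrib sum_distrib_left)
    then have "- w / 2 * (norm (Y m - Y n))\<^sup>2 \<le> - w / 2 * (g m + g n)"
      using A(2)[of "Y m - Y n"] 1 w by (simp add: g_def algebra_simps)
    then show "(norm (Y m - Y n))\<^sup>2 \<le> g m + g n"
      using w by (simp add: mult_le_cancel_left)
  qed
  then obtain r where r: "Y \<longlonglongrightarrow> r"
    using Cauchy_convergent_iff convergent_def by blast
  show ?thesis
  proof (rule that)
    have "(\<lambda>n. inner u (Y n)) \<longlonglongrightarrow> inner u r" by (intro tendsto_intros r)
    then show "inner u r = 0" using X(1) by (simp add: Y_def LIMSEQ_const_iff)
    have "(\<lambda>n. norm (Y n)) \<longlonglongrightarrow> norm r" by (intro tendsto_intros r)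
    then show "norm r = 1" using X(2) by (simp add: Y_def LIMSEQ_const_iff)
    have "(\<lambda>n. ?Q (Y n)) \<longlonglongrightarrow> ?Q r"
      unfolding inner_L_plus_self[OF \<nu> \<mu>, symmetric]
      by (intro tendsto_inner bounded_linear.tendsto[OF bounded_linear_L_plus[OF \<nu> \<mu>]] r)
    then show "?Q r = 0" using QY0 LIMSEQ_unique by blast
  qed
qed

text \<open>Without a gap there is a unit null vector r in the complement. It minimizes a
  nonnegative form there, so \<open>L_plus\<close> maps it to a multiple k of u. The rank-one bound
  gives \<langle>L_plus u, r\<rangle> = 0; by symmetry k = 0, so r lies in the trivial
  kernel.\<close>

lemma energy_hess_coercive_on_complement:
  fixes u :: "(site, real) ell2"
  assumes w: "w < 0" and u: "u \<noteq> 0" and c0: "0 < c\<^sub>0"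
    and bound: "\<And>r. inner u r = 0 \<Longrightarrow> c\<^sub>0 * (inner (L_plus \<nu> \<mu> w u u) r)\<^sup>2 \<le> energy_hess \<nu> \<mu> w u r"
    and ker: "\<And>r. L_plus \<nu> \<mu> w u r = 0 \<Longrightarrow> r = 0"
  shows "\<exists>c>0. \<forall>r. inner u r = 0 \<longrightarrow> c * (norm r)\<^sup>2 \<le> energy_hess \<nu> \<mu> w u r"
proof (rule ccontr)
  let ?Q = "energy_hess \<nu> \<mu> w u" and ?L = "L_plus \<nu> \<mu> w u"
  assume no_gap: "\<not> ?thesis"
  have nonneg: "0 \<le> ?Q r" if "inner u r = 0" for r
    using bound[OF that] c0 by (meson mult_nonneg_nonneg less_imp_le order_trans zero_le_power2)
  obtain r where r: "inner u r = 0" "norm r = 1" "?Q r = 0"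
    using energy_hess_null_vector_on_complement[OF w nonneg no_gap] by metis
  have orth: "inner (?L r) h = 0" if h: "inner u h = 0" for h
  proof (rule ccontr)
    define B q where "B = inner (?L h) r" and "q = ?Q h"
    \<comment> \<open>The optimal step would be -B/q; q + 1 keeps the quotient meaningful when q = 0
      and still makes the form negative.\<close>
    define x where "x = - B / (q + 1)"
    assume "inner (?L r) h \<noteq> 0"
    then have B: "B \<noteq> 0"
      using L_plus_symmetric[OF \<nu> \<mu>, of w u r h] by (simp add: B_def inner_commute)
    have q: "0 \<le> q" using nonneg[OF h] by (simp add: q_def)
    have "0 \<le> ?Q (1 *\<^sub>R r + x *\<^sub>R h)" using r(1) h by (intro nonneg) (simp add: inner_simps)
    then have "0 \<le> 2 * x * B + x\<^sup>2 * q"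
      using energy_hess_linear_combination[OF \<nu> \<mu>, of w u 1 r x h] r(3) by (simp add: B_def q_def)
    also have "\<dots> = - (B\<^sup>2 * (q + 2)) / (q + 1)\<^sup>2"
      using q unfolding x_def by (simp add: divide_simps) (simp add: algebra_simps power2_eq_square)
    also have "\<dots> < 0" using B q by (simp add: divide_neg_pos)
    finally show False by simp
  qed
  define k where "k = inner u (?L r) / inner u u"
  define h where "h = ?L r - k *\<^sub>R u"
  have uh: "inner u h = 0" using u by (simp add: h_def k_def inner_simps)
  have "inner h h = inner (?L r - k *\<^sub>R u) h" by (simp only: h_def)
  also have "\<dots> = inner (?L r) h - k * inner u h" by (simp only: inner_diff_left inner_scaleR_left)
  finally have "inner h h = inner (?L r) h - k * inner u h" .
  then have "h = 0" using orth[OF uh] uh by simp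
  then have Lr: "?L r = k *\<^sub>R u" by (simp add: h_def)
  have "c\<^sub>0 * (inner (?L u) r)\<^sup>2 \<le> 0" using bound[OF r(1)] r(3) by simp
  then have "inner (?L u) r = 0" using c0 by (simp add: mult_le_0_iff)
  then have "k = 0"
    using u unfolding L_plus_symmetric[OF \<nu> \<mu>, of w u u r] Lr by simp
  then have "?L r = 0" using Lr by simp
  then show False using ker r(2) by fastforce
qed

text \<open>In the splitting v = r + a u, half of the coercivity on r absorbs the cross term by
  Young's inequality; what remains is a multiple of the square of a, hence of
  \<open>(inner u v)\<^sup>2\<close>.\<close>

lemma energy_hess_penalized_coercive:
  fixes u :: "(site, real) ell2"
  assumes u: "u \<noteq> 0" and c: "0 < c"
    and bound: "\<And>r. inner u r = 0 \<Longrightarrow> c * (norm r)\<^sup>2 \<le> energy_hess \<nu> \<mu> w u r"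
  obtains \<Gamma> where "0 < \<Gamma>" "\<And>v. c / 2 * (norm v)\<^sup>2 \<le> energy_hess \<nu> \<mu> w u v + \<Gamma> * (inner u v)\<^sup>2"
proof
  define M B q where "M = (norm u)\<^sup>2" and "B = norm (L_plus \<nu> \<mu> w u u)"
    and "q = energy_hess \<nu> \<mu> w u u"
  \<comment> \<open>The three summands pay for the cross term, for the possibly negative diagonal
    term, and for the share of u in the norm of v.\<close>
  define \<Gamma> where "\<Gamma> = (2 * B\<^sup>2 / c + \<bar>q\<bar> + c / 2 * M) / M\<^sup>2"
  have M: "0 < M" using u by (simp add: M_def)
  show "0 < \<Gamma>" using M c by (auto simp: \<Gamma>_def intro!: divide_pos_pos add_nonneg_pos)
  fix v
  define a where "a = inner u v / M"
  define r where "r = v - a *\<^sub>R u"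
  have ur: "inner u r = 0" using M by (simp add: r_def a_def inner_simps M_def power2_norm_eq_inner)
  have v: "v = 1 *\<^sub>R r + a *\<^sub>R u" by (simp add: r_def)
  have nv: "(norm v)\<^sup>2 = (norm r)\<^sup>2 + a\<^sup>2 * M"
    unfolding v M_def power2_norm_eq_inner using ur
    by (simp add: inner_simps inner_commute power2_eq_square[of a])
  define l where "l = inner (L_plus \<nu> \<mu> w u u) r"
  have Q: "energy_hess \<nu> \<mu> w u v = energy_hess \<nu> \<mu> w u r + 2 * a * l + a\<^sup>2 * q"
    unfolding v energy_hess_linear_combination[OF \<nu> \<mu>] by (simp add: q_def l_def)
  have "\<bar>l\<bar> \<le> B * norm r" unfolding l_def B_def by (rule Cauchy_Schwarz_ineq2)
  then have "\<bar>2 * a * l\<bar> \<le> 2 * \<bar>a\<bar> * (B * norm r)"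
    by (simp add: abs_mult mult_left_mono)
  also have "\<dots> \<le> c / 2 * (norm r)\<^sup>2 + 2 * B\<^sup>2 / c * a\<^sup>2"
  proof -
    have "0 \<le> c / 2 * (norm r - 2 * B * \<bar>a\<bar> / c)\<^sup>2" using c by simp
    also have "\<dots> = c / 2 * (norm r)\<^sup>2 + 2 * B\<^sup>2 / c * a\<^sup>2 - 2 * \<bar>a\<bar> * (B * norm r)"
      using c by (simp add: power2_eq_square field_simps)
    finally show ?thesis by simp
  qed
  finally have 1: "\<bar>2 * a * l\<bar> \<le> c / 2 * (norm r)\<^sup>2 + 2 * B\<^sup>2 / c * a\<^sup>2" .
  have 2: "- (\<bar>q\<bar> * a\<^sup>2) \<le> a\<^sup>2 * q"
    using mult_left_mono[of "- \<bar>q\<bar>" q "a\<^sup>2"] by (simp add: mult.commute)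
  have 3: "\<Gamma> * (inner u v)\<^sup>2 = 2 * B\<^sup>2 / c * a\<^sup>2 + \<bar>q\<bar> * a\<^sup>2 + c / 2 * (a\<^sup>2 * M)"
  proof -
    have "inner u v = M * a" using M by (simp add: a_def)
    then show ?thesis using M by (simp add: \<Gamma>_def power_mult_distrib field_simps)
  qed
  show "c / 2 * (norm v)\<^sup>2 \<le> energy_hess \<nu> \<mu> w u v + \<Gamma> * (inner u v)\<^sup>2"
    using 1 2 bound[OF ur] unfolding nv Q 3 distrib_left by linarith
qed

end

section \<open>Complex-valued families\<close>

lift_definition re_part :: "('i, complex) ell2 \<Rightarrow> ('i, real) ell2" is "\<lambda>u p. Re (u p)"
  by (erule square_summable_dominated[where B = 1]) (simp add: abs_Re_le_cmod)

lift_definition im_part :: "('i, complex) ell2 \<Rightarrow> ('i, real) ell2" is "\<lambda>u p. Im (u p)"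
  by (erule square_summable_dominated[where B = 1]) (simp add: abs_Im_le_cmod)

text \<open>The sequence space carries only a real vector space structure; this supplies phases and
  multiplication by the imaginary unit.\<close>

lift_definition cmult :: "complex \<Rightarrow> ('i, complex) ell2 \<Rightarrow> ('i, complex) ell2"
  is "\<lambda>c u p. c * u p"
proof -
  fix c :: complex and u :: "'i \<Rightarrow> complex"
  assume "square_summable u"
  then show "square_summable (\<lambda>p. c * u p)"
    by (rule square_summable_dominated[where B = "cmod c"]) (simp add: norm_mult)
qed

lemma inner_re_im: "inner u v = inner (re_part u) (re_part v) + inner (im_part u) (im_part v)"
  unfolding inner_ell2.rep_eq inner_complex_def
  by (subst infsum_add[symmetric])
    (simp_all add: re_part.rep_eq im_part.rep_eq summable_on_inner_ell2[of "re_part u" "re_part v", unfolded re_part.rep_eq, simplified]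
      summable_on_inner_ell2[of "im_part u" "im_part v", unfolded im_part.rep_eq, simplified])

lemma norm_sq_re_im: "(norm u)\<^sup>2 = (norm (re_part u))\<^sup>2 + (norm (im_part u))\<^sup>2"
  unfolding power2_norm_eq_inner by (rule inner_re_im)

lemma re_part_cmult: "re_part (cmult c u) = Re c *\<^sub>R re_part u - Im c *\<^sub>R im_part u"
  and im_part_cmult: "im_part (cmult c u) = Re c *\<^sub>R im_part u + Im c *\<^sub>R re_part u"
  by (transfer, simp)+

lemma re_im_linear:
  "re_part (u - v) = re_part u - re_part v" "re_part (- u) = - re_part u"
  "im_part (u - v) = im_part u - im_part v" "im_part (- u) = - im_part u"
  "re_part (x *\<^sub>R u) = x *\<^sub>R re_part u" "im_part (x *\<^sub>R u) = x *\<^sub>R im_part u"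
  by (transfer, simp)+

lemma re_im_Laplacian:
  "re_part (Laplacian u) = Laplacian (re_part u)" "im_part (Laplacian u) = Laplacian (im_part u)"
  by (transfer, auto simp: lap_def fun_eq_iff)+

lemma re_im_phase_rotation:
  "re_part (phase_rotation \<theta> u) = cos \<theta> *\<^sub>R u" "im_part (phase_rotation \<theta> u) = sin \<theta> *\<^sub>R u"
  by (transfer, simp add: Re_exp Im_exp)+

lemma cmult_exp_cancel: "cmult (exp (\<i> * of_real (- \<theta>))) (phase_rotation \<theta> u) = phase_rotation 0 u"
  by transfer (simp add: exp_minus field_simps)

lemma cmult_diff: "cmult c (u - v) = cmult c u - cmult c v"
  and cmult_uminus: "cmult c (- u) = - cmult c u"
  and cmult_scaleR: "cmult c (x *\<^sub>R u) = x *\<^sub>R cmult c u"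
  by (transfer, simp add: algebra_simps)+

lemma Laplacian_cmult: "Laplacian (cmult c u) = cmult c (Laplacian u)"
  by transfer (auto simp: lap_def fun_eq_iff algebra_simps)

lemma inner_cmult: "cmod c = 1 \<Longrightarrow> inner (cmult c u) (cmult c v) = inner u v"
proof -
  assume c: "cmod c = 1"
  have "inner (c * x) (c * y) = inner x y" for x y
  proof -
    have "inner (c * x) (c * y) = ((Re c)\<^sup>2 + (Im c)\<^sup>2) * inner x y"
      by (simp add: inner_complex_def algebra_simps power2_eq_square)
    then show ?thesis using c by (simp add: cmod_def)
  qed
  then show ?thesis by (simp add: inner_ell2.rep_eq cmult.rep_eq)
qed

lemma norm_cmult: "cmod c = 1 \<Longrightarrow> norm (cmult c u) = norm u"
  by (simp add: norm_eq_sqrt_inner inner_cmult)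

text \<open>Skew-symmetry for the real inner product, the source of both conservation laws.\<close>

lemma inner_cmult_i: "inner (cmult \<i> u) v = - inner u (cmult \<i> v)"
  by (simp add: inner_re_im re_part_cmult im_part_cmult inner_simps)

lemma inner_cmult_i_self: "inner (cmult \<i> u) u = 0"
  using inner_cmult_i[of u u] by (simp add: inner_commute)

lemma energy_cmult:
  assumes "cmod c = 1" shows "energy \<nu> \<mu> w (cmult c u) = energy \<nu> \<mu> w u"
proof -
  have "- Laplacian (cmult c u) - w *\<^sub>R cmult c u = cmult c (- Laplacian u - w *\<^sub>R u)"
    by (simp add: Laplacian_cmult cmult_diff cmult_uminus cmult_scaleR)
  then show ?thesis
    using assms by (simp add: energy_def inner_cmult cmult.rep_eq norm_mult)
qed

lemma energy_grad_change_frequency: "energy_grad \<nu> \<mu> w u = energy_grad \<nu> \<mu> 0 u - w *\<^sub>R u"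
  by (simp add: energy_grad_def)

lemma energy_grad_phase_rotation_0:
  assumes "energy_grad \<nu> \<mu> w u = 0"
  shows "energy_grad \<nu> \<mu> w (phase_rotation 0 u) = 0"
proof (rule ell2_eqI)
  fix p
  have "apply_ell2 (energy_grad \<nu> \<mu> w (phase_rotation 0 u)) p
      = of_real (apply_ell2 (energy_grad \<nu> \<mu> w u) p)"
    by (cases p) (simp add: energy_grad_def Laplacian.rep_eq saturation.rep_eq phase_rotation.rep_eq
        lap_def scaleR_conv_of_real)
  then show "apply_ell2 (energy_grad \<nu> \<mu> w (phase_rotation 0 u)) p = apply_ell2 0 p"
    using assms by simp
qed

lemma norm_diff_phase_rotation_sq:
  "(norm (\<psi> - phase_rotation \<theta> u))\<^sup>2 = (norm \<psi>)\<^sup>2 + (norm u)\<^sup>2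
    - 2 * (inner u (re_part \<psi>) * cos \<theta> + inner u (im_part \<psi>) * sin \<theta>)"
proof -
  have "inner \<psi> (phase_rotation \<theta> u) = inner u (re_part \<psi>) * cos \<theta> + inner u (im_part \<psi>) * sin \<theta>"
    by (simp add: inner_re_im re_im_phase_rotation inner_commute)
  moreover have "(norm (phase_rotation \<theta> u))\<^sup>2 = (norm u)\<^sup>2"
    by (simp add: norm_sq_re_im re_im_phase_rotation power_mult_distrib flip: distrib_right)
  moreover have "(norm (\<psi> - v))\<^sup>2 = (norm \<psi>)\<^sup>2 + (norm v)\<^sup>2 - 2 * inner \<psi> v" for v
    by (simp add: power2_norm_eq_inner inner_simps inner_commute)
  ultimately show ?thesis by simp
qed

text \<open>The squared distance is a constant minus 2 (a cos \<theta> + b sin \<theta>), which is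
  least at the argument of a + b i. The orthogonality of the imaginary part is the corresponding
  first-order condition.\<close>

lemma nearest_phase:
  obtains \<theta> where "infdist \<psi> (range (\<lambda>\<theta>. phase_rotation \<theta> u)) = norm (\<psi> - phase_rotation \<theta> u)"
    "inner u (im_part (cmult (exp (\<i> * of_real (- \<theta>))) \<psi>)) = 0"
proof
  define a b where "a = inner u (re_part \<psi>)" and "b = inner u (im_part \<psi>)"
  define \<rho> where "\<rho> = cmod (Complex a b)"
  define \<theta> where "\<theta> = Arg (Complex a b)"
  have "Complex a b = rcis \<rho> \<theta>" by (simp add: \<rho>_def \<theta>_def rcis_cmod_Arg)
  then have ab: "a = \<rho> * cos \<theta>" "b = \<rho> * sin \<theta>" by (simp_all add: complex_eq_iff rcis_def)
  have \<rho>: "0 \<le> \<rho>" by (simp add: \<rho>_def)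
  have max: "a * cos x + b * sin x \<le> a * cos \<theta> + b * sin \<theta>" for x
  proof -
    have "a * cos x + b * sin x = \<rho> * cos (x - \<theta>)" by (simp add: ab cos_diff algebra_simps)
    also have "\<dots> \<le> \<rho> * 1" using \<rho> by (intro mult_left_mono) auto
    also have "\<dots> = a * cos \<theta> + b * sin \<theta>"
      unfolding ab mult.assoc by (simp flip: distrib_left power2_eq_square)
    finally show ?thesis .
  qed
  have "norm (\<psi> - phase_rotation \<theta> u) \<le> norm (\<psi> - phase_rotation x u)" for x
    by (rule power2_le_imp_le) (use max[of x] in \<open>simp_all add: norm_diff_phase_rotation_sq a_def b_def\<close>)
  then have "norm (\<psi> - phase_rotation \<theta> u) \<le> infdist \<psi> (range (\<lambda>\<theta>. phase_rotation \<theta> u))"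
    by (simp add: infdist_notempty) (auto intro!: cINF_greatest simp: dist_norm)
  moreover have "infdist \<psi> (range (\<lambda>\<theta>. phase_rotation \<theta> u)) \<le> norm (\<psi> - phase_rotation \<theta> u)"
    unfolding dist_norm[symmetric] by (rule infdist_le) simp
  ultimately show "infdist \<psi> (range (\<lambda>\<theta>. phase_rotation \<theta> u)) = norm (\<psi> - phase_rotation \<theta> u)"
    by (rule antisym[rotated])
  show "inner u (im_part (cmult (exp (\<i> * of_real (- \<theta>))) \<psi>)) = 0"
    using ab by (simp add: im_part_cmult inner_simps Re_exp Im_exp a_def[symmetric] b_def[symmetric])
qed

lemma INF_norm_eq_infdist:
  "(INF \<theta>. norm (\<psi> - phase_rotation \<theta> u)) = infdist \<psi> (range (\<lambda>\<theta>. phase_rotation \<theta> u))"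
  by (simp add: infdist_notempty image_image dist_norm)

section \<open>Conserved quantities and stability\<close>

context
  fixes \<nu> \<mu> :: real
  assumes \<nu>: "\<nu> > 0" and \<mu>: "\<mu> > 0"
begin

text \<open>The equation says that i times the time derivative is the energy gradient at frequency
  0. Pairing this gradient with the derivative gives 0 by skew-symmetry; the mass is handled
  separately, and the two combine at every frequency w.\<close>

lemma solution_conserves:
  assumes T: "is_interval T" and sol: "solution_on \<nu> \<mu> T \<psi>" and st: "s \<in> T" "t \<in> T"
  shows "(norm (\<psi> s))\<^sup>2 = (norm (\<psi> t))\<^sup>2" "energy \<nu> \<mu> w (\<psi> s) = energy \<nu> \<mu> w (\<psi> t)"
proof -
  obtain \<psi>' where d: "\<And>t. t \<in> T \<Longrightarrow> (\<psi> has_vector_derivative \<psi>' t) (at t within T)"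
    and eq: "\<And>t p. t \<in> T \<Longrightarrow> \<i> * apply_ell2 (\<psi>' t) p + lap (apply_ell2 (\<psi> t)) p
        + of_real (\<nu> * (cmod (apply_ell2 (\<psi> t) p))\<^sup>2 / (1 + \<mu> * (cmod (apply_ell2 (\<psi> t) p))\<^sup>2))
            * apply_ell2 (\<psi> t) p = 0"
    using sol unfolding solution_on_def by blast
  have solve: "x = - l - y" if "x + l + y = 0" for x l y :: complex
    using that by algebra
  have grad: "cmult \<i> (\<psi>' t) = energy_grad \<nu> \<mu> 0 (\<psi> t)" if "t \<in> T" for t
  proof (rule ell2_eqI)
    fix p
    show "apply_ell2 (cmult \<i> (\<psi>' t)) p = apply_ell2 (energy_grad \<nu> \<mu> 0 (\<psi> t)) p"
      using solve[OF eq[OF that, of p]]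
      by (simp add: energy_grad_def cmult.rep_eq Laplacian.rep_eq saturation.rep_eq sat_coeff_def
          scaleR_conv_of_real)
  qed
  have orth: "inner (\<psi> t) (\<psi>' t) = 0" if "t \<in> T" for t
  proof -
    have "inner (\<psi> t) (\<psi>' t) = inner (cmult \<i> (\<psi> t)) (cmult \<i> (\<psi>' t))"
      by (simp add: inner_cmult)
    also have "\<dots> = - inner (cmult \<i> (\<psi> t)) (Laplacian (\<psi> t)) - inner (cmult \<i> (\<psi> t)) (saturation \<nu> \<mu> (\<psi> t))"
      unfolding grad[OF that] by (simp add: energy_grad_def inner_simps)
    also have "inner (cmult \<i> (\<psi> t)) (Laplacian (\<psi> t)) = 0"
    proof -
      \<comment> \<open>The Laplacian is symmetric and commutes with i while i is skew, so the
        pairing equals its own negative.\<close>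
      have "inner (cmult \<i> (\<psi> t)) (Laplacian (\<psi> t)) = inner (cmult \<i> (Laplacian (\<psi> t))) (\<psi> t)"
        by (metis inner_Laplacian Laplacian_cmult)
      also have "\<dots> = - inner (cmult \<i> (\<psi> t)) (Laplacian (\<psi> t))"
        unfolding inner_cmult_i[of "Laplacian (\<psi> t)"] inner_commute[of "Laplacian (\<psi> t)"] ..
      finally show ?thesis by simp
    qed
    also have "inner (cmult \<i> (\<psi> t)) (saturation \<nu> \<mu> (\<psi> t)) = 0"
      by (simp add: inner_ell2.rep_eq cmult.rep_eq saturation.rep_eq inner_complex_def)
    finally show ?thesis by simp
  qed
  have const: "f s = f t" if "\<And>x. x \<in> T \<Longrightarrow> (f has_derivative (\<lambda>h. 0)) (at x within T)" for f :: "real \<Rightarrow> real"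
    using has_derivative_zero_constant[of T f] T that st by (auto simp: is_interval_convex_1)
  show "(norm (\<psi> s))\<^sup>2 = (norm (\<psi> t))\<^sup>2"
  proof (rule const)
    fix x assume x: "x \<in> T"
    have "((\<lambda>t. inner (\<psi> t) (\<psi> t)) has_derivative
        (\<lambda>h. inner (\<psi> x) (h *\<^sub>R \<psi>' x) + inner (h *\<^sub>R \<psi>' x) (\<psi> x))) (at x within T)"
      by (intro has_derivative_inner d[OF x, unfolded has_vector_derivative_def])
    then show "((\<lambda>t. (norm (\<psi> t))\<^sup>2) has_derivative (\<lambda>h. 0)) (at x within T)"
      using orth[OF x] by (simp add: power2_norm_eq_inner inner_commute)
  qed
  show "energy \<nu> \<mu> w (\<psi> s) = energy \<nu> \<mu> w (\<psi> t)"
  proof (rule const)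
    fix x assume x: "x \<in> T"
    have "((\<lambda>t. energy \<nu> \<mu> w (\<psi> t)) has_derivative
        (\<lambda>h. inner (energy_grad \<nu> \<mu> w (\<psi> x)) (h *\<^sub>R \<psi>' x))) (at x within T)"
      by (rule has_derivative_compose[OF d[OF x, unfolded has_vector_derivative_def]
            energy_has_derivative[OF \<nu> \<mu>]])
    moreover have "inner (energy_grad \<nu> \<mu> w (\<psi> x)) (\<psi>' x) = 0"
      unfolding energy_grad_change_frequency[of _ _ w] grad[OF x, symmetric]
      using orth[OF x] by (simp add: inner_simps inner_cmult_i_self)
    ultimately show "((\<lambda>t. energy \<nu> \<mu> w (\<psi> t)) has_derivative (\<lambda>h. 0)) (at x within T)"
      by simp
  qed
qed

section \<open>The Lyapunov functional and the trapping argument\<close>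

lemma energy_hess_phase_rotation_0:
  "energy_hess \<nu> \<mu> w u (re_part v) + energy_hess \<nu> \<mu> w u (im_part v)
    \<le> energy_hess \<nu> \<mu> w (phase_rotation 0 u) v"
proof -
  let ?h = "\<lambda>r p. hess_density \<nu> \<mu> (apply_ell2 u p) (apply_ell2 r p)"
  have "hess_density \<nu> \<mu> (apply_ell2 (phase_rotation 0 u) p) (apply_ell2 v p)
      \<le> ?h (re_part v) p + ?h (im_part v) p" for p
  proof -
    \<comment> \<open>At a real profile the complex second variation is the form of
      \<open>L_plus\<close> on real parts and that of \<open>L_minus\<close> on imaginary parts.
      This nonnegative term is the pointwise gap between the two on imaginary parts.\<close>
    have "0 \<le> 2 * \<nu> / (1 + \<mu> * (apply_ell2 u p)\<^sup>2)\<^sup>2 * (apply_ell2 u p * Im (apply_ell2 v p))\<^sup>2"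
      using \<nu> by simp
    moreover have "?h (re_part v) p + ?h (im_part v) p
        = hess_density \<nu> \<mu> (apply_ell2 (phase_rotation 0 u) p) (apply_ell2 v p)
        + 2 * \<nu> / (1 + \<mu> * (apply_ell2 u p)\<^sup>2)\<^sup>2 * (apply_ell2 u p * Im (apply_ell2 v p))\<^sup>2"
      by (simp add: hess_density_def phase_rotation.rep_eq re_part.rep_eq im_part.rep_eq
          inner_complex_def cmod_power2 distrib_left)
    ultimately show ?thesis by linarith
  qed
  then have "(\<Sum>\<^sub>\<infinity>p. hess_density \<nu> \<mu> (apply_ell2 (phase_rotation 0 u) p) (apply_ell2 v p))
      \<le> (\<Sum>\<^sub>\<infinity>p. ?h (re_part v) p + ?h (im_part v) p)"
    by (intro infsum_mono summable_on_add summable_on_hess_density[OF \<nu> \<mu>])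
  also have "\<dots> = infsum (?h (re_part v)) UNIV + infsum (?h (im_part v)) UNIV"
    by (intro infsum_add summable_on_hess_density[OF \<nu> \<mu>])
  finally show ?thesis
    unfolding energy_hess_def inner_re_im[of "- Laplacian v - w *\<^sub>R v"] re_im_linear re_im_Laplacian
    by linarith
qed

text \<open>The phase condition removes the imaginary component along u. The real component along u
  is controlled by the mass defect, which equals 2 x + n^2 and hence is 2 x to first order.\<close>

lemma Lyapunov_coercive:
  fixes u :: "(site, real) ell2"
  assumes grad: "energy_grad \<nu> \<mu> w u = 0" and u: "u \<noteq> 0" and c: "0 < c"
    and bound: "\<And>r. inner u r = 0 \<Longrightarrow> c * (norm r)\<^sup>2 \<le> energy_hess \<nu> \<mu> w u r"
  obtains \<Gamma> \<rho> where "0 < \<Gamma>" "0 < \<rho>"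
    "\<And>v. \<lbrakk>inner u (im_part v) = 0; norm v \<le> \<rho>\<rbrakk> \<Longrightarrow> c / 8 * (norm v)\<^sup>2
      \<le> energy \<nu> \<mu> w (phase_rotation 0 u + v) - energy \<nu> \<mu> w (phase_rotation 0 u)
        + \<Gamma> * ((norm (phase_rotation 0 u + v))\<^sup>2 - (norm u)\<^sup>2)\<^sup>2"
proof -
  obtain \<Gamma>\<^sub>0 where G0: "0 < \<Gamma>\<^sub>0"
    "\<And>v. c / 2 * (norm v)\<^sup>2 \<le> energy_hess \<nu> \<mu> w u v + \<Gamma>\<^sub>0 * (inner u v)\<^sup>2"
    using energy_hess_penalized_coercive[OF \<nu> \<mu> u c bound] by metis
  let ?\<Phi> = "phase_rotation 0 u"
  define R where "R = norm u + 1"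
  define C where "C = 5 / 4 * \<nu> * R + 9 / 2 * \<nu> * \<mu> * R ^ 3"
  \<comment> \<open>The lower bound \<open>2 * x\<^sup>2 - n ^ 4\<close> for the squared mass defect
    turns this into \<open>\<Gamma>\<^sub>0 / 2 * x\<^sup>2\<close>, the penalty that half the
    Hessian needs.\<close>
  define \<Gamma> where "\<Gamma> = \<Gamma>\<^sub>0 / 4"
  \<comment> \<open>Half the penalized Hessian yields c/4; within this radius the cubic and quartic
    errors cost at most c/8, and c/8 remains.\<close>
  define \<rho> where "\<rho> = min 1 (c / (8 * (C + \<Gamma>)))"
  have \<Gamma>: "0 < \<Gamma>" using G0 by (simp add: \<Gamma>_def)
  have R: "0 \<le> R" by (simp add: R_def)
  then have C: "0 \<le> C" using \<nu> \<mu> by (simp add: C_def)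
  have CG: "0 < C + \<Gamma>" using C \<Gamma> by simp
  have norm_\<Phi>: "norm ?\<Phi> = norm u"
    by (rule power2_eq_imp_eq) (simp_all add: norm_sq_re_im[of ?\<Phi>] re_im_phase_rotation)
  show ?thesis
  proof (rule that[OF \<Gamma>])
    show "0 < \<rho>" using c CG by (simp add: \<rho>_def)
    fix v assume v: "inner u (im_part v) = 0" "norm v \<le> \<rho>"
    define n x where "n = norm v" and "x = inner u (re_part v)"
    have n: "0 \<le> n" "n \<le> 1" "n \<le> c / (8 * (C + \<Gamma>))" using v(2) by (auto simp: n_def \<rho>_def)
    have "norm ?\<Phi> \<le> R" "norm v \<le> R" using n(2) norm_ge_zero[of u]
      unfolding R_def n_def norm_\<Phi> by linarith+
    from energy_Taylor[OF \<nu> \<mu> this, of w]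
    have 1: "energy_hess \<nu> \<mu> w ?\<Phi> v / 2 - C * n ^ 3 \<le> energy \<nu> \<mu> w (?\<Phi> + v) - energy \<nu> \<mu> w ?\<Phi>"
      unfolding energy_grad_phase_rotation_0[OF grad] by (simp add: C_def n_def abs_le_iff)
    have 2: "c / 2 * (norm (re_part v))\<^sup>2 \<le> energy_hess \<nu> \<mu> w u (re_part v) + \<Gamma>\<^sub>0 * x\<^sup>2"
      unfolding x_def by (rule G0)
    have 3: "c / 2 * (norm (im_part v))\<^sup>2 \<le> energy_hess \<nu> \<mu> w u (im_part v)"
      using G0(2)[of "im_part v"] v(1) by simp
    have nn: "n\<^sup>2 = (norm (re_part v))\<^sup>2 + (norm (im_part v))\<^sup>2"
      unfolding n_def by (rule norm_sq_re_im)
    have "inner ?\<Phi> v = x"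
      by (simp add: inner_re_im re_im_phase_rotation x_def)
    then have mass: "(norm (?\<Phi> + v))\<^sup>2 - (norm u)\<^sup>2 = 2 * x + n\<^sup>2"
      unfolding norm_\<Phi>[symmetric] n_def
      by (simp add: power2_norm_eq_inner inner_simps inner_commute)
    have "0 \<le> 2 * (x + n\<^sup>2)\<^sup>2" by simp
    then have "2 * x\<^sup>2 - n ^ 4 \<le> (2 * x + n\<^sup>2)\<^sup>2"
      by (simp add: power2_sum power2_eq_square power4_eq_xxxx algebra_simps)
    from mult_left_mono[OF this, of \<Gamma>] \<Gamma>
    have 4: "\<Gamma>\<^sub>0 / 2 * x\<^sup>2 - \<Gamma> * n ^ 4 \<le> \<Gamma> * (2 * x + n\<^sup>2)\<^sup>2"
      by (simp add: \<Gamma>_def algebra_simps)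
    have "n ^ 4 \<le> n ^ 3" using n by (intro power_decreasing) auto
    then have "\<Gamma> * n ^ 4 \<le> \<Gamma> * n ^ 3" using \<Gamma> by simp
    moreover have "(C + \<Gamma>) * n ^ 3 \<le> c / 8 * n\<^sup>2"
    proof -
      have "n * (8 * (C + \<Gamma>)) \<le> c" using n(3) CG by (subst (asm) pos_le_divide_eq) auto
      then have "(C + \<Gamma>) * n \<le> c / 8" by (simp add: algebra_simps)
      from mult_right_mono[OF this zero_le_power2[of n]]
      show ?thesis by (simp add: power2_eq_square power3_eq_cube mult.assoc)
    qed
    ultimately have 5: "C * n ^ 3 + \<Gamma> * n ^ 4 \<le> c / 8 * n\<^sup>2" unfolding distrib_right by linarith
    have "c / 8 * n\<^sup>2 \<le> c / 4 * n\<^sup>2 - (C * n ^ 3 + \<Gamma> * n ^ 4)" using 5 by linarith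
    also have "\<dots> \<le> (energy \<nu> \<mu> w (?\<Phi> + v) - energy \<nu> \<mu> w ?\<Phi>) + \<Gamma> * (2 * x + n\<^sup>2)\<^sup>2"
      using 1 2 3 4 energy_hess_phase_rotation_0[of w u v] unfolding nn distrib_left by linarith
    finally show "c / 8 * (norm v)\<^sup>2 \<le> energy \<nu> \<mu> w (?\<Phi> + v) - energy \<nu> \<mu> w ?\<Phi>
        + \<Gamma> * ((norm (?\<Phi> + v))\<^sup>2 - (norm u)\<^sup>2)\<^sup>2"
      unfolding mass n_def .
  qed
qed

text \<open>A trapping argument: V is conserved, small near the orbit, and bounded below on the
  level set at distance e. The distance varies continuously on the time interval, so it cannot reach
  e from a smaller initial value.\<close>

lemma orbitally_stable_if_coercive:
  fixes u :: "(site, real) ell2"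
  assumes grad: "energy_grad \<nu> \<mu> w u = 0" and u: "u \<noteq> 0" and c: "0 < c"
    and bound: "\<And>r. inner u r = 0 \<Longrightarrow> c * (norm r)\<^sup>2 \<le> energy_hess \<nu> \<mu> w u r"
  shows "orbitally_stable \<nu> \<mu> u"
proof -
  let ?\<Phi> = "phase_rotation 0 u"
  define orb where "orb = range (\<lambda>\<theta>. phase_rotation \<theta> u)"
  obtain \<Gamma> \<rho> where \<rho>: "0 < \<rho>" and coercive:
    "\<And>v. \<lbrakk>inner u (im_part v) = 0; norm v \<le> \<rho>\<rbrakk> \<Longrightarrow> c / 8 * (norm v)\<^sup>2
      \<le> energy \<nu> \<mu> w (?\<Phi> + v) - energy \<nu> \<mu> w ?\<Phi> + \<Gamma> * ((norm (?\<Phi> + v))\<^sup>2 - (norm u)\<^sup>2)\<^sup>2"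
    using Lyapunov_coercive[OF grad u c bound] by metis
  define V where "V \<psi> = energy \<nu> \<mu> w \<psi> - energy \<nu> \<mu> w ?\<Phi> + \<Gamma> * ((norm \<psi>)\<^sup>2 - (norm u)\<^sup>2)\<^sup>2"
    for \<psi> :: "(site, complex) ell2"
  have norm_\<Phi>: "norm ?\<Phi> = norm u"
    by (rule power2_eq_imp_eq) (simp_all add: norm_sq_re_im[of ?\<Phi>] re_im_phase_rotation)
  have V_cmult: "V (cmult z \<psi>) = V \<psi>" if "cmod z = 1" for z \<psi>
    using that by (simp add: V_def energy_cmult norm_cmult)
  have nearest: "\<exists>z v. cmod z = 1 \<and> cmult z \<psi> = ?\<Phi> + v \<and> norm v = infdist \<psi> orb \<and> inner u (im_part v) = 0"
    for \<psi>
  proof -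
    obtain \<theta> where \<theta>: "infdist \<psi> orb = norm (\<psi> - phase_rotation \<theta> u)"
      "inner u (im_part (cmult (exp (\<i> * of_real (- \<theta>))) \<psi>)) = 0"
      unfolding orb_def by (rule nearest_phase)
    define z where "z = exp (\<i> * of_real (- \<theta>))"
    have z: "cmod z = 1" unfolding z_def by (rule norm_exp_i_times)
    have "cmult z \<psi> - ?\<Phi> = cmult z (\<psi> - phase_rotation \<theta> u)"
      unfolding cmult_diff z_def cmult_exp_cancel ..
    then have "norm (cmult z \<psi> - ?\<Phi>) = infdist \<psi> orb"
      using z \<theta>(1) by (simp add: norm_cmult)
    moreover have "inner u (im_part (cmult z \<psi> - ?\<Phi>)) = 0"
      using \<theta>(2) by (simp add: z_def re_im_linear re_im_phase_rotation)
    ultimately show ?thesis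
      using z by (intro exI[of _ z] exI[of _ "cmult z \<psi> - ?\<Phi>"]) simp
  qed
  have V_ge: "c / 8 * (infdist \<psi> orb)\<^sup>2 \<le> V \<psi>" if d: "infdist \<psi> orb \<le> \<rho>" for \<psi>
  proof -
    obtain z v where "cmod z = 1" "cmult z \<psi> = ?\<Phi> + v" "norm v = infdist \<psi> orb" "inner u (im_part v) = 0"
      using nearest[of \<psi>] by blast
    then show ?thesis
      using coercive[of v] d V_cmult[of z \<psi>] by (simp add: V_def)
  qed
  have "isCont V ?\<Phi>"
    unfolding V_def by (intro continuous_intros has_derivative_continuous[OF energy_has_derivative[OF \<nu> \<mu>]])
  moreover have "V ?\<Phi> = 0" by (simp add: V_def norm_\<Phi>)
  \<comment> \<open>Continuity at the single point ?\<Phi> gives smallness near the whole orbit,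
    because V is invariant under phases.\<close>
  ultimately have V_small: "\<exists>\<delta>>0. \<forall>\<psi>. infdist \<psi> orb < \<delta> \<longrightarrow> V \<psi> < k" if "0 < k" for k
  proof -
    have "\<exists>\<delta>>0. \<forall>\<psi>. dist \<psi> ?\<Phi> < \<delta> \<longrightarrow> dist (V \<psi>) (V ?\<Phi>) < k"
      using \<open>isCont V ?\<Phi>\<close> that unfolding continuous_at_eps_delta by simp
    then obtain \<delta> where \<delta>: "0 < \<delta>" "\<And>\<psi>. dist \<psi> ?\<Phi> < \<delta> \<Longrightarrow> \<bar>V \<psi>\<bar> < k"
      unfolding \<open>V ?\<Phi> = 0\<close> dist_real_def diff_zero by auto
    have "V \<psi> < k" if d: "infdist \<psi> orb < \<delta>" for \<psi>
    proof -
      obtain z v where "cmod z = 1" "cmult z \<psi> = ?\<Phi> + v" "norm v = infdist \<psi> orb"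
        using nearest[of \<psi>] by blast
      then show ?thesis
        using \<delta>(2)[of "cmult z \<psi>"] d V_cmult[of z \<psi>] by (simp add: dist_norm)
    qed
    then show ?thesis using \<delta>(1) by blast
  qed
  show ?thesis
    unfolding orbitally_stable_def INF_norm_eq_infdist orb_def[symmetric]
  proof (intro allI impI)
    fix \<epsilon> :: real assume \<epsilon>: "0 < \<epsilon>"
    define e where "e = min \<epsilon> \<rho>"
    have e: "0 < e" "e \<le> \<epsilon>" "e \<le> \<rho>" using \<epsilon> \<rho> by (auto simp: e_def)
    obtain \<delta> where \<delta>: "0 < \<delta>" "\<And>\<psi>. infdist \<psi> orb < \<delta> \<Longrightarrow> V \<psi> < c / 8 * e\<^sup>2"
      using V_small[of "c / 8 * e\<^sup>2"] c e by auto
    have "infdist (\<psi> t) orb < \<epsilon>"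
      if T: "is_interval T" "0 \<in> T" and sol: "solution_on \<nu> \<mu> T \<psi>"
        and small: "infdist (\<psi> 0) orb < min \<delta> e" and t: "t \<in> T" for T \<psi> t
    proof (rule ccontr)
      assume "\<not> infdist (\<psi> t) orb < \<epsilon>"
      then have large: "e \<le> infdist (\<psi> t) orb" using e by simp
      obtain \<psi>' where "\<And>t. t \<in> T \<Longrightarrow> (\<psi> has_vector_derivative \<psi>' t) (at t within T)"
        using sol unfolding solution_on_def by auto
      then have "continuous_on T \<psi>"
        unfolding continuous_on_eq_continuous_within
        by (intro ballI has_vector_derivative_continuous)
      then have "continuous_on T (\<lambda>s. infdist (\<psi> s) orb)" by (intro continuous_intros)
      then have "connected ((\<lambda>s. infdist (\<psi> s) orb) ` T)"
        using T(1) by (intro connected_continuous_image) (simp_all add: is_interval_connected_1)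
      moreover have "infdist (\<psi> 0) orb \<in> (\<lambda>s. infdist (\<psi> s) orb) ` T"
        "infdist (\<psi> t) orb \<in> (\<lambda>s. infdist (\<psi> s) orb) ` T" using T(2) t by auto
      ultimately have "e \<in> (\<lambda>s. infdist (\<psi> s) orb) ` T"
        by (rule connectedD_interval) (use small large in simp_all)
      then obtain s where s: "s \<in> T" "infdist (\<psi> s) orb = e" by auto
      have "c / 8 * e\<^sup>2 \<le> V (\<psi> s)" using V_ge[of "\<psi> s"] s(2) e by simp
      also have "\<dots> = V (\<psi> 0)"
        using solution_conserves[OF T(1) sol s(1) T(2)] by (simp add: V_def)
      also have "\<dots> < c / 8 * e\<^sup>2" using small by (intro \<delta>(2)) simp
      finally show False by simp
    qed
    then show "\<exists>\<delta>>0. \<forall>T \<psi>. is_interval T \<and> 0 \<in> T \<and> solution_on \<nu> \<mu> T \<psi> \<and> infdist (\<psi> 0) orb < \<delta>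
        \<longrightarrow> (\<forall>t\<in>T. infdist (\<psi> t) orb < \<epsilon>)"
      using \<delta>(1) e(1) by (intro exI[of _ "min \<delta> e"]) auto
  qed
qed

text \<open>Pairing the equation with u gives a left side of at most (8 - w) times the mass, while
  the saturation term is nonnegative.\<close>

lemma no_stationary_solution_above_band:
  assumes w: "8 < w" and grad: "energy_grad \<nu> \<mu> w u = 0"
  shows "u = 0"
proof -
  have "- Laplacian u - w *\<^sub>R u = saturation \<nu> \<mu> u" using grad by (simp add: energy_grad_def)
  then have "inner (- Laplacian u) u - w * (norm u)\<^sup>2 = inner (saturation \<nu> \<mu> u) u"
    by (metis inner_diff_left inner_scaleR_left power2_norm_eq_inner)
  moreover have "0 \<le> inner (saturation \<nu> \<mu> u) u"
    unfolding inner_saturation by (intro infsum_nonneg mult_nonneg_nonneg sat_coeff_nonneg \<nu> \<mu>) auto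
  ultimately have "(w - 8) * (norm u)\<^sup>2 \<le> 0"
    using inner_Laplacian_bounds(2)[of u] by (simp add: left_diff_distrib)
  then show ?thesis using w by (simp add: mult_le_0_iff)
qed

end

theorem theorem9p1:
  fixes \<nu> \<mu> \<omega> D :: real and \<phi> :: "real \<Rightarrow> (site, real) ell2"
  assumes "\<nu> > 0" and "\<mu> > 0" and "\<omega> \<in> {..<0} \<union> {8<..}"
    and "\<nu> / \<mu> \<notin> {- \<omega>..8 - \<omega>}" and "\<omega> < 0 \<longrightarrow> \<nu> / \<mu> > - \<omega>"
    and ground: "ground_state \<nu> \<mu> \<omega> (\<phi> \<omega>)" "localized (\<phi> \<omega>)"
    and ker_minus: "{s. L_minus \<nu> \<mu> \<omega> (\<phi> \<omega>) s = 0} = span {\<phi> \<omega>}"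
    and neg_plus: "\<exists>\<kappa><0. simple_eigenvalue (L_plus \<nu> \<mu> \<omega> (\<phi> \<omega>)) \<kappa> \<and>
           (\<forall>\<kappa>'<0. eigenvalue (L_plus \<nu> \<mu> \<omega> (\<phi> \<omega>)) \<kappa>' \<longrightarrow> \<kappa>' = \<kappa>)"
    and ker_plus: "{r. L_plus \<nu> \<mu> \<omega> (\<phi> \<omega>) r = 0} = {0}"
    and family: "\<forall>\<^sub>F w in at \<omega>. ground_state \<nu> \<mu> w (\<phi> w) \<and> localized (\<phi> w)"
    and slope: "((\<lambda>w. mass (\<phi> w)) has_real_derivative D) (at \<omega>)" "D < 0"
  shows "orbitally_stable \<nu> \<mu> (\<phi> \<omega>)"
proof -
  note \<nu>\<mu> = assms(1,2)
  note grad = ground_stateD(1)[OF \<nu>\<mu> ground(1)] and nonzero = ground_stateD(2)[OF \<nu>\<mu> ground(1)]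
  have \<omega>: "\<omega> < 0"
    using assms(3) no_stationary_solution_above_band[OF \<nu>\<mu> _ grad] nonzero by auto
  have family': "\<forall>\<^sub>F w in at \<omega>. ground_state \<nu> \<mu> w (\<phi> w)"
    using family by (rule eventually_mono) simp
  have "\<exists>c>0. \<forall>r. inner (\<phi> \<omega>) r = 0 \<longrightarrow> c * (norm r)\<^sup>2 \<le> energy_hess \<nu> \<mu> \<omega> (\<phi> \<omega>) r"
  proof (rule energy_hess_coercive_on_complement[OF \<nu>\<mu> \<omega> nonzero])
    \<comment> \<open>The constant is the one for the complement with \<kappa> = -D/8 from the
      second-order energy comparison.\<close>
    show "0 < 2 * (- D / 8) / norm (\<phi> \<omega>) ^ 4" using nonzero slope(2) by (simp add: divide_neg_pos)
    show "2 * (- D / 8) / norm (\<phi> \<omega>) ^ 4 * (inner (L_plus \<nu> \<mu> \<omega> (\<phi> \<omega>) (\<phi> \<omega>)) r)\<^sup>2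
        \<le> energy_hess \<nu> \<mu> \<omega> (\<phi> \<omega>) r" if "inner (\<phi> \<omega>) r = 0" for r
      using slope(2) that
      by (intro energy_hess_ge_on_complement[OF \<nu>\<mu>] energy_hess_ray_neg[OF \<nu>\<mu> grad nonzero]
          second_variation_lower_bound[where \<phi> = \<phi>, OF \<nu>\<mu> \<omega> ground(1) family' slope]) simp_all
    show "r = 0" if "L_plus \<nu> \<mu> \<omega> (\<phi> \<omega>) r = 0" for r
      using ker_plus that by blast
  qed
  then show ?thesis
    using orbitally_stable_if_coercive[OF \<nu>\<mu> grad nonzero] by blast
qed

end
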